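(* Let $G$ be a profinite group and let $\mathfrak N$ be the class of finite nilpotent groups. The following are equivalent: (1) $G$ is $\mathfrak N$-positive; (2) $G$ is $\mathfrak N$-bounded-positive; (3) $Z_\infty(G)$ is open in $G$ and $\mu(\Omega_{\mathfrak N}(G))=|G:Z_\infty(G)|^{-1}>0$; (4) $G$ is finite-by-pronilpotent.
   Context: For elements $x,y$ of a profinite group $G$, $\langle x,y\rangle$ denotes the closed subgroup they generate. A profinite group is pronilpotent (pro-$\mathfrak N$) if all its quotients by open normal subgroups are nilpotent. $G$ is finite-by-pronilpotent if it has a finite normal subgroup $K$ such that $G/K$ is pronilpotent. Let $\mu$ be the normalized Haar measure on $G$. For $x\in G$ put $\Omega_{\mathfrak N}(x,G)=\{g\in G\mid \langle x,g\rangle \text{ is pronilpotent}\}$ (a closed subset of $G$), $P_{\mathfrak N}(x,G)=\mu(\Omega_{\mathfrak N}(x,G))$ and $\Omega_{\mathfrak N}(G)=\bigcap_{x\in G}\Omega_{\mathfrak N}(x,G)$. $G$ is $\mathfrak N$-positive if $P_{\mathfrak N}(x,G)>0$ for all $x\in G$, and $\mathfrak N$-bounded-positive if there is a constant $\eta>0$ with $P_{\mathfrak N}(x,G)>\eta$ for all $x\in G$. The hypercenter $Z_\infty(G)$ of a profinite group $G$ is the set of all $x\in G$ such that $xN\in Z_\infty(G/N)$ for every open normal subgroup $N$ of $G$, where for a finite group $H$, $Z_\infty(H)$ is the usual hypercenter (the last term of the upper central series). *)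

theory Defs
  imports "HOL-Analysis.Analysis" "HOL-Algebra.Algebra"
begin

definition group_center :: "('a, 'b) monoid_scheme \<Rightarrow> 'a set" where
  "group_center G = {z \<in> carrier G. \<forall>x \<in> carrier G. z \<otimes>\<^bsub>G\<^esub> x = x \<otimes>\<^bsub>G\<^esub> z}"

primrec upper_central :: "('a, 'b) monoid_scheme \<Rightarrow> nat \<Rightarrow> 'a set" where
  "upper_central G 0 = {\<one>\<^bsub>G\<^esub>}"
| "upper_central G (Suc n) =
     {x \<in> carrier G. upper_central G n #>\<^bsub>G\<^esub> x \<in> group_center (G Mod upper_central G n)}"

definition nilpotent_group :: "('a, 'b) monoid_scheme \<Rightarrow> bool" where
  "nilpotent_group G \<longleftrightarrow> group G \<and> (\<exists>n. upper_central G n = carrier G)"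

text \<open>In a finite group the ascending upper central series stabilises, so this union is its last
  term. It is only used for finite groups.\<close>

definition finite_hypercenter :: "('a, 'b) monoid_scheme \<Rightarrow> 'a set" where
  "finite_hypercenter H = (\<Union>n. upper_central H n)"

locale topological_group = group G for G (structure) +
  fixes T :: "'a topology"
  assumes topspace_eq: "topspace T = carrier G"
    and continuous_mult: "continuous_map (prod_topology T T) T (\<lambda>(x, y). x \<otimes> y)"
    and continuous_inv: "continuous_map T T (\<lambda>x. inv x)"

locale profinite_group = topological_group +
  assumes compact: "compact_space T"
    and Hausdorff: "Hausdorff_space T"
    and totally_disconnected: "connectedin T S \<Longrightarrow> x \<in> S \<Longrightarrow> y \<in> S \<Longrightarrow> x = y"

definition closed_subgroup_generated ::
    "('a, 'b) monoid_scheme \<Rightarrow> 'a topology \<Rightarrow> 'a set \<Rightarrow> 'a set" where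
  "closed_subgroup_generated G T S = T closure_of (generate G S)"

definition quotient_topology :: "'a topology \<Rightarrow> ('a \<Rightarrow> 'c) \<Rightarrow> 'c topology" where
  "quotient_topology T q =
     topology (\<lambda>U. U \<subseteq> q ` topspace T \<and> openin T {x \<in> topspace T. q x \<in> U})"

lemma openin_quotient_topology:
  "openin (quotient_topology T q) U \<longleftrightarrow>
     U \<subseteq> q ` topspace T \<and> openin T {x \<in> topspace T. q x \<in> U}"
proof -
  let ?P = "\<lambda>U. U \<subseteq> q ` topspace T \<and> openin T {x \<in> topspace T. q x \<in> U}"
  have "istopology ?P"
    unfolding istopology_def
  proof (intro conjI allI impI)
    fix U V assume U: "?P U" and V: "?P V"
    show "U \<inter> V \<subseteq> q ` topspace T" using U by blast
    have "{x \<in> topspace T. q x \<in> U \<inter> V} =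
        {x \<in> topspace T. q x \<in> U} \<inter> {x \<in> topspace T. q x \<in> V}"
      by blast
    with U V show "openin T {x \<in> topspace T. q x \<in> U \<inter> V}" by auto
  next
    fix \<U> assume *: "\<forall>U\<in>\<U>. ?P U"
    then show "\<Union>\<U> \<subseteq> q ` topspace T" by blast
    have "{x \<in> topspace T. q x \<in> \<Union>\<U>} = (\<Union>U\<in>\<U>. {x \<in> topspace T. q x \<in> U})"
      by blast
    also have "openin T \<dots>" using * by blast
    finally show "openin T {x \<in> topspace T. q x \<in> \<Union>\<U>}" .
  qed
  then show ?thesis by (simp add: quotient_topology_def)
qed

lemma topspace_quotient_topology: "topspace (quotient_topology T q) = q ` topspace T"
proof -
  have "{x \<in> topspace T. q x \<in> q ` topspace T} = topspace T" by blast
  then have "openin (quotient_topology T q) (q ` topspace T)"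
    by (simp add: openin_quotient_topology)
  then show ?thesis
    by (metis openin_quotient_topology openin_subset openin_topspace subset_antisym)
qed

lemma quotient_map_quotient_topology: "quotient_map T (quotient_topology T q) q"
  by (auto simp: quotient_map_def topspace_quotient_topology openin_quotient_topology)

text \<open>Applied below only to closed subgroups and to quotients by finite normal subgroups of a
  profinite group. These are again profinite, so profiniteness is not repeated in the predicate.\<close>

definition pronilpotent :: "('a, 'b) monoid_scheme \<Rightarrow> 'a topology \<Rightarrow> bool" where
  "pronilpotent G T \<longleftrightarrow> (\<forall>N. N \<lhd> G \<longrightarrow> openin T N \<longrightarrow> nilpotent_group (G Mod N))"

definition finite_by_pronilpotent :: "('a, 'b) monoid_scheme \<Rightarrow> 'a topology \<Rightarrow> bool" where
  "finite_by_pronilpotent G T \<longleftrightarrow>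
     (\<exists>K. K \<lhd> G \<and> finite K \<and>
        pronilpotent (G Mod K) (quotient_topology T (\<lambda>x. K #>\<^bsub>G\<^esub> x)))"

definition hypercenter :: "('a, 'b) monoid_scheme \<Rightarrow> 'a topology \<Rightarrow> 'a set" where
  "hypercenter G T =
     {x \<in> carrier G. \<forall>N. N \<lhd> G \<longrightarrow> openin T N \<longrightarrow>
        N #>\<^bsub>G\<^esub> x \<in> finite_hypercenter (G Mod N)}"

text \<open>The profinite group need not be second countable, so regularity has to be required
  explicitly to single out the Haar measure among the Borel measures.\<close>

locale normalized_haar_measure =
  fixes G :: "('a, 'b) monoid_scheme" (structure)
    and T :: "'a topology"
    and \<mu> :: "'a measure"
  assumes space_haar: "space \<mu> = carrier G"
    and sets_haar: "sets \<mu> = sigma_sets (carrier G) {U. openin T U}"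
    and normalized: "emeasure \<mu> (carrier G) = 1"
    and left_invariant:
      "g \<in> carrier G \<Longrightarrow> A \<in> sets \<mu> \<Longrightarrow> emeasure \<mu> (g <# A) = emeasure \<mu> A"
    and outer_regular:
      "A \<in> sets \<mu> \<Longrightarrow> emeasure \<mu> A = (INF U \<in> {U. openin T U \<and> A \<subseteq> U}. emeasure \<mu> U)"
    and inner_regular:
      "openin T U \<Longrightarrow> emeasure \<mu> U = (SUP C \<in> {C. compactin T C \<and> C \<subseteq> U}. emeasure \<mu> C)"

definition Omega_elt :: "('a, 'b) monoid_scheme \<Rightarrow> 'a topology \<Rightarrow> 'a \<Rightarrow> 'a set" where
  "Omega_elt G T x =
     {g \<in> carrier G.
        let H = closed_subgroup_generated G T {x, g}
        in pronilpotent (G\<lparr>carrier := H\<rparr>) (subtopology T H)}"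

definition P_elt ::
    "('a, 'b) monoid_scheme \<Rightarrow> 'a topology \<Rightarrow> 'a measure \<Rightarrow> 'a \<Rightarrow> real" where
  "P_elt G T \<mu> x = measure \<mu> (Omega_elt G T x)"

definition Omega :: "('a, 'b) monoid_scheme \<Rightarrow> 'a topology \<Rightarrow> 'a set" where
  "Omega G T = (\<Inter>x \<in> carrier G. Omega_elt G T x)"

definition nilpotent_positive ::
    "('a, 'b) monoid_scheme \<Rightarrow> 'a topology \<Rightarrow> 'a measure \<Rightarrow> bool" where
  "nilpotent_positive G T \<mu> \<longleftrightarrow> (\<forall>x \<in> carrier G. P_elt G T \<mu> x > 0)"

definition nilpotent_bounded_positive ::
    "('a, 'b) monoid_scheme \<Rightarrow> 'a topology \<Rightarrow> 'a measure \<Rightarrow> bool" where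
  "nilpotent_bounded_positive G T \<mu> \<longleftrightarrow>
     (\<exists>\<eta> > 0. \<forall>x \<in> carrier G. P_elt G T \<mu> x > \<eta>)"

end

theory Submission
  imports Defs "HOL-Number_Theory.Cong"
begin

text \<open>
  Let \<open>G\<close> be positive. If no coset \<open>N a\<close> of an open normal subgroup had the property that all its
  elements share more than \<open>11/12\<close> of their nilpotent partners, one could descend through a sequence
  of cosets to a point whose set of partners is null. For a coset with this property the \<open>p\<close>-part and
  the \<open>p'\<close>-part of its elements are, modulo open normal subgroups, almost multiplicative; comparing
  \<open>a\<close> with \<open>a v\<close> yields endomorphisms of \<open>N\<close> that split it into primary parts, so that \<open>p\<close>-parts of
  \<open>N\<close> commute with \<open>p'\<close>-parts of \<open>N a\<close>. Doing this near every coset of \<open>N\<close> produces an open normal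
  subgroup whose \<open>p\<close>-parts commute with all \<open>p'\<close>-parts of \<open>G\<close>, that is, an open subgroup of the
  hypercenter.

  If the hypercenter has finite index \<open>m\<close>, then in every finite quotient the commutators of elements
  of coprime order form a normal set whose size is bounded in terms of \<open>m\<close>, and the arguments of Schur
  and Dietzmann bound the nilpotent residual they generate; hence \<open>G\<close> is finite-by-pronilpotent.
  Conversely, if \<open>K\<close> is finite and \<open>G/K\<close> is pronilpotent, an open normal subgroup meeting \<open>K\<close>
  trivially lies in the hypercenter. Finally \<open>\<Omega>(G)\<close> is the hypercenter itself, and \<open>\<Omega>(x, G)\<close>
  contains \<open>Z\<^sub>\<infinity>(G)\<close> for every \<open>x\<close>, which gives the uniform bound.\<close>

section \<open>Primary parts\<close>

text \<open>Positivity speaks about one element at a time, while hypercentrality asks primary parts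
  of different elements to commute. The link is a common partner: in a nilpotent pair taking
  \<open>p\<close>-parts is multiplicative, so if \<open>y\<close> is a partner of several elements
  at once, relations between their parts hold up to a factor depending on \<open>y\<close>, and this
  factor cancels. Positive measure alone does not make partner sets meet; in a dense coset each
  exceptional set fills at most a twelfth, and no more than five are excluded together, so the loss
  stays below one half. One half matters wherever a subgroup is recognised by containing most
  elements of a group. This calculus is formal and yields idempotent endomorphisms of
  \<open>N\<close>, but it does not show that the image belonging to the \<open>p\<close>-parts is a
  \<open>p\<close>-group; a Sylow count supplies that. Nor does one prime suffice: the leftover
  factor is only seen to vanish when the splittings for all primes are compared. All estimates live
  in finite quotients, with bounds independent of the quotient, and compactness carries them back to
  \<open>G\<close>.\<close>

lemma (in group) inv_cancel_left: "x \<in> carrier G \<Longrightarrow> y \<in> carrier G \<Longrightarrow> inv x \<otimes> (x \<otimes> y) = y"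
  by (simp add: m_assoc[symmetric])

lemma (in group) cancel_inv_left: "x \<in> carrier G \<Longrightarrow> y \<in> carrier G \<Longrightarrow> x \<otimes> (inv x \<otimes> y) = y"
  by (simp add: m_assoc[symmetric])

text \<open>As simp rules these cancel inverses in right-associated words, which settles the
  identities between group words met below.\<close>

lemmas (in group) group_word = m_assoc inv_mult_group inv_cancel_left cancel_inv_left

lemma (in group) pow_eq_pow_cong:
  assumes "x \<in> carrier G" "x [^] (n::nat) = \<one>" "[i = j] (mod n)"
  shows "x [^] i = x [^] j"
proof -
  have "x [^] k = x [^] (k mod n)" for k :: nat
  proof -
    have "x [^] k = x [^] (n * (k div n) + k mod n)" by simp
    also have "\<dots> = x [^] (n * (k div n)) \<otimes> x [^] (k mod n)"
      using assms(1) by (simp add: nat_pow_mult)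
    also have "x [^] (n * (k div n)) = \<one>"
      using assms(1,2) by (metis nat_pow_one nat_pow_pow)
    finally show ?thesis using assms(1) by simp
  qed
  then show ?thesis using assms(3) by (metis cong_def)
qed

lemma (in group) pow_dvd_one:
  assumes "x \<in> carrier G" "x [^] (n::nat) = \<one>" "n dvd m"
  shows "x [^] m = \<one>"
  using pow_eq_pow_cong[OF assms(1,2), of m 0] assms(3) by (simp add: cong_0_iff)

text \<open>In a group of exponent \<open>p\<^sup>a t\<close> with \<open>p\<close> prime to \<open>t\<close>, the powers \<open>x\<^sup>e\<close> and \<open>x\<^sup>f\<close> are
  the \<open>p\<close>-part and the \<open>p'\<close>-part of \<open>x\<close>. Fixing the exponents globally makes taking primary parts
  compatible with homomorphisms and subgroups.\<close>

definition primary_split :: "nat \<Rightarrow> nat \<Rightarrow> nat \<Rightarrow> nat \<Rightarrow> nat \<Rightarrow> bool" where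
  "primary_split p a t e f \<longleftrightarrow>
     Factorial_Ring.prime p \<and> 0 < t \<and> coprime p t \<and>
     [e = 1] (mod p ^ a) \<and> [e = 0] (mod t) \<and> [f = 0] (mod p ^ a) \<and> [f = 1] (mod t)"

text \<open>The power of \<open>p\<close> is split off by multiplicity, the exponents come from the
  Chinese remainder theorem. The prime need not divide \<open>n\<close>: then \<open>a = 0\<close>
  and all \<open>p\<close>-parts are trivial.\<close>

lemma primary_split_exists:
  assumes "Factorial_Ring.prime p" "0 < (n::nat)"
  obtains a t e f where "primary_split p a t e f" "n = p ^ a * t"
proof -
  obtain t where t: "n = p ^ multiplicity p n * t" "\<not> p dvd t"
    using assms multiplicity_decompose'[of n p] by (metis not_prime_unit not_gr0)
  have cop: "coprime p t" using t assms by (simp add: prime_imp_coprime)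
  then have "coprime (p ^ multiplicity p n) t" by simp
  then obtain e f where "[e = 1] (mod p ^ multiplicity p n)" "[e = 0] (mod t)"
      "[f = 0] (mod p ^ multiplicity p n)" "[f = 1] (mod t)"
    by (metis binary_chinese_remainder_nat)
  moreover have "0 < t" using t assms by (cases t) auto
  ultimately show thesis using that[of "multiplicity p n" t e f] assms cop t
    by (simp add: primary_split_def)
qed

locale prime_split =
  fixes p a t e f :: nat
  assumes split: "primary_split p a t e f"
begin

lemma prime_p: "Factorial_Ring.prime p" and t_pos: "0 < t" and coprime_p_t: "coprime p t"
  and coprime_pa_t: "coprime (p ^ a) t"
  using split by (auto simp: primary_split_def)

lemma exponent_pos:
  assumes "p dvd p ^ a * t" shows "0 < a"
proof (rule ccontr)
  assume "\<not> 0 < a"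
  then have "p dvd t" using assms by simp
  then show False using coprime_p_t prime_p by (metis coprime_common_divisor dvd_refl not_prime_unit)
qed

lemma cong_split: "[i = j] (mod p ^ a) \<Longrightarrow> [i = j] (mod t) \<Longrightarrow> [i = j] (mod p ^ a * t)"
  using coprime_pa_t by (simp add: coprime_cong_mult_nat)

lemma congs: "[e = 1] (mod p ^ a)" "[e = 0] (mod t)" "[f = 0] (mod p ^ a)" "[f = 1] (mod t)"
  using split by (auto simp: primary_split_def)

text \<open>\<open>e\<close> and \<open>f\<close> are complementary orthogonal idempotents of the
  integers modulo \<open>p ^ a * t\<close>; each congruence is checked modulo the two coprime
  factors.\<close>

lemma
  shows cong_ef: "[e + f = 1] (mod p ^ a * t)" and cong_ee: "[e * e = e] (mod p ^ a * t)"
    and cong_ff: "[f * f = f] (mod p ^ a * t)" and cong_ef0: "[e * f = 0] (mod p ^ a * t)"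
  using cong_add[OF congs(1,3)] cong_add[OF congs(2,4)]
    cong_mult[OF congs(1) congs(1)] cong_mult[OF congs(2) congs(2)]
    cong_mult[OF congs(3) congs(3)] cong_mult[OF congs(4) congs(4)]
    cong_mult[OF congs(1) congs(3)] cong_mult[OF congs(2) congs(4)] congs
  by (auto intro!: cong_split elim: cong_trans cong_sym intro: cong_trans dest: cong_sym)

end

locale group_split = group G + prime_split p a t e f for G (structure) and p a t e f +
  assumes exponent: "x \<in> carrier G \<Longrightarrow> x [^] (p ^ a * t) = \<one>"
begin

lemma pow_cong: "x \<in> carrier G \<Longrightarrow> [i = j] (mod p ^ a * t) \<Longrightarrow> x [^] i = x [^] j"
  using pow_eq_pow_cong exponent by blast

lemma part_mult: "x \<in> carrier G \<Longrightarrow> x [^] e \<otimes> x [^] f = x"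
  using pow_cong[OF _ cong_ef] by (simp add: nat_pow_mult)

lemma part_mult': "x \<in> carrier G \<Longrightarrow> x [^] f \<otimes> x [^] e = x"
  using pow_cong[OF _ cong_ef] by (simp add: nat_pow_mult add.commute)

lemma part_ee: "x \<in> carrier G \<Longrightarrow> (x [^] e) [^] e = x [^] e"
  using pow_cong[OF _ cong_ee] by (simp add: nat_pow_pow)

lemma part_ff: "x \<in> carrier G \<Longrightarrow> (x [^] f) [^] f = x [^] f"
  using pow_cong[OF _ cong_ff] by (simp add: nat_pow_pow)

lemma part_ef: "x \<in> carrier G \<Longrightarrow> (x [^] e) [^] f = \<one>"
  using pow_cong[OF _ cong_ef0] by (simp add: nat_pow_pow)

lemma part_fe: "x \<in> carrier G \<Longrightarrow> (x [^] f) [^] e = \<one>"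
  using pow_cong[OF _ cong_ef0] by (simp add: nat_pow_pow mult.commute)

lemma part_pow_pa: "x \<in> carrier G \<Longrightarrow> (x [^] e) [^] (p ^ a) = \<one>"
proof -
  assume x: "x \<in> carrier G"
  have "t dvd e" using congs(2) by (simp add: cong_0_iff)
  then have "p ^ a * t dvd e * p ^ a" by (simp add: mult.commute mult_dvd_mono)
  then show ?thesis using x pow_dvd_one[OF x exponent] by (simp add: nat_pow_pow)
qed

lemma part_pow_t: "x \<in> carrier G \<Longrightarrow> (x [^] f) [^] t = \<one>"
proof -
  assume x: "x \<in> carrier G"
  have "p ^ a dvd f" using congs(3) by (simp add: cong_0_iff)
  then have "p ^ a * t dvd f * t" by simp
  then show ?thesis using x pow_dvd_one[OF x exponent] by (simp add: nat_pow_pow)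
qed

lemma ord_dvd: "x \<in> carrier G \<Longrightarrow> ord x dvd p ^ a * t"
  using exponent pow_eq_id by blast

text \<open>The order of \<open>x\<close> divides \<open>p ^ a * t\<close> and is prime to
  \<open>t\<close>, hence divides \<open>p ^ a\<close>.\<close>

lemma part_e_id:
  assumes x: "x \<in> carrier G" and "x [^] m = \<one>" "coprime m t"
  shows "x [^] e = x" "x [^] f = \<one>"
proof -
  have "ord x dvd m" using assms pow_eq_id by blast
  then have "coprime (ord x) t" using assms(3) by (meson coprime_divisors dvd_refl)
  then have "ord x dvd p ^ a" using ord_dvd[OF x] by (simp add: coprime_dvd_mult_left_iff)
  then have "x [^] (p ^ a) = \<one>" using x pow_eq_id by blast
  then show "x [^] e = x" "x [^] f = \<one>"
    using x pow_eq_pow_cong[OF x _ congs(1)] pow_eq_pow_cong[OF x _ congs(3)] by simp_all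
qed

lemma part_f_id:
  assumes x: "x \<in> carrier G" and "x [^] m = \<one>" "coprime m p"
  shows "x [^] f = x" "x [^] e = \<one>"
proof -
  have "ord x dvd m" using assms pow_eq_id by blast
  then have "coprime (ord x) (p ^ a)" using assms(3)
    by (metis coprime_divisors coprime_power_right_iff dvd_refl)
  then have "ord x dvd t" using ord_dvd[OF x] by (simp add: coprime_dvd_mult_right_iff)
  then have "x [^] t = \<one>" using x pow_eq_id by blast
  then show "x [^] f = x" "x [^] e = \<one>"
    using x pow_eq_pow_cong[OF x _ congs(4)] pow_eq_pow_cong[OF x _ congs(2)] by simp_all
qed

lemma part_e_id': "x \<in> carrier G \<Longrightarrow> x [^] (p ^ k) = \<one> \<Longrightarrow> x [^] e = x"
  using part_e_id(1) coprime_p_t by simp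

lemma subgroup_split: "subgroup K G \<Longrightarrow> group_split (G\<lparr>carrier := K\<rparr>) p a t e f"
  using split exponent subgroup.subgroup_is_group[of K G] subgroup.subset[of K G]
  by (auto simp: group_split_def group_split_axioms_def prime_split_def is_group simp flip: nat_pow_consistent)

lemma quotient_split: "N \<lhd> G \<Longrightarrow> group_split (G Mod N) p a t e f"
  using split exponent normal.factorgroup_is_group[of N G] normal.FactGroup_pow[of N G]
  by (auto simp: group_split_def group_split_axioms_def prime_split_def carrier_FactGroup
      subgroup.subset normal_imp_subgroup)

end

text \<open>This avoids writing \<open>x\<close> as a product over all primes. The exponents
  \<open>k\<close> with \<open>x [^] k \<in> K\<close> are the multiples of the least positive one,
  \<open>d\<close>. A prime \<open>q\<close> dividing \<open>d\<close> would divide the exponent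
  \<open>e\<close> of the \<open>q\<close>-part, which is 1 modulo \<open>q\<close>; so
  \<open>d = 1\<close>.\<close>

lemma (in group) mem_subgroup_if_parts:
  assumes K: "subgroup K G" and x: "x \<in> carrier G" "x [^] (n::nat) = \<one>" and n: "0 < n"
    and parts: "\<And>p a t e f. primary_split p a t e f \<Longrightarrow> n = p ^ a * t \<Longrightarrow> x [^] e \<in> K"
  shows "x \<in> K"
proof -
  define d where "d = (LEAST k::nat. 0 < k \<and> x [^] k \<in> K)"
  have ex: "0 < n \<and> x [^] n \<in> K" using n x subgroup.one_closed[OF K] by simp
  have "0 < d \<and> x [^] d \<in> K" unfolding d_def
    using ex by (rule LeastI[where P = "\<lambda>k::nat. 0 < k \<and> x [^] k \<in> K" and k = n])
  then have d: "0 < d" "x [^] d \<in> K" by auto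
  have Kpow: "y [^] k \<in> K" if "y \<in> K" for y and k :: nat
    using subgroup.one_closed[OF K] subgroup.m_closed[OF K] that by (induct k) auto
  have div: "d dvd k" if k: "x [^] k \<in> K" for k
  proof (rule ccontr)
    assume "\<not> d dvd k"
    then have pos: "0 < k mod d" by (simp add: mod_greater_zero_iff_not_dvd)
    have "x [^] k = x [^] (d * (k div d)) \<otimes> x [^] (k mod d)"
      using x by (simp add: nat_pow_mult)
    then have "x [^] (k mod d) = inv (x [^] (d * (k div d))) \<otimes> x [^] k"
      using x by (simp add: inv_cancel_left)
    moreover have "x [^] (d * (k div d)) \<in> K"
      using Kpow[OF d(2)] x by (simp add: nat_pow_pow)
    ultimately have "x [^] (k mod d) \<in> K"
      using k subgroup.m_closed[OF K] subgroup.m_inv_closed[OF K] by simp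
    then have "(LEAST j::nat. 0 < j \<and> x [^] j \<in> K) \<le> k mod d" using pos by (intro Least_le) simp
    then show False using mod_less_divisor[OF d(1), of k] by (simp flip: d_def)
  qed
  have "d = 1"
  proof (rule ccontr)
    assume "d \<noteq> 1"
    then obtain q where q: "Factorial_Ring.prime q" "q dvd d" using prime_factor_nat by blast
    obtain a t e f where s: "primary_split q a t e f" "n = q ^ a * t"
      using primary_split_exists[OF q(1) n] by blast
    have "q dvd n" using q(2) div[of n] ex dvd_trans by blast
    then have "a \<noteq> 0" using prime_split.exponent_pos[of q a t e f] s by (simp add: prime_split_def)
    then have "q dvd q ^ a" by simp
    then have "[e = 1] (mod q)" using s(1) cong_dvd_modulus_nat by (auto simp: primary_split_def)
    moreover have "q dvd e" using q(2) div[OF parts[OF s]] dvd_trans by blast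
    ultimately show False using q(1) by (metis cong_dvd_iff not_prime_unit)
  qed
  then show ?thesis using d x by simp
qed

section \<open>Actions of p-groups\<close>

text \<open>The elements of \<open>Bij E\<close> are extensional functions, so an action given by
  total functions has to be restricted to \<open>E\<close>.\<close>

lemma group_action_restrict:
  assumes "group G" and closed: "\<And>g x. g \<in> carrier G \<Longrightarrow> x \<in> E \<Longrightarrow> act g x \<in> E"
    and one: "\<And>x. x \<in> E \<Longrightarrow> act \<one>\<^bsub>G\<^esub> x = x"
    and mult: "\<And>g h x. g \<in> carrier G \<Longrightarrow> h \<in> carrier G \<Longrightarrow> x \<in> E \<Longrightarrow> act (g \<otimes>\<^bsub>G\<^esub> h) x = act g (act h x)"
  shows "group_action G E (\<lambda>g. restrict (act g) E)"
proof -
  interpret group G by fact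
  have bij: "restrict (act g) E \<in> Bij E" if g: "g \<in> carrier G" for g
  proof -
    have "bij_betw (act g) E E"
      by (rule bij_betw_byWitness[of _ "act (inv\<^bsub>G\<^esub> g)"])
        (use g closed one mult[symmetric] in \<open>auto simp: r_inv l_inv\<close>)
    then show ?thesis by (simp add: Bij_def bij_betw_restrict_eq)
  qed
  have "(\<lambda>g. restrict (act g) E) \<in> hom G (BijGroup E)"
    using bij closed mult
    by (auto simp: hom_def BijGroup_def compose_def fun_eq_iff restrict_def)
  then show ?thesis
    by (simp add: group_action_def group_hom_def group_hom_axioms_def group_BijGroup is_group)
qed

text \<open>The moved points form the union of the orbits with more than one element, and orbit
  lengths divide \<open>p ^ k\<close>. Counting moved instead of fixed points avoids congruences:
  fixed points exist as soon as \<open>p\<close> does not divide the size of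
  \<open>E\<close>.\<close>

lemma prime_dvd_card_moved:
  assumes "group G" "order G = p ^ k" "Factorial_Ring.prime (p::nat)" and fin: "finite E"
    and closed: "\<And>g x. g \<in> carrier G \<Longrightarrow> x \<in> E \<Longrightarrow> act g x \<in> E"
    and one: "\<And>x. x \<in> E \<Longrightarrow> act \<one>\<^bsub>G\<^esub> x = x"
    and mult: "\<And>g h x. g \<in> carrier G \<Longrightarrow> h \<in> carrier G \<Longrightarrow> x \<in> E \<Longrightarrow> act (g \<otimes>\<^bsub>G\<^esub> h) x = act g (act h x)"
  shows "p dvd card {x \<in> E. \<exists>g \<in> carrier G. act g x \<noteq> x}"
proof -
  define \<phi> where "\<phi> = (\<lambda>g. restrict (act g) E)"
  interpret group_action G E \<phi>
    unfolding \<phi>_def using group_action_restrict[OF assms(1) closed one mult] by simp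
  let ?M = "{x \<in> E. \<exists>g \<in> carrier G. act g x \<noteq> x}"
  let ?C = "{B \<in> orbits G E \<phi>. card B \<noteq> 1}"
  have sub: "orbit G \<phi> x \<subseteq> E" if "x \<in> E" for x
    using that closed by (auto simp: orbit_def \<phi>_def)
  have card1: "card (orbit G \<phi> x) = 1 \<longleftrightarrow> (\<forall>g \<in> carrier G. act g x = x)" if x: "x \<in> E" for x
  proof
    assume "card (orbit G \<phi> x) = 1"
    then obtain y where y: "orbit G \<phi> x = {y}" by (auto simp: card_1_singleton_iff)
    then have "x = y" using orbit_refl[OF x] by auto
    with y show "\<forall>g \<in> carrier G. act g x = x" using x by (auto simp: orbit_def \<phi>_def)
  next
    assume "\<forall>g \<in> carrier G. act g x = x"
    then have "orbit G \<phi> x = {x}" using x orbit_refl[OF x] by (auto simp: orbit_def \<phi>_def)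
    then show "card (orbit G \<phi> x) = 1" by simp
  qed
  have M: "?M = \<Union>?C"
  proof (intro equalityI subsetI)
    fix x assume x: "x \<in> ?M"
    then show "x \<in> \<Union>?C" using card1[of x] orbit_refl[of x] by (auto simp: orbits_def)
  next
    fix y assume "y \<in> \<Union>?C"
    then obtain x where x: "x \<in> E" "y \<in> orbit G \<phi> x" "card (orbit G \<phi> x) \<noteq> 1"
      by (auto simp: orbits_def)
    have y: "y \<in> E" using x sub by blast
    have "orbit G \<phi> y = orbit G \<phi> x"
      using disjoint_union[of "orbit G \<phi> y" "orbit G \<phi> x"] x y orbit_refl[OF y]
      by (auto simp: orbits_def)
    then show "y \<in> ?M" using y x card1[OF y] by auto
  qed
  have "p dvd card (\<Union>?C)"
  proof (rule dvd_partition)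
    show "finite (\<Union>?C)" using M fin by (metis (no_types, lifting) finite_subset mem_Collect_eq subsetI)
    show "\<forall>c1\<in>?C. \<forall>c2\<in>?C. c1 \<noteq> c2 \<longrightarrow> c1 \<inter> c2 = {}" using disjoint_union by blast
    show "\<forall>c\<in>?C. p dvd card c"
    proof
      fix c assume "c \<in> ?C"
      then obtain x where x: "x \<in> E" "c = orbit G \<phi> x" "card c \<noteq> 1" by (auto simp: orbits_def)
      have "card c dvd p ^ k" using orbit_stabilizer_theorem[OF x(1)] assms(2) x(2) by (metis dvd_triv_left)
      then show "p dvd card c" using x(3) assms(3)
        by (metis One_nat_def divides_primepow_nat dvd_power gr0I power_0)
    qed
  qed
  then show ?thesis using M by simp
qed

text \<open>\<open>P\<close> acts on the cosets of \<open>Q\<close>, whose number is prime to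
  \<open>p\<close>, so it fixes some coset \<open>Q #> u\<close>; this says that conjugation by
  \<open>u\<close> takes \<open>P\<close> into \<open>Q\<close>.\<close>

lemma (in group) sylow_conj:
  assumes fin: "finite (carrier G)" and Q: "subgroup Q G" and P: "subgroup P G"
    and cP: "card P = p ^ k" and p: "Factorial_Ring.prime (p::nat)" and idx: "\<not> p dvd card (rcosets Q)"
  obtains u where "u \<in> carrier G" "\<And>x. x \<in> P \<Longrightarrow> u \<otimes> x \<otimes> inv u \<in> Q"
proof -
  let ?P = "G\<lparr>carrier := P\<rparr>"
  have PG: "P \<subseteq> carrier G" using P subgroup.subset by blast
  have QG: "Q \<subseteq> carrier G" using Q subgroup.subset by blast
  \<comment> \<open>Translation by the inverse turns right multiplication into a left
    action.\<close>
  let ?act = "\<lambda>g C. C #> inv g"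
  have CG: "C \<subseteq> carrier G" if "C \<in> rcosets Q" for C
    using that subgroup.rcosets_carrier[OF Q is_group] by blast
  have "p dvd card {C \<in> rcosets Q. \<exists>g \<in> carrier ?P. ?act g C \<noteq> C}"
  proof (rule prime_dvd_card_moved[of ?P p k])
    show "group ?P" using P by (simp add: subgroup.subgroup_is_group is_group)
    show "order ?P = p ^ k" using cP by (simp add: order_def)
    show "Factorial_Ring.prime p" by fact
    show "finite (rcosets Q)" using fin by (simp add: RCOSETS_def)
    show "C #> inv g \<in> rcosets Q" if g: "g \<in> carrier ?P" and C: "C \<in> rcosets Q" for g C
    proof -
      obtain x where x: "x \<in> carrier G" "C = Q #> x" using C by (auto simp: RCOSETS_def)
      have "g \<in> carrier G" using g PG by auto
      then have "C #> inv g = Q #> (x \<otimes> inv g)" "x \<otimes> inv g \<in> carrier G"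
        using x QG by (simp_all add: coset_mult_assoc)
      then show ?thesis by (auto simp: RCOSETS_def)
    qed
    show "C #> inv \<one>\<^bsub>?P\<^esub> = C" if "C \<in> rcosets Q" for C using CG[OF that] by simp
    show "C #> inv (g \<otimes>\<^bsub>?P\<^esub> h) = C #> inv h #> inv g"
      if "g \<in> carrier ?P" "h \<in> carrier ?P" "C \<in> rcosets Q" for g h C
    proof -
      have "g \<in> carrier G" "h \<in> carrier G" using that PG by auto
      then show ?thesis using CG[OF that(3)] by (simp add: coset_mult_assoc inv_mult_group)
    qed
  qed
  then have "{C \<in> rcosets Q. \<exists>g \<in> carrier ?P. ?act g C \<noteq> C} \<noteq> rcosets Q" using idx by metis
  then obtain C where "C \<in> rcosets Q" "\<not> (\<exists>g \<in> carrier ?P. ?act g C \<noteq> C)" by blast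
  then have C: "C \<in> rcosets Q" "\<And>g. g \<in> P \<Longrightarrow> C #> inv g = C" by auto
  then obtain u where u: "u \<in> carrier G" "C = Q #> u" by (auto simp: RCOSETS_def)
  have "u \<otimes> x \<otimes> inv u \<in> Q" if x: "x \<in> P" for x
  proof -
    have ix: "inv x \<in> P" "x \<in> carrier G" using x P subgroup.m_inv_closed PG by auto
    then have "Q #> (u \<otimes> x) = Q #> u" using C(2)[OF ix(1)] u QG by (simp add: coset_mult_assoc)
    then have "u \<otimes> x \<in> Q #> u" using u ix Q rcos_self by (metis m_closed)
    then show ?thesis using Q u ix by (simp add: subgroup.rcos_module_imp is_group)
  qed
  then show thesis using that u(1) by blast
qed

lemma (in group) sylow_index:
  assumes fin: "finite (carrier G)" and "order G = p ^ a * m" "\<not> p dvd m" "subgroup Q G" "card Q = p ^ a"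
    and p: "Factorial_Ring.prime (p::nat)"
  shows "card (rcosets Q) = m"
proof -
  have "card (rcosets Q) * p ^ a = p ^ a * m" using lagrange[OF assms(4)] assms by simp
  then show ?thesis using p by (simp add: prime_gt_0_nat)
qed

lemma (in group) sylow_exists:
  assumes fin: "finite (carrier G)" and p: "Factorial_Ring.prime (p::nat)"
  obtains a m Q where "order G = p ^ a * m" "\<not> p dvd m" "subgroup Q G" "card Q = p ^ a"
proof -
  have "order G \<noteq> 0" using fin order_gt_0_iff_finite by simp
  then obtain m where m: "order G = p ^ multiplicity p (order G) * m" "\<not> p dvd m"
    using p multiplicity_decompose'[of "order G" p] by (metis not_prime_unit)
  obtain Q where "subgroup Q G" "card Q = p ^ multiplicity p (order G)"
    using sylow_thm[OF p is_group m(1) fin] by blast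
  then show thesis using that m by blast
qed

lemma (in group) card_subgroup_dvd:
  assumes "subgroup H G" "subgroup K G" "H \<subseteq> K"
  shows "card H dvd card K"
proof -
  have "card (rcosets\<^bsub>G\<lparr>carrier := K\<rparr>\<^esub> H) * card H = card K"
    using group.lagrange[OF subgroup.subgroup_is_group[OF assms(2) is_group] subgroup_incl[OF assms]]
    by (simp add: order_def)
  then show ?thesis by (metis dvd_triv_right)
qed

lemma (in group) pow_card_subgroup:
  assumes "subgroup H G" "x \<in> H"
  shows "x [^] card H = \<one>"
  using group.pow_order_eq_1[OF subgroup.subgroup_is_group[OF assms(1) is_group], of x] assms(2)
  by (simp add: order_def flip: nat_pow_consistent)

text \<open>The index of \<open>C\<close> has no prime factor: it divides the index of
  \<open>S\<close>, which excludes \<open>p\<close>, and for \<open>q \<noteq> p\<close> the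
  elements of a Sylow \<open>q\<close>-subgroup are their own \<open>p'\<close>-parts and so lie in
  \<open>C\<close>. The lemma extends a property closed under products from a Sylow
  \<open>p\<close>-subgroup and the \<open>p'\<close>-parts to the whole group.\<close>

lemma (in group_split) subgroup_eq_carrier:
  assumes fin: "finite (carrier G)" and C: "subgroup C G"
    and S: "subgroup S G" "S \<subseteq> C" "\<not> p dvd card (rcosets S)"
    and parts: "\<And>x. x \<in> carrier G \<Longrightarrow> x [^] f \<in> C"
  shows "C = carrier G"
proof -
  have idx: "card (rcosets C) * card C = order G" by (rule lagrange[OF C])
  have "card (rcosets C) = 1"
  proof (rule ccontr)
    assume "card (rcosets C) \<noteq> 1"
    then obtain q where q: "Factorial_Ring.prime q" "q dvd card (rcosets C)" using prime_factor_nat by blast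
    show False
    proof (cases "q = p")
      case True
      obtain k where k: "card C = k * card S" using card_subgroup_dvd[OF S(1) C S(2)] by (metis dvd_def mult.commute)
      have "card S \<noteq> 0" using S(1) fin by (metis card_0_eq finite_subset empty_iff subgroup.one_closed subgroup.subset)
      moreover have "card (rcosets C) * (k * card S) = card (rcosets S) * card S"
        using idx lagrange[OF S(1)] k by simp
      ultimately have "card (rcosets S) = card (rcosets C) * k" by simp
      then show False using S(3) q(2) True by simp
    next
      case False
      obtain b m Q where Q: "order G = q ^ b * m" "\<not> q dvd m" "subgroup Q G" "card Q = q ^ b"
        using sylow_exists[OF fin q(1)] by blast
      have "Q \<subseteq> C"
      proof
        fix x assume x: "x \<in> Q"
        then have xG: "x \<in> carrier G" using Q(3) subgroup.subset by blast
        have "x [^] (q ^ b) = \<one>" using pow_card_subgroup[OF Q(3) x] Q(4) by simp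
        moreover have "coprime (q ^ b) p" using False q(1) prime_p by (simp add: primes_coprime)
        ultimately have "x [^] f = x" using part_f_id(1)[OF xG] by blast
        then show "x \<in> C" using parts[OF xG] by simp
      qed
      then have "q ^ b dvd card C" using card_subgroup_dvd[OF Q(3) C] Q(4) by simp
      then have "q * q ^ b dvd order G" using q(2) idx by (metis mult_dvd_mono)
      then show False using Q q(1) by (simp add: prime_gt_0_nat)
    qed
  qed
  then have "card C = order G" using idx by simp
  then show ?thesis using fin C subgroup.subset by (metis card_subset_eq order_def)
qed

section \<open>Central series relative to a normal subgroup\<close>

definition commutator :: "('a, 'b) monoid_scheme \<Rightarrow> 'a \<Rightarrow> 'a \<Rightarrow> 'a" where
  "commutator G x y = x \<otimes>\<^bsub>G\<^esub> y \<otimes>\<^bsub>G\<^esub> inv\<^bsub>G\<^esub> x \<otimes>\<^bsub>G\<^esub> inv\<^bsub>G\<^esub> y"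

text \<open>The preimage in \<open>G\<close> of the \<open>n\<close>-th term of the upper central series of \<open>G/N\<close>; staying
  inside \<open>G\<close> makes different quotients comparable.\<close>

primrec central_above :: "('a, 'b) monoid_scheme \<Rightarrow> 'a set \<Rightarrow> nat \<Rightarrow> 'a set" where
  "central_above G N 0 = N"
| "central_above G N (Suc n) =
     {x \<in> carrier G. \<forall>g \<in> carrier G. commutator G x g \<in> central_above G N n}"

lemma central_above_mono: "N \<subseteq> N' \<Longrightarrow> central_above G N n \<subseteq> central_above G N' n"
  by (induct n) auto

text \<open>Behind this is the fact that normal subgroups with nilpotent quotient are closed under
  intersection.\<close>

lemma central_above_Int: "central_above G (N \<inter> N') n = central_above G N n \<inter> central_above G N' n"
  by (induct n) auto

context group begin

lemma commutator_closed [simp]: "x \<in> carrier G \<Longrightarrow> y \<in> carrier G \<Longrightarrow> commutator G x y \<in> carrier G"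
  by (simp add: commutator_def)

lemma commutator_eq_one_iff:
  "x \<in> carrier G \<Longrightarrow> y \<in> carrier G \<Longrightarrow> commutator G x y = \<one> \<longleftrightarrow> x \<otimes> y = y \<otimes> x"
  by (simp add: commutator_def m_assoc flip: inv_mult_group)
    (metis inv_mult_group inv_closed inv_equality inv_inv m_closed r_inv m_assoc)

lemma commutator_mem_normal:
  assumes "N \<lhd> G" "x \<in> N" "g \<in> carrier G"
  shows "commutator G x g \<in> N"
proof -
  have N: "subgroup N G" and xG: "x \<in> carrier G"
    using assms normal_imp_subgroup subgroup.mem_carrier by (blast, metis)
  then have "inv x \<in> N" using assms by (simp add: subgroup.m_inv_closed)
  then have "g \<otimes> inv x \<otimes> inv g \<in> N" using assms by (simp add: normal.inv_op_closed2)
  then have "x \<otimes> (g \<otimes> inv x \<otimes> inv g) \<in> N" using assms N by (simp add: subgroup.m_closed)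
  then show ?thesis using xG assms(3) by (simp add: commutator_def m_assoc)
qed

lemma rcoset_eq_iff:
  assumes "subgroup N G" "x \<in> carrier G" "y \<in> carrier G"
  shows "N #> x = N #> y \<longleftrightarrow> x \<otimes> inv y \<in> N"
  using assms by (metis is_group repr_independence rcos_self subgroup.rcos_module)

lemma rcoset_eq_self_iff:
  assumes "subgroup N G" "x \<in> carrier G"
  shows "N #> x = N \<longleftrightarrow> x \<in> N"
  using assms by (metis coset_join1 coset_join2 subgroup.subset)

lemma commutator_mem_iff:
  assumes "N \<lhd> G" "x \<in> carrier G" "g \<in> carrier G"
  shows "commutator G x g \<in> N \<longleftrightarrow>
    (N #> x) \<otimes>\<^bsub>G Mod N\<^esub> (N #> g) = (N #> g) \<otimes>\<^bsub>G Mod N\<^esub> (N #> x)"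
proof -
  have "commutator G x g = (x \<otimes> g) \<otimes> inv (g \<otimes> x)"
    using assms by (simp add: commutator_def group_word)
  then show ?thesis using assms rcoset_eq_iff[OF normal_imp_subgroup[OF assms(1)], of "x \<otimes> g" "g \<otimes> x"]
    by (simp add: normal.rcos_sum)
qed

text \<open>The set is the preimage in \<open>G\<close> of the centre of
  \<open>G Mod N\<close>.\<close>

lemma normal_central_step:
  assumes N: "N \<lhd> G"
  shows "{x \<in> carrier G. \<forall>g \<in> carrier G. commutator G x g \<in> N} \<lhd> G"
    (is "?Z \<lhd> G")
proof -
  have sN: "subgroup N G" using N normal_imp_subgroup by blast
  have conjN: "h \<otimes> x \<otimes> inv h \<in> N" if "h \<in> carrier G" "x \<in> N" for h x
    using N that by (simp add: normal.inv_op_closed2)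
  have "subgroup ?Z G"
  proof
    show "?Z \<subseteq> carrier G" by auto
    show "\<one> \<in> ?Z" using sN by (simp add: commutator_def subgroup.one_closed)
  next
    fix x y assume x: "x \<in> ?Z" and y: "y \<in> ?Z"
    have "commutator G (x \<otimes> y) g \<in> N" if g: "g \<in> carrier G" for g
    proof -
      have "commutator G (x \<otimes> y) g = (x \<otimes> commutator G y g \<otimes> inv x) \<otimes> commutator G x g"
        using x y g by (simp add: commutator_def group_word)
      then show ?thesis using x y g sN conjN by (simp add: subgroup.m_closed)
    qed
    then show "x \<otimes> y \<in> ?Z" using x y by simp
  next
    fix x assume x: "x \<in> ?Z"
    have "commutator G (inv x) g \<in> N" if g: "g \<in> carrier G" for g
    proof -
      have "commutator G (inv x) g = inv x \<otimes> inv (commutator G x g) \<otimes> inv (inv x)"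
        using x g by (simp add: commutator_def group_word)
      then show ?thesis using x g sN conjN[of "inv x"] by (simp add: subgroup.m_inv_closed)
    qed
    then show "inv x \<in> ?Z" using x by simp
  qed
  moreover have "h \<otimes> x \<otimes> inv h \<in> ?Z" if h: "h \<in> carrier G" and x: "x \<in> ?Z" for h x
  proof -
    have "commutator G (h \<otimes> x \<otimes> inv h) g \<in> N" if g: "g \<in> carrier G" for g
    proof -
      have "commutator G (h \<otimes> x \<otimes> inv h) g = h \<otimes> commutator G x (inv h \<otimes> g \<otimes> h) \<otimes> inv h"
        using x g h by (simp add: commutator_def group_word)
      then show ?thesis using x g h conjN by simp
    qed
    then show ?thesis using x h by simp
  qed
  ultimately show ?thesis by (simp add: normal_inv_iff)
qed

lemma normal_central_above: "N \<lhd> G \<Longrightarrow> central_above G N n \<lhd> G"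
  by (induct n) (simp_all add: normal_central_step)

lemma central_above_Suc:
  assumes "N \<lhd> G" shows "central_above G N n \<subseteq> central_above G N (Suc n)"
  using commutator_mem_normal[OF normal_central_above[OF assms, of n]]
    subgroup.subset[OF normal_imp_subgroup[OF normal_central_above[OF assms, of n]]] by auto

lemma central_above_le:
  assumes "N \<lhd> G" "m \<le> n" shows "central_above G N m \<subseteq> central_above G N n"
  using lift_Suc_mono_le[of "central_above G N", OF central_above_Suc[OF assms(1)] assms(2)] .

lemma central_above_stable:
  assumes "N \<lhd> G" "finite (carrier G)"
  obtains k where "\<And>n. central_above G N n \<subseteq> central_above G N k"
proof -
  let ?U = "\<Union>n. central_above G N n"
  have sub: "central_above G N n \<subseteq> carrier G" for n
    using assms(1) normal_central_above normal_imp_subgroup subgroup.subset by blast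
  then have fin: "finite ?U" by (meson UN_least assms(2) finite_subset)
  have "\<forall>x \<in> ?U. \<exists>n. x \<in> central_above G N n" by auto
  then obtain i where i: "\<And>x. x \<in> ?U \<Longrightarrow> x \<in> central_above G N (i x)" by metis
  have "central_above G N n \<subseteq> central_above G N (Max (insert 0 (i ` ?U)))" for n
  proof
    fix x assume "x \<in> central_above G N n"
    then have x: "x \<in> ?U" by blast
    then have "i x \<le> Max (insert 0 (i ` ?U))" using fin by (intro Max_ge) auto
    then show "x \<in> central_above G N (Max (insert 0 (i ` ?U)))"
      using i[OF x] central_above_le[OF assms(1)] by blast
  qed
  then show thesis using that by blast
qed

lemma upper_central_eq: "upper_central G n = central_above G {\<one>} n"
proof (induct n)
  case (Suc n)
  let ?Z = "central_above G {\<one>} n"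
  have Z: "?Z \<lhd> G" by (rule normal_central_above[OF one_is_normal])
  have "?Z #> x \<in> group_center (G Mod ?Z) \<longleftrightarrow> (\<forall>g \<in> carrier G. commutator G x g \<in> ?Z)"
    if "x \<in> carrier G" for x
    using commutator_mem_iff[OF Z that] that by (auto simp: group_center_def carrier_FactGroup)
  then show ?case using Suc by auto
qed simp

lemma nilpotent_group_iff: "nilpotent_group G \<longleftrightarrow> (\<exists>n. central_above G {\<one>} n = carrier G)"
  by (simp add: nilpotent_group_def is_group upper_central_eq)

lemma finite_hypercenter_eq: "finite_hypercenter G = (\<Union>n. central_above G {\<one>} n)"
  by (simp add: finite_hypercenter_def upper_central_eq)

end

section \<open>Central series under homomorphisms\<close>

lemma (in group_hom) hom_commutator:
  "x \<in> carrier G \<Longrightarrow> y \<in> carrier G \<Longrightarrow> h (commutator G x y) = commutator H (h x) (h y)"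
  by (simp add: commutator_def)

lemma (in group_hom) subgroup_vimage:
  "subgroup K H \<Longrightarrow> subgroup {g \<in> carrier G. h g \<in> K} G"
  by unfold_locales (auto simp: subgroup.m_closed subgroup.m_inv_closed subgroup.one_closed)

lemma (in group_hom) central_above_vimage:
  assumes surj: "h ` carrier G = carrier H"
  shows "central_above G {x \<in> carrier G. h x \<in> N} n = {x \<in> carrier G. h x \<in> central_above H N n}"
proof (induct n)
  case (Suc n)
  have "(\<forall>g \<in> carrier G. commutator H (h x) (h g) \<in> A) \<longleftrightarrow> (\<forall>g \<in> carrier H. commutator H (h x) g \<in> A)"
    for x A using surj by (metis (no_types, lifting) image_iff)
  then show ?case using Suc by (auto simp: hom_commutator)
qed simp

lemma (in group_hom) nilpotent_image_iff:
  assumes surj: "h ` carrier G = carrier H"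
  shows "nilpotent_group H \<longleftrightarrow> (\<exists>n. central_above G {x \<in> carrier G. h x = \<one>\<^bsub>H\<^esub>} n = carrier G)"
proof -
  have "central_above H {\<one>\<^bsub>H\<^esub>} n = carrier H \<longleftrightarrow>
      {x \<in> carrier G. h x \<in> central_above H {\<one>\<^bsub>H\<^esub>} n} = carrier G" for n
  proof -
    have "central_above H {\<one>\<^bsub>H\<^esub>} n \<subseteq> carrier H"
      using H.normal_central_above[OF H.one_is_normal] normal_imp_subgroup subgroup.subset by blast
    moreover have "A = h ` C \<longleftrightarrow> {x \<in> C. h x \<in> A} = C" if "A \<subseteq> h ` C" for A C
      using that by blast
    ultimately show ?thesis using surj by metis
  qed
  then show ?thesis using central_above_vimage[OF surj, of "{\<one>\<^bsub>H\<^esub>}"]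
    by (simp add: H.nilpotent_group_iff)
qed

lemma (in normal) coset_hom: "group_hom G (G Mod H) (\<lambda>x. H #> x)"
  using r_coset_hom_Mod factorgroup_is_group is_group
  by (simp add: group_hom_def group_hom_axioms_def)

lemma (in normal) coset_image: "(\<lambda>x. H #> x) ` carrier G = carrier (G Mod H)"
  by (simp add: carrier_FactGroup)

lemma (in normal) nilpotent_Mod_iff:
  "nilpotent_group (G Mod H) \<longleftrightarrow> (\<exists>n. central_above G H n = carrier G)"
proof -
  have "{x \<in> carrier G. H #> x = H} = H"
    using rcoset_eq_self_iff[OF subgroup_axioms] subset by auto
  then show ?thesis using group_hom.nilpotent_image_iff[OF coset_hom coset_image] by simp
qed

lemma (in normal) finite_hypercenter_Mod_iff:
  assumes "x \<in> carrier G"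
  shows "H #> x \<in> finite_hypercenter (G Mod H) \<longleftrightarrow> (\<exists>n. x \<in> central_above G H n)"
proof -
  have "{x \<in> carrier G. H #> x = H} = H"
    using rcoset_eq_self_iff[OF subgroup_axioms] subset by auto
  then show ?thesis
    using group_hom.central_above_vimage[OF coset_hom coset_image, of "{H}"] assms
    by (auto simp: group.finite_hypercenter_eq[OF factorgroup_is_group] set_eq_iff)
qed

section \<open>Nilpotency and commutation of primary parts\<close>

context group begin

lemma conj_pow:
  "x \<in> carrier G \<Longrightarrow> y \<in> carrier G \<Longrightarrow> (x \<otimes> y \<otimes> inv x) [^] (n::nat) = x \<otimes> y [^] n \<otimes> inv x"
  by (induct n) (simp_all add: group_word)

lemma pow_coprime_one:
  assumes "x \<in> carrier G" "x [^] (r::nat) = \<one>" "x [^] (s::nat) = \<one>" "coprime r s"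
  shows "x = \<one>"
proof -
  have "ord x dvd r" "ord x dvd s" using assms pow_eq_id by blast+
  then have "ord x dvd 1" using assms(4) coprime_common_divisor by blast
  then have "x [^] (1::nat) = \<one>" using assms(1) pow_eq_id by blast
  then show ?thesis using assms(1) by simp
qed

text \<open>Write \<open>z\<close> for the commutator. Then \<open>z \<otimes> y\<close> is a
  conjugate of \<open>y\<close>, and \<open>inv x \<otimes> z\<close> is a conjugate of
  \<open>inv x\<close>. Since \<open>z\<close> commutes with \<open>x\<close> and \<open>y\<close>,
  taking powers gives \<open>z [^] s = \<one>\<close> and \<open>z [^] r = \<one>\<close>.\<close>

lemma central_commutator_trivial:
  assumes x: "x \<in> carrier G" and y: "y \<in> carrier G"
    and zx: "commutator G x y \<otimes> x = x \<otimes> commutator G x y"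
    and zy: "commutator G x y \<otimes> y = y \<otimes> commutator G x y"
    and pow: "x [^] (r::nat) = \<one>" "y [^] (s::nat) = \<one>" "coprime r s"
  shows "commutator G x y = \<one>"
proof -
  let ?z = "commutator G x y"
  have z: "?z \<in> carrier G" using x y by simp
  have "?z \<otimes> y = x \<otimes> y \<otimes> inv x" using x y by (simp add: commutator_def group_word)
  then have "(?z \<otimes> y) [^] s = \<one>" using x y pow by (simp add: conj_pow)
  then have s: "?z [^] s = \<one>" using pow_mult_distrib[OF zy z y] pow z by simp
  have "y \<otimes> inv x \<otimes> inv y = inv x \<otimes> ?z" using x y by (simp add: commutator_def group_word)
  moreover have "(y \<otimes> inv x \<otimes> inv y) [^] r = \<one>" using x y pow by (simp add: conj_pow nat_pow_inv)
  ultimately have "(inv x \<otimes> ?z) [^] r = \<one>" by simp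
  moreover have "inv x \<otimes> ?z = ?z \<otimes> inv x"
    using zx x z by (metis inv_closed inv_solve_left inv_solve_right m_assoc m_closed)
  ultimately have r: "?z [^] r = \<one>"
    using pow_mult_distrib[of "inv x" ?z r] pow x z by (simp add: nat_pow_inv)
  show ?thesis using pow_coprime_one[OF z r s pow(3)] .
qed

text \<open>Descent along the upper central series: a commutator in the term \<open>Suc n\<close> is
  central modulo the term \<open>n\<close>, hence trivial there by the central case.\<close>

lemma hypercentral_commutator_trivial:
  assumes x: "x \<in> carrier G" and y: "y \<in> carrier G"
    and mem: "commutator G x y \<in> central_above G {\<one>} n"
    and pow: "x [^] (r::nat) = \<one>" "y [^] (s::nat) = \<one>" "coprime r s"
  shows "x \<otimes> y = y \<otimes> x"
proof -
  have "commutator G x y = \<one>" using mem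
  proof (induct n)
    case (Suc n)
    let ?Z = "central_above G {\<one>} n"
    have N: "?Z \<lhd> G" by (rule normal_central_above[OF one_is_normal])
    interpret N: normal ?Z G by (rule N)
    interpret Q: group "G Mod ?Z" by (rule N.factorgroup_is_group)
    interpret h: group_hom G "G Mod ?Z" "\<lambda>x. ?Z #> x" by (rule N.coset_hom)
    let ?c = "commutator G x y"
    have c: "commutator (G Mod ?Z) (?Z #> x) (?Z #> y) = ?Z #> ?c" using h.hom_commutator x y by simp
    have com: "(?Z #> ?c) \<otimes>\<^bsub>G Mod ?Z\<^esub> (?Z #> g) = (?Z #> g) \<otimes>\<^bsub>G Mod ?Z\<^esub> (?Z #> ?c)"
      if "g \<in> carrier G" for g
      using Suc.prems that commutator_mem_iff[OF N _ that, of ?c] x y by simp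
    have "commutator (G Mod ?Z) (?Z #> x) (?Z #> y) = \<one>\<^bsub>G Mod ?Z\<^esub>"
    proof (rule Q.central_commutator_trivial)
      show "?Z #> x \<in> carrier (G Mod ?Z)" "?Z #> y \<in> carrier (G Mod ?Z)" using h.hom_closed x y by blast+
      show "(?Z #> x) [^]\<^bsub>G Mod ?Z\<^esub> r = \<one>\<^bsub>G Mod ?Z\<^esub>" "(?Z #> y) [^]\<^bsub>G Mod ?Z\<^esub> s = \<one>\<^bsub>G Mod ?Z\<^esub>"
        using pow x y N.FactGroup_pow N.subset by simp_all
    qed (use com x y pow c in auto)
    then have "?Z #> ?c = ?Z" using c by simp
    then have "?c \<in> ?Z" using rcoset_eq_self_iff[OF N.subgroup_axioms] x y by simp
    then show ?case using Suc.hyps by simp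
  qed simp
  then show ?thesis using commutator_eq_one_iff x y by blast
qed

lemma hypercentral_coprime_commute:
  assumes x: "x \<in> central_above G {\<one>} n" and y: "y \<in> carrier G"
    and pow: "x [^] (r::nat) = \<one>" "y [^] (s::nat) = \<one>" "coprime r s"
  shows "x \<otimes> y = y \<otimes> x"
proof -
  have N: "central_above G {\<one>} n \<lhd> G" by (rule normal_central_above[OF one_is_normal])
  show ?thesis
    by (rule hypercentral_commutator_trivial[OF _ y commutator_mem_normal[OF N x y] pow])
      (use x N normal_imp_subgroup subgroup.mem_carrier in metis)
qed

lemma subgroup_centralizer:
  "A \<subseteq> carrier G \<Longrightarrow> subgroup {g \<in> carrier G. \<forall>x \<in> A. g \<otimes> x = x \<otimes> g} G"
proof
  fix g h assume A: "A \<subseteq> carrier G" and g: "g \<in> {g \<in> carrier G. \<forall>x \<in> A. g \<otimes> x = x \<otimes> g}"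
    and h: "h \<in> {g \<in> carrier G. \<forall>x \<in> A. g \<otimes> x = x \<otimes> g}"
  have "g \<otimes> h \<otimes> x = x \<otimes> (g \<otimes> h)" if x: "x \<in> A" for x
  proof -
    have xG: "x \<in> carrier G" using x A by auto
    then have "g \<otimes> h \<otimes> x = g \<otimes> (x \<otimes> h)" using g h x by (simp add: m_assoc)
    also have "\<dots> = x \<otimes> g \<otimes> h" using g h x xG by (simp flip: m_assoc)
    finally show ?thesis using g h xG by (simp add: m_assoc)
  qed
  then show "g \<otimes> h \<in> {g \<in> carrier G. \<forall>x \<in> A. g \<otimes> x = x \<otimes> g}" using g h by simp
next
  fix g assume A: "A \<subseteq> carrier G" and g: "g \<in> {g \<in> carrier G. \<forall>x \<in> A. g \<otimes> x = x \<otimes> g}"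
  have "inv g \<otimes> x = x \<otimes> inv g" if x: "x \<in> A" for x
  proof -
    have xG: "x \<in> carrier G" using x A by auto
    then have "inv g \<otimes> (x \<otimes> g) \<otimes> inv g = inv g \<otimes> (g \<otimes> x) \<otimes> inv g" using g x by simp
    then show ?thesis using g xG by (simp add: group_word)
  qed
  then show "inv g \<in> {g \<in> carrier G. \<forall>x \<in> A. g \<otimes> x = x \<otimes> g}" using g by simp
qed (auto simp: subset_iff)

lemma subgroup_pow_closed: "subgroup K G \<Longrightarrow> x \<in> K \<Longrightarrow> x [^] (n::nat) \<in> K"
  by (induct n) (simp_all add: subgroup.one_closed subgroup.m_closed)

end

section \<open>Commuting primary parts force hypercentrality\<close>

context group_split begin

text \<open>The elements commuting with all \<open>p'\<close>-parts form a normal subgroup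
  \<open>N\<close>, and \<open>w\<close> makes its order divisible by \<open>p\<close>. A Sylow
  \<open>p\<close>-subgroup acts on \<open>N\<close> by conjugation and therefore fixes some
  \<open>z \<noteq> \<one>\<close>; this \<open>z\<close> commutes with the Sylow subgroup and with
  all \<open>p'\<close>-parts, hence with everything.\<close>

lemma exists_central:
  assumes fin: "finite (carrier G)" and w: "w \<in> carrier G" "w \<noteq> \<one>" "w [^] (p ^ a) = \<one>"
    and com: "\<And>y. y \<in> carrier G \<Longrightarrow> w \<otimes> y [^] f = y [^] f \<otimes> w"
  obtains z where "z \<in> carrier G" "z \<noteq> \<one>" "\<And>g. g \<in> carrier G \<Longrightarrow> z \<otimes> g = g \<otimes> z"
proof -
  let ?F = "(\<lambda>y. y [^] f) ` carrier G"
  define N where "N = {u \<in> carrier G. \<forall>x \<in> ?F. u \<otimes> x = x \<otimes> u}"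
  have N: "subgroup N G" unfolding N_def by (rule subgroup_centralizer) auto
  have NG: "N \<subseteq> carrier G" by (auto simp: N_def)
  have wN: "w \<in> N" using w com by (simp add: N_def)
  have conjN: "g \<otimes> u \<otimes> inv g \<in> N" if g: "g \<in> carrier G" and u: "u \<in> N" for g u
  proof -
    have uG: "u \<in> carrier G" using u NG by auto
    have "(g \<otimes> u \<otimes> inv g) \<otimes> y [^] f = y [^] f \<otimes> (g \<otimes> u \<otimes> inv g)" if y: "y \<in> carrier G" for y
    proof -
      have "u \<otimes> (inv g \<otimes> y \<otimes> g) [^] f = (inv g \<otimes> y \<otimes> g) [^] f \<otimes> u"
        using u g y by (simp add: N_def)
      then have "u \<otimes> (inv g \<otimes> y [^] f \<otimes> g) = (inv g \<otimes> y [^] f \<otimes> g) \<otimes> u"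
        using conj_pow[of "inv g" y f] g y by simp
      then have "g \<otimes> (u \<otimes> (inv g \<otimes> y [^] f \<otimes> g)) \<otimes> inv g = g \<otimes> ((inv g \<otimes> y [^] f \<otimes> g) \<otimes> u) \<otimes> inv g"
        by simp
      then show ?thesis using g y uG by (simp add: group_word)
    qed
    then show ?thesis using g uG by (simp add: N_def)
  qed
  have finN: "finite N" using fin NG finite_subset by blast
  have pN: "p dvd card N"
  proof (rule ccontr)
    assume "\<not> p dvd card N"
    then have "coprime (p ^ a) (card N)" using prime_p by (simp add: prime_imp_coprime)
    then show False using pow_coprime_one[OF w(1,3) pow_card_subgroup[OF N wN]] w(2) by blast
  qed
  obtain b m S where S: "order G = p ^ b * m" "\<not> p dvd m" "subgroup S G" "card S = p ^ b"
    using sylow_exists[OF fin prime_p] by blast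
  have SG: "S \<subseteq> carrier G" using S(3) subgroup.subset by blast
  let ?S = "G\<lparr>carrier := S\<rparr>"
  let ?M = "{u \<in> N. \<exists>g \<in> carrier ?S. g \<otimes> u \<otimes> inv g \<noteq> u}"
  have "p dvd card ?M"
  proof (rule prime_dvd_card_moved[of ?S p b])
    show "group ?S" using S(3) by (simp add: subgroup.subgroup_is_group is_group)
    show "order ?S = p ^ b" using S(4) by (simp add: order_def)
    show "g \<otimes>\<^bsub>?S\<^esub> h \<otimes> u \<otimes> inv (g \<otimes>\<^bsub>?S\<^esub> h) = g \<otimes> (h \<otimes> u \<otimes> inv h) \<otimes> inv g"
      if "g \<in> carrier ?S" "h \<in> carrier ?S" "u \<in> N" for g h u
      using that SG NG by (simp add: group_word subset_iff)
  qed (use prime_p finN conjN SG NG in auto)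
  then have "p dvd card (N - ?M)" using pN finN by (simp add: card_Diff_subset dvd_diff_nat)
  moreover have one: "\<one> \<in> N - ?M" using N SG subgroup.one_closed by auto
  moreover have "0 < card (N - ?M)" using one finN by (simp only: card_gt_0_iff) blast
  ultimately have "p \<le> card (N - ?M)" by (simp add: dvd_imp_le)
  then have "1 < card (N - ?M)" using prime_gt_1_nat[OF prime_p] by linarith
  moreover have "card (N - ?M) \<le> card {\<one>}" if "N - ?M \<subseteq> {\<one>}" by (rule card_mono) (use that in auto)
  ultimately have "\<not> N - ?M \<subseteq> {\<one>}" by auto
  then obtain z where z: "z \<in> N - ?M" "z \<noteq> \<one>" by blast
  have zG: "z \<in> carrier G" using z NG by auto
  let ?C = "{g \<in> carrier G. \<forall>x \<in> {z}. g \<otimes> x = x \<otimes> g}"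
  have C: "?C = carrier G"
  proof (rule subgroup_eq_carrier[OF fin _ S(3)])
    show "subgroup ?C G" using subgroup_centralizer[of "{z}"] zG by simp
    show "S \<subseteq> ?C"
    proof
      fix g assume g: "g \<in> S"
      then have "g \<otimes> z \<otimes> inv g = z" "g \<in> carrier G" using z SG by auto
      then have "g \<otimes> z = z \<otimes> g" using zG by (metis inv_solve_right m_closed)
      then show "g \<in> ?C" using g SG by auto
    qed
    show "\<not> p dvd card (rcosets S)" using sylow_index[OF fin S(1-4) prime_p] S(2) by simp
    show "x [^] f \<in> ?C" if "x \<in> carrier G" for x using z that by (auto simp: N_def)
  qed
  have "z \<otimes> g = g \<otimes> z" if "g \<in> carrier G" for g
  proof -
    have "g \<in> ?C" unfolding C using that .
    then show ?thesis by simp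
  qed
  then show thesis using that[OF zG z(2)] by blast
qed

end

context group begin

text \<open>Let \<open>?Z\<close> be the last term of the upper central series. If the
  \<open>p\<close>-part of \<open>w\<close> were outside \<open>?Z\<close>, its image would produce
  a nontrivial central element of \<open>G Mod ?Z\<close>, so the series could still grow.\<close>

lemma hypercentral_if_parts_commute:
  assumes fin: "finite (carrier G)" and exp: "\<And>x. x \<in> carrier G \<Longrightarrow> x [^] n = \<one>" and n: "0 < (n::nat)"
    and w: "w \<in> carrier G"
    and com: "\<And>p a t e f y. primary_split p a t e f \<Longrightarrow> n = p ^ a * t \<Longrightarrow> y \<in> carrier G \<Longrightarrow>
      w [^] e \<otimes> y [^] f = y [^] f \<otimes> w [^] e"
  shows "\<exists>k. w \<in> central_above G {\<one>} k"
proof -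
  obtain k where k: "\<And>n. central_above G {\<one>} n \<subseteq> central_above G {\<one>} k"
    using central_above_stable[OF one_is_normal fin] by blast
  let ?Z = "central_above G {\<one>} k"
  have N: "?Z \<lhd> G" by (rule normal_central_above[OF one_is_normal])
  interpret N: normal ?Z G by (rule N)
  have "w \<in> ?Z"
  proof (rule mem_subgroup_if_parts[OF N.subgroup_axioms w exp[OF w] n])
    fix p a t e f assume split: "primary_split p a t e f" and nn: "n = p ^ a * t"
    interpret group_split G p a t e f
      using split exp nn by unfold_locales auto
    interpret Q: group_split "G Mod ?Z" p a t e f by (rule quotient_split[OF N])
    show "w [^] e \<in> ?Z"
    proof (rule ccontr)
      assume not: "w [^] e \<notin> ?Z"
      have in_Q: "?Z #> g \<in> carrier (G Mod ?Z)" if "g \<in> carrier G" for g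
        using that by (auto simp: carrier_FactGroup)
      obtain z where z: "z \<in> carrier (G Mod ?Z)" "z \<noteq> \<one>\<^bsub>G Mod ?Z\<^esub>"
        "\<And>g. g \<in> carrier (G Mod ?Z) \<Longrightarrow> z \<otimes>\<^bsub>G Mod ?Z\<^esub> g = g \<otimes>\<^bsub>G Mod ?Z\<^esub> z"
      proof (rule Q.exists_central[of "?Z #> w [^] e"])
        show "finite (carrier (G Mod ?Z))" using fin by (simp add: carrier_FactGroup)
        show "?Z #> w [^] e \<in> carrier (G Mod ?Z)" using w in_Q by simp
        show "?Z #> w [^] e \<noteq> \<one>\<^bsub>G Mod ?Z\<^esub>"
          using not rcoset_eq_self_iff[OF N.subgroup_axioms] w by simp
        show "(?Z #> w [^] e) [^]\<^bsub>G Mod ?Z\<^esub> (p ^ a) = \<one>\<^bsub>G Mod ?Z\<^esub>"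
          using w part_pow_pa N.subset by (simp add: N.FactGroup_pow)
        show "(?Z #> w [^] e) \<otimes>\<^bsub>G Mod ?Z\<^esub> y [^]\<^bsub>G Mod ?Z\<^esub> f = y [^]\<^bsub>G Mod ?Z\<^esub> f \<otimes>\<^bsub>G Mod ?Z\<^esub> (?Z #> w [^] e)"
          if y: "y \<in> carrier (G Mod ?Z)" for y
        proof -
          obtain g where g: "g \<in> carrier G" "y = ?Z #> g" using y by (auto simp: carrier_FactGroup)
          then show ?thesis using com[OF split nn g(1)] w by (simp add: N.FactGroup_pow N.rcos_sum)
        qed
      qed (rule that)
      then obtain u where u: "u \<in> carrier G" "z = ?Z #> u" by (auto simp: carrier_FactGroup)
      have "u \<in> central_above G {\<one>} (Suc k)"
        using u z(3)[OF in_Q] commutator_mem_iff[OF N u(1)] by auto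
      then have "u \<in> ?Z" using k by blast
      then show False using z(2) u rcoset_eq_self_iff[OF N.subgroup_axioms] by simp
    qed
  qed
  then show ?thesis by blast
qed

lemma nilpotent_if_parts_commute:
  assumes fin: "finite (carrier G)" and exp: "\<And>x. x \<in> carrier G \<Longrightarrow> x [^] n = \<one>" and n: "0 < (n::nat)"
    and com: "\<And>p a t e f x y. primary_split p a t e f \<Longrightarrow> n = p ^ a * t \<Longrightarrow> x \<in> carrier G \<Longrightarrow>
      y \<in> carrier G \<Longrightarrow> x [^] e \<otimes> y [^] f = y [^] f \<otimes> x [^] e"
  shows "nilpotent_group G"
proof -
  obtain k where k: "\<And>n. central_above G {\<one>} n \<subseteq> central_above G {\<one>} k"
    using central_above_stable[OF one_is_normal fin] by blast
  have "w \<in> central_above G {\<one>} k" if w: "w \<in> carrier G" for w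
    using hypercentral_if_parts_commute[OF fin exp n w] com w k by blast
  then have "central_above G {\<one>} k = carrier G"
    using normal_central_above[OF one_is_normal] normal_imp_subgroup subgroup.subset by blast
  then show ?thesis using nilpotent_group_iff by blast
qed

lemma nilpotent_coprime_commute:
  assumes "nilpotent_group G" "x \<in> carrier G" "y \<in> carrier G"
    "x [^] (r::nat) = \<one>" "y [^] (s::nat) = \<one>" "coprime r s"
  shows "x \<otimes> y = y \<otimes> x"
  using assms hypercentral_coprime_commute nilpotent_group_iff by metis

text \<open>In a nilpotent group the \<open>p'\<close>-parts centralize a Sylow
  \<open>p\<close>-subgroup \<open>P\<close>, so \<open>P\<close> is normal. The quotient has order
  prime to \<open>p\<close>, hence every \<open>p\<close>-element lies in \<open>P\<close>.\<close>

lemma nilpotent_sylow: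
  assumes nil: "nilpotent_group G" and fin: "finite (carrier G)" and p: "Factorial_Ring.prime (p::nat)"
  obtains P k where "subgroup P G" "card P = p ^ k"
    "\<And>x i. x \<in> carrier G \<Longrightarrow> x [^] (p ^ i) = \<one> \<Longrightarrow> x \<in> P"
proof -
  have "0 < order G" using fin order_gt_0_iff_finite by simp
  then obtain a t e f where split: "primary_split p a t e f" "order G = p ^ a * t"
    using primary_split_exists[OF p] by blast
  interpret group_split G p a t e f
    using split pow_order_eq_1 by unfold_locales auto
  obtain b m P where P: "order G = p ^ b * m" "\<not> p dvd m" "subgroup P G" "card P = p ^ b"
    using sylow_exists[OF fin p] by blast
  have PG: "P \<subseteq> carrier G" using P(3) subgroup.subset by blast
  interpret P: subgroup P G by (rule P(3))
  have Ppow: "x [^] (p ^ b) = \<one>" if "x \<in> P" for x using pow_card_subgroup[OF P(3) that] P(4) by simp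
  \<comment> \<open>The normalizer of \<open>P\<close>, stated as an equivalence so that closure
    under inverses needs no counting.\<close>
  let ?C = "{g \<in> carrier G. \<forall>x \<in> carrier G. g \<otimes> x \<otimes> inv g \<in> P \<longleftrightarrow> x \<in> P}"
  have C: "?C = carrier G"
  proof (rule subgroup_eq_carrier[OF fin _ P(3)])
    show "subgroup ?C G"
    proof
      fix g h assume g: "g \<in> ?C" and h: "h \<in> ?C"
      have "g \<otimes> h \<otimes> x \<otimes> inv (g \<otimes> h) \<in> P \<longleftrightarrow> x \<in> P" if x: "x \<in> carrier G" for x
      proof -
        have "g \<otimes> h \<otimes> x \<otimes> inv (g \<otimes> h) = g \<otimes> (h \<otimes> x \<otimes> inv h) \<otimes> inv g"
          using g h x by (simp add: group_word)
        then show ?thesis using g h x by simp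
      qed
      then show "g \<otimes> h \<in> ?C" using g h by simp
    next
      fix g assume g: "g \<in> ?C"
      have "inv g \<otimes> x \<otimes> inv (inv g) \<in> P \<longleftrightarrow> x \<in> P" if x: "x \<in> carrier G" for x
      proof -
        have "g \<otimes> (inv g \<otimes> x \<otimes> inv (inv g)) \<otimes> inv g = x" using g x by (simp add: group_word)
        moreover have "inv g \<otimes> x \<otimes> inv (inv g) \<in> carrier G" using g x by simp
        moreover have "g \<otimes> y \<otimes> inv g \<in> P \<longleftrightarrow> y \<in> P" if "y \<in> carrier G" for y using g that by auto
        ultimately show ?thesis by metis
      qed
      then show "inv g \<in> ?C" using g by simp
    qed auto
    show "P \<subseteq> ?C"
    proof
      fix g assume g: "g \<in> P"
      have gG: "g \<in> carrier G" using g PG by auto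
      have "x \<in> P" if x: "x \<in> carrier G" "g \<otimes> x \<otimes> inv g \<in> P" for x
      proof -
        have "inv g \<otimes> (g \<otimes> x \<otimes> inv g) \<otimes> g \<in> P"
          by (intro P.m_closed P.m_inv_closed g x)
        then show ?thesis using gG x by (simp add: group_word)
      qed
      moreover have "g \<otimes> x \<otimes> inv g \<in> P" if "x \<in> P" for x
        by (intro P.m_closed P.m_inv_closed g that)
      ultimately show "g \<in> ?C" using gG by blast
    qed
    show "\<not> p dvd card (rcosets P)" using sylow_index[OF fin P(1-4) p] P(2) by simp
    show "y [^] f \<in> ?C" if y: "y \<in> carrier G" for y
    proof -
      have com: "y [^] f \<otimes> x = x \<otimes> y [^] f" if x: "x \<in> P" for x
        using nilpotent_coprime_commute[OF nil _ _ part_pow_t[OF y] Ppow[OF x]] x y PG coprime_p_t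
        by (auto simp: coprime_commute)
      have "x \<in> P" if x: "x \<in> carrier G" "y [^] f \<otimes> x \<otimes> inv (y [^] f) \<in> P" for x
      proof -
        let ?x = "y [^] f \<otimes> x \<otimes> inv (y [^] f)"
        have "y [^] f \<otimes> ?x = y [^] f \<otimes> x" using com[OF x(2)] x y by (simp add: group_word)
        then have "?x = x" using x y by (meson inv_closed l_cancel m_closed nat_pow_closed)
        then show ?thesis using x by simp
      qed
      moreover have "y [^] f \<otimes> x \<otimes> inv (y [^] f) = x" if x: "x \<in> P" for x
      proof -
        have xG: "x \<in> carrier G" using x PG by auto
        have "y [^] f \<otimes> x \<otimes> inv (y [^] f) = x \<otimes> y [^] f \<otimes> inv (y [^] f)" by (simp only: com[OF x])
        also have "\<dots> = x" using xG y by (simp add: m_assoc)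
        finally show ?thesis .
      qed
      ultimately have "y [^] f \<otimes> x \<otimes> inv (y [^] f) \<in> P \<longleftrightarrow> x \<in> P" if "x \<in> carrier G" for x
        using that by metis
      then show ?thesis using y by blast
    qed
  qed
  have "g \<otimes> x \<otimes> inv g \<in> P" if "g \<in> carrier G" "x \<in> P" for g x
  proof -
    have "g \<in> ?C" unfolding C using that(1) .
    then show ?thesis using that(2) PG by auto
  qed
  then have N: "P \<lhd> G" using P(3) by (simp add: normal_inv_iff)
  interpret N: normal P G by (rule N)
  interpret Q: group "G Mod P" by (rule N.factorgroup_is_group)
  have "x \<in> P" if x: "x \<in> carrier G" "x [^] (p ^ i) = \<one>" for x i
  proof -
    have xQ: "P #> x \<in> carrier (G Mod P)" using x by (auto simp: carrier_FactGroup)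
    have "order (G Mod P) = m" using sylow_index[OF fin P(1-4) p] by (simp add: order_def FactGroup_def)
    then have "(P #> x) [^]\<^bsub>G Mod P\<^esub> m = \<one>\<^bsub>G Mod P\<^esub>" using Q.pow_order_eq_1[OF xQ] by simp
    moreover have "(P #> x) [^]\<^bsub>G Mod P\<^esub> (p ^ i) = \<one>\<^bsub>G Mod P\<^esub>" using x PG by (simp add: N.FactGroup_pow)
    moreover have "coprime m (p ^ i)"
      using prime_imp_coprime[OF p P(2)] by (simp add: coprime_commute)
    ultimately have "P #> x = P" using Q.pow_coprime_one[OF xQ] by simp
    then show ?thesis using rcoset_eq_self_iff[OF P(3) x(1)] by simp
  qed
  then show thesis using that P(3,4) by blast
qed

text \<open>Needed to see that a product of \<open>p'\<close>-elements is a
  \<open>p'\<close>-element. One prime \<open>q\<close> of \<open>m\<close> is split off: the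
  \<open>q\<close>-parts multiply inside the normal Sylow subgroup, the other parts by induction
  with exponent \<open>t < m\<close>, and the two products commute.\<close>

lemma nilpotent_pow_mult:
  assumes nil: "nilpotent_group G" and fin: "finite (carrier G)"
    and "x \<in> carrier G" "y \<in> carrier G" "x [^] m = \<one>" "y [^] m = \<one>" "0 < (m::nat)"
  shows "\<exists>j. (x \<otimes> y) [^] (m ^ j) = \<one>"
  using assms(3-)
proof (induct m arbitrary: x y rule: less_induct)
  case (less m)
  note xy = less.prems(1,2)
  show ?case
  proof (cases "m = 1")
    case True
    then have "x = \<one>" "y = \<one>" using less.prems by simp_all
    then show ?thesis by simp
  next
    case False
    then obtain q where q: "Factorial_Ring.prime q" "q dvd m" using prime_factor_nat by blast
    obtain a t e f where s: "primary_split q a t e f" "m = q ^ a * t"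
      using primary_split_exists[OF q(1) less.prems(5)] by blast
    interpret prime_split q a t e f by unfold_locales (rule s)
    have "a \<noteq> 0" using exponent_pos s q(2) by simp
    then have "1 < q ^ a" using q(1) by (metis prime_gt_1_nat one_less_power zero_less_iff_neq_zero)
    then have tm: "t < m" using s t_pos by simp
    have dvds: "m dvd e * q ^ a" "m dvd f * t"
      using s(2) congs(2,3) by (auto simp: cong_0_iff mult.commute mult_dvd_mono)
    have one: "(z [^] e) [^] (q ^ a) = \<one>" "(z [^] f) [^] t = \<one>" "z = z [^] e \<otimes> z [^] f"
      if z: "z \<in> carrier G" "z [^] m = \<one>" for z
      using pow_dvd_one[OF z dvds(1)] pow_dvd_one[OF z dvds(2)] pow_eq_pow_cong[OF z(1), of m "e + f" 1]
        cong_ef s(2) z by (simp_all add: nat_pow_pow nat_pow_mult)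
    note ox = one[OF xy(1) less.prems(3)] and oy = one[OF xy(2) less.prems(4)]
    obtain P k where P: "subgroup P G" "card P = q ^ k"
        "\<And>x i. x \<in> carrier G \<Longrightarrow> x [^] (q ^ i) = \<one> \<Longrightarrow> x \<in> P"
      using nilpotent_sylow[OF nil fin q(1)] by blast
    let ?u = "x [^] e \<otimes> y [^] e" and ?w = "x [^] f \<otimes> y [^] f"
    have "?u \<in> P" using P(1) P(3)[OF _ ox(1)] P(3)[OF _ oy(1)] xy by (simp add: subgroup.m_closed)
    then have u: "?u [^] (q ^ k) = \<one>" using pow_card_subgroup[OF P(1)] P(2) by simp
    obtain j where j: "?w [^] (t ^ j) = \<one>"
      using less.hyps[OF tm _ _ ox(2) oy(2) t_pos] xy by auto
    have com: "?u \<otimes> ?w = ?w \<otimes> ?u"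
      by (rule nilpotent_coprime_commute[OF nil _ _ u j]) (use xy coprime_p_t in auto)
    have com2: "x [^] f \<otimes> y [^] e = y [^] e \<otimes> x [^] f"
      by (rule nilpotent_coprime_commute[OF nil _ _ ox(2) oy(1)]) (use xy coprime_p_t in \<open>auto simp: coprime_commute\<close>)
    have "x \<otimes> y = (x [^] e \<otimes> x [^] f) \<otimes> (y [^] e \<otimes> y [^] f)" using ox(3) oy(3) by simp
    also have "\<dots> = x [^] e \<otimes> (x [^] f \<otimes> y [^] e) \<otimes> y [^] f" using xy by (simp add: m_assoc)
    also have "\<dots> = ?u \<otimes> ?w" using xy com2 by (simp add: m_assoc)
    finally have uw: "x \<otimes> y = ?u \<otimes> ?w" .
    have "(x \<otimes> y) [^] (q ^ k * t ^ j) = ?u [^] (q ^ k * t ^ j) \<otimes> ?w [^] (q ^ k * t ^ j)"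
      unfolding uw by (rule pow_mult_distrib[OF com]) (use xy in auto)
    also have "\<dots> = \<one>"
      using pow_dvd_one[OF _ u, of "q ^ k * t ^ j"] pow_dvd_one[OF _ j, of "q ^ k * t ^ j"] xy by simp
    finally have "(x \<otimes> y) [^] (q ^ k * t ^ j) = \<one>" .
    moreover have "q ^ k * t ^ j dvd m ^ (k + j)"
      using q(2) s(2) by (simp add: power_add mult_dvd_mono dvd_power_same)
    ultimately show ?thesis using pow_dvd_one xy by (metis m_closed)
  qed
qed

end

context group_split begin

text \<open>The product of the \<open>p\<close>-parts is again a \<open>p\<close>-element, that of
  the \<open>p'\<close>-parts a \<open>p'\<close>-element, and they commute; their product is
  \<open>x \<otimes> y\<close>, so they are its primary parts.\<close>

lemma nilpotent_part_mult:
  assumes nil: "nilpotent_group G" and fin: "finite (carrier G)" and xy: "x \<in> carrier G" "y \<in> carrier G"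
  shows "(x \<otimes> y) [^] e = x [^] e \<otimes> y [^] e" "(x \<otimes> y) [^] f = x [^] f \<otimes> y [^] f"
    "x [^] e \<otimes> y [^] f = y [^] f \<otimes> x [^] e"
proof -
  have com: "u [^] e \<otimes> v [^] f = v [^] f \<otimes> u [^] e" if "u \<in> carrier G" "v \<in> carrier G" for u v
    by (rule nilpotent_coprime_commute[OF nil _ _ part_pow_pa part_pow_t]) (use that coprime_p_t in auto)
  then show "x [^] e \<otimes> y [^] f = y [^] f \<otimes> x [^] e" using xy .
  obtain P k where P: "subgroup P G" "card P = p ^ k"
      "\<And>x i. x \<in> carrier G \<Longrightarrow> x [^] (p ^ i) = \<one> \<Longrightarrow> x \<in> P"
    using nilpotent_sylow[OF nil fin prime_p] by blast
  let ?u = "x [^] e \<otimes> y [^] e" and ?w = "x [^] f \<otimes> y [^] f"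
  have "?u \<in> P" using P(1) P(3)[OF _ part_pow_pa] xy by (simp add: subgroup.m_closed)
  then have "?u [^] (p ^ k) = \<one>" using pow_card_subgroup[OF P(1)] P(2) by simp
  then have u: "?u [^] e = ?u" "?u [^] f = \<one>" using part_e_id[of ?u "p ^ k"] coprime_p_t xy by auto
  obtain j where j: "?w [^] (t ^ j) = \<one>"
    using nilpotent_pow_mult[OF nil fin _ _ part_pow_t part_pow_t t_pos, of x y] xy by auto
  then have w: "?w [^] f = ?w" "?w [^] e = \<one>"
    using part_f_id[OF _ j] coprime_p_t xy by (auto simp: coprime_commute)
  have "x \<otimes> y = (x [^] e \<otimes> x [^] f) \<otimes> (y [^] e \<otimes> y [^] f)" using part_mult xy by simp
  also have "\<dots> = x [^] e \<otimes> (x [^] f \<otimes> y [^] e) \<otimes> y [^] f" using xy by (simp add: m_assoc)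
  also have "x [^] f \<otimes> y [^] e = y [^] e \<otimes> x [^] f" using com[OF xy(2,1)] by simp
  also have "x [^] e \<otimes> (y [^] e \<otimes> x [^] f) \<otimes> y [^] f = ?u \<otimes> ?w" using xy by (simp add: m_assoc)
  finally have uw: "x \<otimes> y = ?u \<otimes> ?w" .
  have uw_com: "?u \<otimes> ?w = ?w \<otimes> ?u" using com[of ?u ?w] u w xy by simp
  show "(x \<otimes> y) [^] e = x [^] e \<otimes> y [^] e" "(x \<otimes> y) [^] f = x [^] f \<otimes> y [^] f"
    unfolding uw using pow_mult_distrib[OF uw_com] u w xy by simp_all
qed

end

text \<open>The element \<open>z\<close> lies in the term \<open>n\<close> of the series of the
  subgroup itself. Modulo that term the subgroup is generated by \<open>x\<close> alone, hence
  abelian, so \<open>x\<close> lies in the next term.\<close>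

lemma (in group) nilpotent_generate_hypercentral:
  assumes z: "z \<in> central_above G {\<one>} n" and x: "x \<in> carrier G"
  shows "nilpotent_group (G\<lparr>carrier := generate G {x, z}\<rparr>)"
proof -
  have Zn: "central_above G {\<one>} n \<lhd> G" by (rule normal_central_above[OF one_is_normal])
  have zG: "z \<in> carrier G" using z Zn normal_imp_subgroup subgroup.mem_carrier by metis
  let ?K = "generate G {x, z}" and ?H = "G\<lparr>carrier := generate G {x, z}\<rparr>"
  have K: "subgroup ?K G" using generate_is_subgroup x zG by simp
  have KG: "?K \<subseteq> carrier G" using K subgroup.subset by blast
  interpret H: group ?H using K by (simp add: subgroup.subgroup_is_group is_group)
  have com: "commutator ?H u v = commutator G u v" if "u \<in> ?K" "v \<in> ?K" for u v
    using that K by (simp add: commutator_def m_inv_consistent)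
  have comK: "commutator G u v \<in> ?K" if "u \<in> ?K" "v \<in> ?K" for u v
    using H.commutator_closed com that by simp
  have sub: "central_above G {\<one>} k \<inter> ?K \<subseteq> central_above ?H {\<one>} k" for k
  proof (induct k)
    case (Suc k)
    show ?case
    proof
      fix u assume u: "u \<in> central_above G {\<one>} (Suc k) \<inter> ?K"
      have "commutator G u g \<in> central_above ?H {\<one>} k" if g: "g \<in> ?K" for g
      proof -
        have "commutator G u g \<in> central_above G {\<one>} k" using u g KG by auto
        then show ?thesis using Suc comK[of u g] u g by blast
      qed
      then show "u \<in> central_above ?H {\<one>} (Suc k)" using u com by simp
    qed
  qed simp
  let ?Z = "central_above ?H {\<one>} n"
  have Z: "?Z \<lhd> ?H" using H.normal_central_above[OF H.one_is_normal] by simp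
  have xK: "x \<in> ?K" "z \<in> ?K" by (auto intro: generate.incl)
  have zZ: "z \<in> ?Z" using sub z xK by blast
  have suc: "central_above ?H {\<one>} (Suc n) \<lhd> ?H" using H.normal_central_above[OF H.one_is_normal, of "Suc n"] by simp
  have zS: "z \<in> central_above ?H {\<one>} (Suc n)"
    using H.central_above_Suc[OF H.one_is_normal] zZ by auto
  have xS: "x \<in> central_above ?H {\<one>} (Suc n)"
  proof -
    let ?C = "{g \<in> carrier ?H. commutator ?H g x \<in> ?Z}"
    interpret Z: normal ?Z ?H by (rule Z)
    interpret Q: group "?H Mod ?Z" by (rule Z.factorgroup_is_group)
    interpret h: group_hom ?H "?H Mod ?Z" "\<lambda>g. ?Z #>\<^bsub>?H\<^esub> g" by (rule Z.coset_hom)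
    have hx: "?Z #>\<^bsub>?H\<^esub> x \<in> carrier (?H Mod ?Z)" using h.hom_closed xK by simp
    have C: "?C = {g \<in> carrier ?H. ?Z #>\<^bsub>?H\<^esub> g \<in> {u \<in> carrier (?H Mod ?Z). \<forall>v \<in> {?Z #>\<^bsub>?H\<^esub> x}. u \<otimes>\<^bsub>?H Mod ?Z\<^esub> v = v \<otimes>\<^bsub>?H Mod ?Z\<^esub> u}}"
      using H.commutator_mem_iff[OF Z] xK h.hom_closed by auto
    have sC: "subgroup ?C ?H"
      unfolding C by (rule h.subgroup_vimage) (rule Q.subgroup_centralizer, use hx in simp)
    have "subgroup ?C G" using incl_subgroup[OF K sC] .
    moreover have "{x, z} \<subseteq> ?C"
    proof -
      have "commutator ?H x x = \<one>" using com xK KG x by (simp add: commutator_def m_assoc)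
      then have "x \<in> ?C" using Z.one_closed xK by simp
      moreover have "z \<in> ?C" using H.commutator_mem_normal[OF Z zZ] xK by simp
      ultimately show ?thesis by simp
    qed
    ultimately have "?K \<subseteq> ?C" by (rule generate_subgroup_incl[rotated])
    then have C': "commutator ?H g x \<in> ?Z" if "g \<in> ?K" for g using that by auto
    have "commutator ?H x g \<in> ?Z" if g: "g \<in> ?K" for g
      using C'[OF g] H.commutator_mem_iff[OF Z, of g x] H.commutator_mem_iff[OF Z, of x g] g xK by auto
    then show ?thesis using xK by simp
  qed
  have "subgroup (central_above ?H {\<one>} (Suc n)) G"
    using incl_subgroup[OF K normal_imp_subgroup[OF suc]] .
  then have "?K \<subseteq> central_above ?H {\<one>} (Suc n)"
    using generate_subgroup_incl[of "{x, z}"] xS zS by blast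
  then have "central_above ?H {\<one>} (Suc n) = carrier ?H"
    using subgroup.subset[OF normal_imp_subgroup[OF suc]] by auto
  then show ?thesis unfolding H.nilpotent_group_iff
    by (intro exI[of _ "Suc n"]) (simp del: central_above.simps)
qed

section \<open>Dense sets of nilpotent pairs in finite groups\<close>

definition nil_partners :: "('a, 'b) monoid_scheme \<Rightarrow> 'a \<Rightarrow> 'a set" where
  "nil_partners G x = {y \<in> carrier G. nilpotent_group (G\<lparr>carrier := generate G {x, y}\<rparr>)}"

lemma card_Union_bound:
  assumes "finite \<B>" "\<And>B. B \<in> \<B> \<Longrightarrow> 12 * card B \<le> (s::nat)" "card \<B> \<le> m"
  shows "12 * card (\<Union>\<B>) \<le> m * s"
proof -
  have "12 * card (\<Union>\<B>) \<le> 12 * sum card \<B>" using card_Union_le_sum_card by simp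
  also have "\<dots> = (\<Sum>B\<in>\<B>. 12 * card B)" by (simp add: sum_distrib_left)
  also have "\<dots> \<le> card \<B> * s" using sum_bounded_above[of \<B> "\<lambda>B. 12 * card B" s] assms(2) by simp
  also have "\<dots> \<le> m * s" using assms(3) by simp
  finally show ?thesis .
qed

text \<open>Double counting of the pairs on which \<open>P\<close> fails. The fraction 5/12 stands
  for five exceptional sets of at most a twelfth each; it is below 1/2, so the chosen
  \<open>y\<close> is good for more than half of \<open>T\<close>.\<close>

lemma exists_mostly_good:
  assumes fin: "finite T" "finite S" and S: "S \<noteq> {}"
    and bad: "\<And>u. u \<in> T \<Longrightarrow> 12 * card {y \<in> S. \<not> P u y} \<le> 5 * card S"
  obtains y where "y \<in> S" "12 * card {u \<in> T. \<not> P u y} \<le> 5 * card T"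
proof (rule ccontr)
  assume "\<not> thesis"
  then have less: "5 * card T + 1 \<le> 12 * card {u \<in> T. \<not> P u y}" if "y \<in> S" for y
    using that \<open>\<And>y. y \<in> S \<Longrightarrow> 12 * card {u \<in> T. \<not> P u y} \<le> 5 * card T \<Longrightarrow> thesis\<close> by force
  have "card S * (5 * card T + 1) = (\<Sum>y\<in>S. 5 * card T + 1)" by simp
  also have "\<dots> \<le> (\<Sum>y\<in>S. 12 * card {u \<in> T. \<not> P u y})" by (rule sum_mono) (rule less)
  also have "\<dots> = 12 * (\<Sum>y\<in>S. \<Sum>u\<in>T. if \<not> P u y then 1 else 0)"
    by (simp only: card_as_sums[OF refl fin(1)] card_as_sums[OF refl fin(2)] sum_distrib_left)
  also have "\<dots> = 12 * (\<Sum>u\<in>T. \<Sum>y\<in>S. if \<not> P u y then 1 else 0)" by (subst sum.swap) simp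
  also have "\<dots> = (\<Sum>u\<in>T. 12 * card {y \<in> S. \<not> P u y})"
    by (simp only: card_as_sums[OF refl fin(1)] card_as_sums[OF refl fin(2)] sum_distrib_left)
  also have "\<dots> \<le> (\<Sum>u\<in>T. 5 * card S)" by (rule sum_mono) (rule bad)
  also have "\<dots> = card T * (5 * card S)" by simp
  finally have "card S = 0" by (simp add: algebra_simps)
  then show False using S fin by simp
qed

section \<open>Auxiliary facts on finite groups\<close>

context group begin

lemma subgroup_eq_if_large:
  assumes "subgroup H G" "subgroup K G" "H \<subseteq> K" "finite K" "card K < 2 * card H"
  shows "H = K"
proof -
  obtain m where m: "card K = card H * m" using card_subgroup_dvd[OF assms(1-3)] by (elim dvdE)
  have "card K \<noteq> 0" using assms(4) subgroup.one_closed[OF assms(2)] by auto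
  then have "m \<noteq> 0" using m by auto
  moreover have "m < 2"
  proof (rule ccontr)
    assume "\<not> m < 2"
    then have "card H * 2 \<le> card H * m" by simp
    then show False using m assms(5) by simp
  qed
  ultimately have "card K = card H" using m by (cases m) auto
  then show ?thesis using assms(3,4) card_subset_eq by metis
qed

lemma commute_mult:
  assumes "x \<in> carrier G" "y \<in> carrier G" "z \<in> carrier G" "x \<otimes> y = y \<otimes> x" "x \<otimes> z = z \<otimes> x"
  shows "x \<otimes> (y \<otimes> z) = (y \<otimes> z) \<otimes> x"
  using assms by (metis m_assoc)

lemma commute_inv:
  assumes "x \<in> carrier G" "y \<in> carrier G" "x \<otimes> y = y \<otimes> x"
  shows "x \<otimes> inv y = inv y \<otimes> x"
  using assms by (metis inv_closed inv_solve_left inv_solve_right m_assoc m_closed)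

lemma sylow_containing:
  assumes fin: "finite (carrier G)" and p: "Factorial_Ring.prime (p::nat)" and P: "subgroup P G" "card P = p ^ k"
  obtains Q b where "subgroup Q G" "P \<subseteq> Q" "card Q = p ^ b" "\<not> p dvd card (rcosets Q)"
proof -
  obtain b m Q where Q: "order G = p ^ b * m" "\<not> p dvd m" "subgroup Q G" "card Q = p ^ b"
    using sylow_exists[OF fin p] by blast
  have "\<not> p dvd card (rcosets Q)" using sylow_index[OF fin Q p] Q(2) by simp
  then obtain u where u: "u \<in> carrier G" "\<And>x. x \<in> P \<Longrightarrow> u \<otimes> x \<otimes> inv u \<in> Q"
    using sylow_conj[OF fin Q(3) P p] by blast
  interpret Q: subgroup Q G by (rule Q(3))
  let ?Q = "{x \<in> carrier G. u \<otimes> x \<otimes> inv u \<in> Q}"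
  have sub: "subgroup ?Q G"
  proof
    fix x y assume x: "x \<in> ?Q" and y: "y \<in> ?Q"
    have "(u \<otimes> x \<otimes> inv u) \<otimes> (u \<otimes> y \<otimes> inv u) \<in> Q" using x y by simp
    moreover have "(u \<otimes> x \<otimes> inv u) \<otimes> (u \<otimes> y \<otimes> inv u) = u \<otimes> (x \<otimes> y) \<otimes> inv u"
      using x y u(1) by (simp add: group_word)
    ultimately show "x \<otimes> y \<in> ?Q" using x y by simp
  next
    fix x assume x: "x \<in> ?Q"
    have "inv (u \<otimes> x \<otimes> inv u) \<in> Q" using x by simp
    moreover have "inv (u \<otimes> x \<otimes> inv u) = u \<otimes> inv x \<otimes> inv u"
      using x u(1) by (simp add: group_word)
    ultimately show "inv x \<in> ?Q" using x by simp
  qed (use u(1) in auto)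
  have "bij_betw (\<lambda>x. u \<otimes> x \<otimes> inv u) ?Q Q"
    by (rule bij_betw_byWitness[of _ "\<lambda>x. inv u \<otimes> x \<otimes> u"]) (use u(1) in \<open>auto simp: group_word\<close>)
  then have "card ?Q = p ^ b" using bij_betw_same_card Q(4) by fastforce
  moreover have "P \<subseteq> ?Q" using u P(1) subgroup.subset by blast
  ultimately show thesis using that[OF sub] sylow_index[OF fin Q(1,2) sub _ p] Q(2) by simp
qed

end

context group_split begin

text \<open>All claims hold inside the nilpotent group generated by \<open>x\<close> and
  \<open>y\<close>. With the exponents \<open>e\<close> and \<open>f\<close> fixed in advance,
  primary parts computed there agree with those in \<open>G\<close>.\<close>

lemma nil_partners_parts:
  assumes fin: "finite (carrier G)" and x: "x \<in> carrier G" and y: "y \<in> nil_partners G x"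
  shows "(x \<otimes> y) [^] e = x [^] e \<otimes> y [^] e"
    and "(x \<otimes> y) [^] f = x [^] f \<otimes> y [^] f"
    and "x [^] e \<otimes> y [^] f = y [^] f \<otimes> x [^] e"
    and "y [^] e \<otimes> x [^] f = x [^] f \<otimes> y [^] e"
    and "\<exists>P k. subgroup P G \<and> card P = p ^ k \<and> x [^] e \<in> P \<and> y [^] e \<in> P"
proof -
  let ?K = "generate G {x, y}" and ?H = "G\<lparr>carrier := generate G {x, y}\<rparr>"
  have yG: "y \<in> carrier G" and nil: "nilpotent_group ?H" using y by (auto simp: nil_partners_def)
  have K: "subgroup ?K G" using generate_is_subgroup x yG by simp
  interpret H: group_split ?H p a t e f by (rule subgroup_split[OF K])
  have finK: "finite (carrier ?H)" using fin subgroup.subset[OF K] finite_subset by simp blast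
  have xy: "x \<in> carrier ?H" "y \<in> carrier ?H" by (auto intro: generate.incl)
  have pow: "z [^]\<^bsub>?H\<^esub> n = z [^] n" for z and n :: nat by (simp flip: nat_pow_consistent)
  show "(x \<otimes> y) [^] e = x [^] e \<otimes> y [^] e" "(x \<otimes> y) [^] f = x [^] f \<otimes> y [^] f"
    "x [^] e \<otimes> y [^] f = y [^] f \<otimes> x [^] e" "y [^] e \<otimes> x [^] f = x [^] f \<otimes> y [^] e"
    using H.nilpotent_part_mult[OF nil finK xy] H.nilpotent_part_mult(3)[OF nil finK xy(2,1)]
    by (simp_all add: pow)
  obtain P k where P: "subgroup P ?H" "card P = p ^ k"
      "\<And>x i. x \<in> carrier ?H \<Longrightarrow> x [^]\<^bsub>?H\<^esub> (p ^ i) = \<one>\<^bsub>?H\<^esub> \<Longrightarrow> x \<in> P"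
    using H.nilpotent_sylow[OF nil finK prime_p] by blast
  have "x [^] e \<in> P" "y [^] e \<in> P"
    using P(3)[OF H.nat_pow_closed[OF xy(1), of e], of a] P(3)[OF H.nat_pow_closed[OF xy(2), of e], of a]
      H.part_pow_pa[OF xy(1)] H.part_pow_pa[OF xy(2)] by (simp_all add: pow)
  then show "\<exists>P k. subgroup P G \<and> card P = p ^ k \<and> x [^] e \<in> P \<and> y [^] e \<in> P"
    using P(2) incl_subgroup[OF K P(1)] by blast
qed

end

text \<open>The constant 12 leaves room to choose an element of \<open>S\<close> that is a nilpotent partner of up to
  a dozen prescribed elements of the coset \<open>N c\<close> simultaneously.\<close>

locale dense_pairs = group G + normal N G for G (structure) and N +
  fixes c :: 'a and S :: "'a set"
  assumes fin: "finite (carrier G)"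
    and c: "c \<in> carrier G"
    and S: "S \<subseteq> carrier G"
    and N_S: "v \<in> N \<Longrightarrow> y \<in> S \<Longrightarrow> v \<otimes> y \<in> S"
    and D_S: "x \<in> N #> c \<Longrightarrow> y \<in> S \<Longrightarrow> x \<otimes> y \<in> S"
    and dense: "x \<in> N #> c \<Longrightarrow> 12 * card (S - nil_partners G x) < card S"
begin

lemma finS: "finite S" using fin S finite_subset by blast

lemma NG: "v \<in> N \<Longrightarrow> v \<in> carrier G" using subset by blast

lemma c_D: "c \<in> N #> c" using rcos_self[OF c subgroup_axioms] .

lemma S_ne: "S \<noteq> {}" using dense[OF c_D] by auto

lemma SG: "y \<in> S \<Longrightarrow> y \<in> carrier G" using S by blast

lemma DG: "x \<in> N #> c \<Longrightarrow> x \<in> carrier G" using c subset r_coset_subset_G by blast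

lemma D_mult: "x \<in> N #> c \<Longrightarrow> v \<in> N \<Longrightarrow> x \<otimes> v \<in> N #> c"
proof -
  assume x: "x \<in> N #> c" and v: "v \<in> N"
  then obtain n where n: "n \<in> N" "x = n \<otimes> c" by (auto simp: r_coset_def)
  have "x \<otimes> v = (n \<otimes> (c \<otimes> v \<otimes> inv c)) \<otimes> c" using n v c NG by (simp add: group_word)
  moreover have "n \<otimes> (c \<otimes> v \<otimes> inv c) \<in> N" using n v c by (simp add: inv_op_closed2)
  ultimately show ?thesis by (auto simp: r_coset_def)
qed

definition bad :: "'a \<Rightarrow> 'a \<Rightarrow> 'a set" where
  "bad g x = {y \<in> S. g \<otimes> y \<notin> nil_partners G x}"

lemma fin_bad: "finite (bad g x)" using finS by (simp add: bad_def)

text \<open>Left multiplication by \<open>g\<close> preserves \<open>S\<close> and embeds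
  \<open>bad g x\<close> into the set of non-partners of \<open>x\<close>.\<close>

lemma card_bad:
  assumes x: "x \<in> N #> c" and g: "g \<in> carrier G" "\<And>y. y \<in> S \<Longrightarrow> g \<otimes> y \<in> S"
  shows "12 * card (bad g x) \<le> card S"
proof -
  have inj: "inj_on (\<lambda>y. g \<otimes> y) (bad g x)" using g(1) SG by (auto simp: inj_on_def bad_def)
  have "(\<lambda>y. g \<otimes> y) ` bad g x \<subseteq> S - nil_partners G x" using g by (auto simp: bad_def)
  then have "card (bad g x) \<le> card (S - nil_partners G x)"
    using inj finS by (metis card_image card_mono finite_Diff)
  then show ?thesis using dense[OF x] by simp
qed

lemma card_bad_N: "x \<in> N #> c \<Longrightarrow> v \<in> N \<Longrightarrow> 12 * card (bad v x) \<le> card S"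
  using card_bad N_S NG by blast

lemma card_bad_D: "x \<in> N #> c \<Longrightarrow> x' \<in> N #> c \<Longrightarrow> 12 * card (bad x' x) \<le> card S"
  using card_bad D_S DG by blast

lemma pick:
  assumes "\<And>B. B \<in> set Bs \<Longrightarrow> 12 * card B \<le> card S" "\<And>B. B \<in> set Bs \<Longrightarrow> finite B" "length Bs \<le> 5"
  obtains y where "y \<in> S" "y \<notin> \<Union>(set Bs)"
proof -
  let ?\<B> = "set Bs"
  have "card ?\<B> \<le> 5" using card_length[of Bs] assms(3) by linarith
  then have "12 * card (\<Union>?\<B>) \<le> 5 * card S" using card_Union_bound[of ?\<B>] assms(1) by simp
  moreover have "card S \<noteq> 0" using finS S_ne by simp
  ultimately have lt: "card (\<Union>?\<B>) < card S" by linarith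
  have "finite (\<Union>?\<B>)" using assms(2) by simp
  then have "\<not> S \<subseteq> \<Union>?\<B>" using card_mono[of "\<Union>?\<B>" S] lt by linarith
  then show thesis using that by blast
qed

end

section \<open>Primary parts on a dense coset\<close>

locale dense_split = dense_pairs G N c S + group_split G p a t e f
  for G (structure) and N c S p a t e f
begin

lemma partners:
  assumes x: "x \<in> carrier G" and y: "y \<in> nil_partners G x"
  shows partners_e: "(x \<otimes> y) [^] e = x [^] e \<otimes> y [^] e"
    and partners_f: "(x \<otimes> y) [^] f = x [^] f \<otimes> y [^] f"
    and partners_ef: "x [^] e \<otimes> y [^] f = y [^] f \<otimes> x [^] e"
    and partners_fe: "y [^] e \<otimes> x [^] f = x [^] f \<otimes> y [^] e"
    and partners_p: "\<exists>P k. subgroup P G \<and> card P = p ^ k \<and> x [^] e \<in> P \<and> y [^] e \<in> P"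
  using nil_partners_parts[OF fin x y] by blast+

text \<open>A \<open>y\<close> is chosen that is a partner of \<open>x\<close> and of
  \<open>x'\<close>, with \<open>x' \<otimes> y\<close> a partner of \<open>x\<close>. Then
  \<open>x [^] e\<close> commutes with \<open>y [^] f\<close> and with
  \<open>(x' \<otimes> y) [^] f\<close>, which is \<open>x' [^] f \<otimes> y [^] f\<close>; the
  factor from \<open>y\<close> cancels.\<close>

lemma D_commute:
  assumes x: "x \<in> N #> c" and x': "x' \<in> N #> c"
  shows "x [^] e \<otimes> x' [^] f = x' [^] f \<otimes> x [^] e"
proof -
  let ?B = "[bad \<one> x, bad \<one> x', bad x' x]"
  have b: "12 * card B \<le> card S" "finite B" if "B \<in> set ?B" for B
    using that card_bad_N[OF _ one_closed] card_bad_D x x' fin_bad by auto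
  obtain y where y: "y \<in> S" "y \<notin> \<Union>(set ?B)" by (rule pick[of ?B, OF b]) auto
  have G: "x \<in> carrier G" "x' \<in> carrier G" "y \<in> carrier G" using x x' y DG SG by auto
  have ny: "y \<in> nil_partners G x" "y \<in> nil_partners G x'" "x' \<otimes> y \<in> nil_partners G x"
    using y G by (auto simp: bad_def)
  have 1: "x [^] e \<otimes> y [^] f = y [^] f \<otimes> x [^] e" using partners_ef[OF G(1) ny(1)] .
  have 2: "x [^] e \<otimes> (x' [^] f \<otimes> y [^] f) = (x' [^] f \<otimes> y [^] f) \<otimes> x [^] e"
    using partners_ef[OF G(1) ny(3)] partners_f[OF G(2) ny(2)] by simp
  have "x [^] e \<otimes> ((x' [^] f \<otimes> y [^] f) \<otimes> inv (y [^] f)) = ((x' [^] f \<otimes> y [^] f) \<otimes> inv (y [^] f)) \<otimes> x [^] e"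
    by (rule commute_mult[OF _ _ _ 2 commute_inv[OF _ _ 1]]) (use G in auto)
  then show ?thesis using G by (simp add: m_assoc)
qed

text \<open>The primary parts of the elements of the coset differ by values of an endomorphism of \<open>N\<close>:
  \<open>(x v)\<^sup>i = x\<^sup>i \<cdot> shift i v\<close> for all \<open>x \<in> N c\<close>, where \<open>i\<close> is \<open>e\<close> or \<open>f\<close>.\<close>

definition shift :: "nat \<Rightarrow> 'a \<Rightarrow> 'a" where
  "shift i v = inv (c [^] i) \<otimes> (c \<otimes> v) [^] i"

lemma shift_closed: "v \<in> N \<Longrightarrow> shift i v \<in> carrier G"
  using c NG by (simp add: shift_def)

text \<open>The product \<open>x v y\<close> is bracketed in two ways. If
  \<open>v \<otimes> y\<close> is a partner of \<open>x\<close> and \<open>y\<close> a partner of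
  \<open>x \<otimes> v\<close>, then the quotient of \<open>(x \<otimes> v) [^] i\<close> by
  \<open>x [^] i\<close> is expressed through \<open>v\<close> and \<open>y\<close> alone. A
  \<open>y\<close> that serves \<open>c\<close> as well shows that this quotient does not depend on
  \<open>x\<close>.\<close>

lemma pow_D_mult:
  assumes x: "x \<in> N #> c" and v: "v \<in> N" and i: "i \<in> {e, f}"
  shows "(x \<otimes> v) [^] i = x [^] i \<otimes> shift i v"
proof -
  let ?B = "[bad v x, bad \<one> (x \<otimes> v), bad v c, bad \<one> (c \<otimes> v)]"
  have b: "12 * card B \<le> card S" "finite B" if "B \<in> set ?B" for B
    using that card_bad_N D_mult[OF x v] D_mult[OF c_D v] c_D x v one_closed fin_bad by auto
  obtain y where y: "y \<in> S" "y \<notin> \<Union>(set ?B)" by (rule pick[of ?B, OF b]) auto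
  have G: "x \<in> carrier G" "v \<in> carrier G" "y \<in> carrier G" using x v y DG SG NG by auto
  have ny: "v \<otimes> y \<in> nil_partners G x" "y \<in> nil_partners G (x \<otimes> v)"
      "v \<otimes> y \<in> nil_partners G c" "y \<in> nil_partners G (c \<otimes> v)"
    using y G c by (auto simp: bad_def)
  have pi: "(x \<otimes> y) [^] i = x [^] i \<otimes> y [^] i" if "x \<in> carrier G" "y \<in> nil_partners G x" for x y
    using partners_e[OF that] partners_f[OF that] i by auto
  have *: "inv (z [^] i) \<otimes> (z \<otimes> v) [^] i = (v \<otimes> y) [^] i \<otimes> inv (y [^] i)"
    if z: "z \<in> carrier G" "v \<otimes> y \<in> nil_partners G z" "y \<in> nil_partners G (z \<otimes> v)" for z
  proof -
    have "(z \<otimes> v) [^] i \<otimes> y [^] i = (z \<otimes> v \<otimes> y) [^] i" using pi[OF _ z(3)] z G by simp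
    also have "z \<otimes> v \<otimes> y = z \<otimes> (v \<otimes> y)" using z G by (simp add: m_assoc)
    also have "(z \<otimes> (v \<otimes> y)) [^] i = z [^] i \<otimes> (v \<otimes> y) [^] i" using pi[OF z(1,2)] .
    finally have eq: "(z \<otimes> v) [^] i \<otimes> y [^] i = z [^] i \<otimes> (v \<otimes> y) [^] i" .
    have "inv (z [^] i) \<otimes> (z \<otimes> v) [^] i = inv (z [^] i) \<otimes> ((z \<otimes> v) [^] i \<otimes> y [^] i) \<otimes> inv (y [^] i)"
      using z G by (simp add: m_assoc)
    also have "\<dots> = (v \<otimes> y) [^] i \<otimes> inv (y [^] i)"
      unfolding eq using z G by (simp add: group_word)
    finally show ?thesis .
  qed
  have "inv (x [^] i) \<otimes> (x \<otimes> v) [^] i = shift i v"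
    using *[OF G(1) ny(1,2)] *[OF c ny(3,4)] by (simp add: shift_def)
  then have "x [^] i \<otimes> (inv (x [^] i) \<otimes> (x \<otimes> v) [^] i) = x [^] i \<otimes> shift i v" by simp
  then show ?thesis using G by (simp add: cancel_inv_left)
qed

lemma shift_in_N:
  assumes v: "v \<in> N"
  shows "shift i v \<in> N"
proof -
  have vG: "v \<in> carrier G" using v NG by auto
  have "N #> (c \<otimes> v) = N #> c"
    using v vG c inv_op_closed2[OF c v] rcoset_eq_iff[OF subgroup_axioms] by simp
  then have "N #> ((c \<otimes> v) [^] i) = N #> (c [^] i)"
    using c vG FactGroup_pow[of "c \<otimes> v" i] FactGroup_pow[of c i] by simp
  then have "(c \<otimes> v) [^] i \<otimes> inv (c [^] i) \<in> N"
    using c vG rcoset_eq_iff[OF subgroup_axioms] by simp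
  then have "inv (c [^] i) \<otimes> ((c \<otimes> v) [^] i \<otimes> inv (c [^] i)) \<otimes> inv (inv (c [^] i)) \<in> N"
    using c by (intro inv_op_closed2) auto
  then show ?thesis using c vG by (simp add: shift_def group_word)
qed

lemma shift_mult:
  assumes v: "v \<in> N" and w: "w \<in> N" and i: "i \<in> {e, f}"
  shows "shift i (v \<otimes> w) = shift i v \<otimes> shift i w"
proof -
  have "(c \<otimes> (v \<otimes> w)) [^] i = (c \<otimes> v \<otimes> w) [^] i" using c v w NG by (simp add: m_assoc)
  also have "\<dots> = c [^] i \<otimes> shift i v \<otimes> shift i w"
    using pow_D_mult[OF D_mult[OF c_D v] w i] pow_D_mult[OF c_D v i] by simp
  finally show ?thesis using c shift_closed v w by (simp add: shift_def[of i "v \<otimes> w"] group_word)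
qed

lemma D_commute_shift:
  assumes x: "x \<in> N #> c" and v: "v \<in> N"
  shows "x [^] e \<otimes> shift f v = shift f v \<otimes> x [^] e"
    and "x [^] f \<otimes> shift e v = shift e v \<otimes> x [^] f"
proof -
  have G: "x \<in> carrier G" "v \<in> carrier G" using x v DG NG by auto
  note D = c_D D_mult[OF c_D v]
  show "x [^] e \<otimes> shift f v = shift f v \<otimes> x [^] e"
    unfolding shift_def
    by (rule commute_mult[OF _ _ _ commute_inv[OF _ _ D_commute[OF x D(1)]] D_commute[OF x D(2)]])
      (use G c in auto)
  show "x [^] f \<otimes> shift e v = shift e v \<otimes> x [^] f"
    unfolding shift_def
    by (rule commute_mult[OF _ _ _ commute_inv[OF _ _ D_commute[OF D(1) x, symmetric]]
          D_commute[OF D(2) x, symmetric]])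
      (use G c in auto)
qed

lemma shift_commute:
  assumes v: "v \<in> N" and w: "w \<in> N"
  shows "shift e v \<otimes> shift f w = shift f w \<otimes> shift e v"
proof -
  have "shift f w \<otimes> shift e v = shift e v \<otimes> shift f w"
    unfolding shift_def[of e]
    by (rule commute_mult[OF _ _ _ commute_inv[OF _ _ D_commute_shift(1)[OF c_D w, symmetric]]
          D_commute_shift(1)[OF D_mult[OF c_D v] w, symmetric]])
      (use v w c NG shift_closed in auto)
  then show ?thesis by simp
qed

lemma shift_decomp:
  assumes v: "v \<in> N"
  shows "shift e v \<otimes> shift f v = v"
proof -
  have G: "v \<in> carrier G" "shift e v \<in> carrier G" "shift f v \<in> carrier G"
    using v NG shift_closed by auto
  have "c \<otimes> v = (c \<otimes> v) [^] e \<otimes> (c \<otimes> v) [^] f" using part_mult c G by simp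
  also have "\<dots> = c [^] e \<otimes> (shift e v \<otimes> c [^] f) \<otimes> shift f v"
    using pow_D_mult[OF c_D v] c G by (simp add: m_assoc)
  also have "shift e v \<otimes> c [^] f = c [^] f \<otimes> shift e v" using D_commute_shift(2)[OF c_D v] by simp
  also have "c [^] e \<otimes> (c [^] f \<otimes> shift e v) \<otimes> shift f v = (c [^] e \<otimes> c [^] f) \<otimes> (shift e v \<otimes> shift f v)"
    using c G by (simp add: m_assoc)
  also have "\<dots> = c \<otimes> (shift e v \<otimes> shift f v)" using part_mult c by simp
  finally show ?thesis using c G by simp
qed

text \<open>The element \<open>c \<otimes> shift e v\<close> is the product of the
  \<open>p'\<close>-part of \<open>c\<close> and the \<open>p\<close>-part of
  \<open>c \<otimes> v\<close>. These commute, so its primary parts can be read off.\<close>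

lemma
  assumes v: "v \<in> N"
  shows shift_e_idem: "shift e (shift e v) = shift e v" and shift_fe: "shift f (shift e v) = \<one>"
proof -
  let ?u = "(c \<otimes> v) [^] e" and ?w = "c [^] f"
  have G: "v \<in> carrier G" "?u \<in> carrier G" "?w \<in> carrier G" using v NG c by auto
  have "c \<otimes> shift e v = ?w \<otimes> (c [^] e \<otimes> shift e v)"
    using part_mult'[OF c] c shift_closed[OF v] by (simp flip: m_assoc)
  also have "\<dots> = ?w \<otimes> ?u" using pow_D_mult[OF c_D v] by simp
  finally have eq: "c \<otimes> shift e v = ?w \<otimes> ?u" .
  have com: "?w \<otimes> ?u = ?u \<otimes> ?w" using D_commute[OF D_mult[OF c_D v] c_D] by simp
  have "(?w \<otimes> ?u) [^] e = ?u" "(?w \<otimes> ?u) [^] f = ?w"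
    using pow_mult_distrib[OF com G(3,2)] part_ee part_fe part_ef part_ff c G by simp_all
  then show "shift e (shift e v) = shift e v" "shift f (shift e v) = \<one>"
    using c unfolding shift_def[of _ "shift e v"] eq by (simp_all add: shift_def)
qed

lemma shift_one: "i \<in> {e, f} \<Longrightarrow> shift i \<one> = \<one>"
  using c by (simp add: shift_def)

lemma shift_ef:
  assumes v: "v \<in> N"
  shows "shift e (shift f v) = \<one>"
proof -
  have N: "shift e v \<in> N" "shift f v \<in> N" using shift_in_N v by auto
  have "shift e v = shift e (shift e v \<otimes> shift f v)" using shift_decomp[OF v] by simp
  also have "\<dots> = shift e v \<otimes> shift e (shift f v)" using shift_mult[OF N] shift_e_idem[OF v] by simp
  finally show ?thesis using shift_closed N v by (metis l_cancel_one')
qed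

lemma shift_pow: "v \<in> N \<Longrightarrow> i \<in> {e, f} \<Longrightarrow> shift i (v [^] n) = shift i v [^] (n::nat)"
proof (induct n)
  case (Suc n)
  have "v [^] n \<in> N" using subgroup_pow_closed[OF subgroup_axioms] Suc by simp
  then show ?case using Suc shift_mult by simp
qed (simp add: shift_one)

lemma shift_inv:
  assumes "v \<in> N" "i \<in> {e, f}"
  shows "shift i (inv v) = inv (shift i v)"
proof -
  have "shift i (inv v) \<otimes> shift i v = \<one>"
    using shift_mult[of "inv v" v i] assms shift_one NG by simp
  then show ?thesis using shift_closed assms by (simp add: inv_equality)
qed

text \<open>\<open>N\<close> is the product of \<open>A\<close> and the image of
  \<open>shift f\<close>, which commute elementwise: \<open>A\<close> is the candidate for the
  \<open>p\<close>-component of \<open>N\<close>.\<close>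

definition A where "A = shift e ` N"

lemma A_N: "v \<in> A \<Longrightarrow> v \<in> N" using shift_in_N by (auto simp: A_def)

lemma A_fix: "v \<in> A \<Longrightarrow> shift e v = v" using shift_e_idem by (auto simp: A_def)

lemma AG: "v \<in> A \<Longrightarrow> v \<in> carrier G" using A_N NG by blast

lemma A_subgroup: "subgroup A G"
proof
  show "A \<subseteq> carrier G" using AG by blast
  show "\<one> \<in> A" using shift_one[of e] by (auto simp: A_def intro: image_eqI[of _ _ \<one>])
next
  fix v w assume v: "v \<in> A" and w: "w \<in> A"
  then have "shift e (v \<otimes> w) = v \<otimes> w" using shift_mult A_N A_fix by simp
  then show "v \<otimes> w \<in> A" using A_N v w by (auto simp: A_def intro: image_eqI[of _ _ "v \<otimes> w"])
next
  fix v assume v: "v \<in> A"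
  then have "shift e (inv v) = inv v" using shift_inv A_N A_fix by simp
  then show "inv v \<in> A" using A_N v by (auto simp: A_def intro: image_eqI[of _ _ "inv v"])
qed

lemma finA: "finite A" using fin subgroup.subset[OF A_subgroup] finite_subset by blast

lemma finN: "finite N" using fin subset finite_subset by blast

text \<open>A single \<open>y\<close> has to serve two purposes, so the averaging runs over triples
  \<open>((v, w), u)\<close>: most pairs \<open>(v, w)\<close> must give a common
  \<open>p\<close>-subgroup, and \<open>y [^] e\<close> must commute with every
  \<open>shift f u\<close>.\<close>

lemma card_half_good:
  obtains y where "y \<in> S" "\<And>u. u \<in> N \<Longrightarrow> y [^] e \<otimes> shift f u = shift f u \<otimes> y [^] e"
    "card A * card A < 2 * card {(v, w). v \<in> A \<and> w \<in> A \<and>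
      (\<exists>P k. subgroup P G \<and> card P = p ^ k \<and> c [^] e \<otimes> v \<in> P \<and> w \<otimes> y [^] e \<in> P)}"
proof -
  let ?T = "(A \<times> A) \<times> N"
  \<comment> \<open>\<open>w y\<close> as partner of \<open>c\<close> and \<open>y\<close> as
    partner of \<open>c w\<close> give \<open>(w \<otimes> y) [^] e = w \<otimes> y [^] e\<close>;
    \<open>w y\<close> as partner of \<open>c v\<close> puts the two \<open>p\<close>-elements into
    a common \<open>p\<close>-subgroup; \<open>y\<close> as partner of \<open>c\<close> and of
    \<open>c u\<close> makes \<open>y [^] e\<close> commute with \<open>shift f u\<close>.\<close>
  define Bs where "Bs = (\<lambda>((v, w), u). [bad w (c \<otimes> v), bad w c, bad \<one> (c \<otimes> w), bad \<one> c, bad \<one> (c \<otimes> u)])"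
  define good where "good = (\<lambda>\<tau> y. \<forall>B \<in> set (Bs \<tau>). y \<notin> B)"
  have finT: "finite ?T" using finA finN by simp
  have bad: "12 * card {y \<in> S. \<not> good \<tau> y} \<le> 5 * card S" if \<tau>: "\<tau> \<in> ?T" for \<tau>
  proof -
    obtain v w u where vwu: "\<tau> = ((v, w), u)" "v \<in> A" "w \<in> A" "u \<in> N" using \<tau> by auto
    have "card (set (Bs \<tau>)) \<le> 5" using card_length[of "Bs \<tau>"] vwu by (simp add: Bs_def)
    moreover have "12 * card B \<le> card S" if "B \<in> set (Bs \<tau>)" for B
      using that vwu A_N card_bad_N D_mult[OF c_D] c_D one_closed by (auto simp: Bs_def)
    ultimately have "12 * card (\<Union>(set (Bs \<tau>))) \<le> 5 * card S" using card_Union_bound[of "set (Bs \<tau>)"] by simp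
    moreover have "{y \<in> S. \<not> good \<tau> y} \<subseteq> \<Union>(set (Bs \<tau>))" by (auto simp: good_def)
    moreover have "finite (\<Union>(set (Bs \<tau>)))" using vwu fin_bad by (auto simp: Bs_def)
    ultimately show ?thesis using card_mono[of "\<Union>(set (Bs \<tau>))" "{y \<in> S. \<not> good \<tau> y}"] by linarith
  qed
  obtain y where y: "y \<in> S" "12 * card {\<tau> \<in> ?T. \<not> good \<tau> y} \<le> 5 * card ?T"
    by (rule exists_mostly_good[OF finT finS S_ne, where P = good, OF bad])
  let ?g = "{\<tau> \<in> ?T. good \<tau> y}"
  have "card ?T = card ?g + card {\<tau> \<in> ?T. \<not> good \<tau> y}"
  proof -
    have "?T = ?g \<union> {\<tau> \<in> ?T. \<not> good \<tau> y}" by blast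
    then show ?thesis using card_Un_disjoint[of ?g "{\<tau> \<in> ?T. \<not> good \<tau> y}"] finT by auto
  qed
  moreover have "card ?T \<noteq> 0"
  proof -
    have "A \<noteq> {}" "N \<noteq> {}" using one_closed subgroup.one_closed[OF A_subgroup] by blast+
    then show ?thesis using finA finN by simp
  qed
  ultimately have half: "card ?T < 2 * card ?g" using y(2) by linarith
  have yG: "y \<in> carrier G" using y SG by simp
  have ng: "w \<otimes> y \<in> nil_partners G (c \<otimes> v)" "w \<otimes> y \<in> nil_partners G c" "y \<in> nil_partners G (c \<otimes> w)"
      "y \<in> nil_partners G c" "y \<in> nil_partners G (c \<otimes> u)" if g: "good ((v, w), u) y" for v w u
  proof -
    have "y \<notin> bad w (c \<otimes> v)" "y \<notin> bad w c" "y \<notin> bad \<one> (c \<otimes> w)" "y \<notin> bad \<one> c" "y \<notin> bad \<one> (c \<otimes> u)"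
      using g by (simp_all add: good_def Bs_def)
    then show "w \<otimes> y \<in> nil_partners G (c \<otimes> v)" "w \<otimes> y \<in> nil_partners G c" "y \<in> nil_partners G (c \<otimes> w)"
      "y \<in> nil_partners G c" "y \<in> nil_partners G (c \<otimes> u)"
      using y(1) yG by (simp_all add: bad_def)
  qed
  let ?V = "{u \<in> N. \<exists>v w. ((v, w), u) \<in> ?g}"
  let ?W = "{g \<in> carrier G. \<forall>x \<in> {y [^] e}. g \<otimes> x = x \<otimes> g}"
  have Vcom: "y [^] e \<otimes> shift f u = shift f u \<otimes> y [^] e" if u: "u \<in> ?V" for u
  proof -
    obtain v w where vwu: "good ((v, w), u) y" "u \<in> N" using u by auto
    have cu: "c \<otimes> u \<in> carrier G" using c vwu(2) NG by simp
    show ?thesis unfolding shift_def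
      by (rule commute_mult[OF _ _ _ commute_inv[OF _ _ partners_fe[OF c ng(4)[OF vwu(1)]]]
            partners_fe[OF cu ng(5)[OF vwu(1)]]])
        (use yG c cu in auto)
  qed
  let ?H = "{u \<in> N. shift f u \<in> ?W}"
  have W: "subgroup ?W G" using subgroup_centralizer[of "{y [^] e}"] yG by simp
  have H: "subgroup ?H G"
  proof
    fix u v assume "u \<in> ?H" "v \<in> ?H"
    then show "u \<otimes> v \<in> ?H" using shift_mult[of u v f] subgroup.m_closed[OF W] by simp
  next
    fix u assume "u \<in> ?H"
    then show "inv u \<in> ?H" using shift_inv[of u f] subgroup.m_inv_closed[OF W] by simp
  qed (use NG shift_one[of f] subgroup.one_closed[OF W] in auto)
  have VH: "?V \<subseteq> ?H"
  proof
    fix u assume u: "u \<in> ?V"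
    then show "u \<in> ?H" using Vcom[OF u] shift_closed[of u f] by simp
  qed
  have "?g \<subseteq> (A \<times> A) \<times> ?V" by auto
  then have "card ?g \<le> card ((A \<times> A) \<times> ?V)" using finA finN by (intro card_mono) auto
  also have "\<dots> = card A * card A * card ?V" by (simp add: card_cartesian_product)
  finally have "card ?g \<le> card A * card A * card ?V" .
  moreover have "card A * card A * card N < 2 * card ?g"
    using half by (simp only: card_cartesian_product)
  ultimately have "card A * card A * card N < 2 * (card A * card A * card ?V)" by linarith
  also have "\<dots> = card A * card A * (2 * card ?V)" by (simp only: ac_simps)
  finally have "card N < 2 * card ?V" by (simp only: mult_less_cancel1)
  also have "card ?V \<le> card ?H" using VH finN by (intro card_mono) auto
  \<comment> \<open>A subgroup containing more than half of \<open>N\<close> is \<open>N\<close>: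
    what holds for most \<open>u\<close> holds for all.\<close>
  finally have HN: "?H = N" using subgroup_eq_if_large[OF H subgroup_axioms _ finN] by simp
  have com: "y [^] e \<otimes> shift f u = shift f u \<otimes> y [^] e" if "u \<in> N" for u
  proof -
    have "u \<in> ?H" unfolding HN using that .
    then show ?thesis by simp
  qed
  let ?\<Gamma> = "{(v, w). v \<in> A \<and> w \<in> A \<and>
      (\<exists>P k. subgroup P G \<and> card P = p ^ k \<and> c [^] e \<otimes> v \<in> P \<and> w \<otimes> y [^] e \<in> P)}"
  have "?g \<subseteq> ?\<Gamma> \<times> N"
  proof
    fix \<tau> assume \<tau>: "\<tau> \<in> ?g"
    then obtain v w u where vwu: "\<tau> = ((v, w), u)" "v \<in> A" "w \<in> A" "u \<in> N" by auto
    then have gd: "good ((v, w), u) y" using \<tau> by simp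
    have G: "v \<in> carrier G" "w \<in> carrier G" "c \<otimes> v \<in> carrier G" "c \<otimes> w \<in> carrier G" "w \<otimes> y \<in> carrier G"
      using vwu AG c yG by auto
    have v: "(c \<otimes> v) [^] e = c [^] e \<otimes> v" and w: "(c \<otimes> w) [^] e = c [^] e \<otimes> w"
      using pow_D_mult[OF c_D] A_N A_fix vwu by simp_all
    have "c [^] e \<otimes> (w \<otimes> y) [^] e = (c \<otimes> (w \<otimes> y)) [^] e" using partners_e[OF c ng(2)[OF gd]] by simp
    also have "\<dots> = ((c \<otimes> w) \<otimes> y) [^] e" using G c yG by (simp add: m_assoc)
    also have "\<dots> = c [^] e \<otimes> (w \<otimes> y [^] e)"
      using partners_e[OF G(4) ng(3)[OF gd]] w G c yG by (simp add: m_assoc)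
    finally have "c [^] e \<otimes> (w \<otimes> y) [^] e = c [^] e \<otimes> (w \<otimes> y [^] e)" .
    moreover have "c [^] e \<otimes> (w \<otimes> y) [^] e = c [^] e \<otimes> (w \<otimes> y [^] e) \<longleftrightarrow> (w \<otimes> y) [^] e = w \<otimes> y [^] e"
      by (rule Units_l_cancel) (use G c yG in auto)
    ultimately have "(w \<otimes> y) [^] e = w \<otimes> y [^] e" by blast
    then show "\<tau> \<in> ?\<Gamma> \<times> N" using partners_p[OF G(3) ng(1)[OF gd]] v vwu by auto
  qed
  moreover have fin\<Gamma>: "finite ?\<Gamma>" by (rule finite_subset[of _ "A \<times> A"]) (use finA in auto)
  ultimately have "card ?g \<le> card (?\<Gamma> \<times> N)" using finN by (intro card_mono) auto
  then have "card ?g \<le> card ?\<Gamma> * card N" by (simp only: card_cartesian_product)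
  moreover have "card A * card A * card N < 2 * card ?g"
    using half by (simp only: card_cartesian_product)
  ultimately have "card A * card A * card N < 2 * (card ?\<Gamma> * card N)" by linarith
  also have "\<dots> = 2 * card ?\<Gamma> * card N" by (simp only: ac_simps)
  finally have "card A * card A < 2 * card ?\<Gamma>" by (simp only: mult_less_cancel2)
  then show thesis using that[OF y(1) com] by blast
qed

lemma set_mult_N_subgroup: "subgroup P G \<Longrightarrow> subgroup (N <#> P) G"
  using mult_norm_subgroup[OF normal_axioms] .

text \<open>Every \<open>p\<close>-subgroup generated by one of the pairs lies in a conjugate of a fixed Sylow
  subgroup \<open>Q\<close> under an element of \<open>A\<close>; there are at most \<open>|A : A \<inter> Q|\<close> conjugates and each
  contains at most \<open>|A \<inter> Q|\<^sup>2\<close> pairs, so \<open>A \<inter> Q\<close> is more than half of \<open>A\<close>.\<close>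

lemma A_p_group: "\<exists>k. \<forall>v \<in> A. v [^] (p ^ k) = \<one>"
proof -
  obtain y where y: "y \<in> S" "\<And>u. u \<in> N \<Longrightarrow> y [^] e \<otimes> shift f u = shift f u \<otimes> y [^] e"
    and half: "card A * card A < 2 * card {(v, w). v \<in> A \<and> w \<in> A \<and>
      (\<exists>P k. subgroup P G \<and> card P = p ^ k \<and> c [^] e \<otimes> v \<in> P \<and> w \<otimes> y [^] e \<in> P)}"
    using card_half_good by blast
  define x where "x = c [^] e"
  define z where "z = y [^] e"
  have xG: "x \<in> carrier G" and zG: "z \<in> carrier G" using c y SG by (auto simp: x_def z_def)
  define \<Gamma> where "\<Gamma> = {(v, w). v \<in> A \<and> w \<in> A \<and>
      (\<exists>P k. subgroup P G \<and> card P = p ^ k \<and> x \<otimes> v \<in> P \<and> w \<otimes> z \<in> P)}"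
  have half\<Gamma>: "card A * card A < 2 * card \<Gamma>" using half by (simp add: \<Gamma>_def x_def z_def)
  interpret A: subgroup A G by (rule A_subgroup)
  have "\<Gamma> \<noteq> {}" using half\<Gamma> by auto
  then obtain v0 w0 P0 k0 where vw0: "v0 \<in> A" "w0 \<in> A"
    and P0: "subgroup P0 G" "card P0 = p ^ k0" "x \<otimes> v0 \<in> P0" "w0 \<otimes> z \<in> P0"
    by (auto simp: \<Gamma>_def)
  interpret P0: subgroup P0 G by (rule P0(1))
  \<comment> \<open>Sylow's theorem is applied in \<open>N P0\<close>, which contains
    \<open>A\<close>, \<open>x\<close> and \<open>z\<close> and whose elements lie in
    \<open>N\<close> up to a factor from \<open>P0\<close>.\<close>
  define L where "L = N <#> P0"
  have L: "subgroup L G" unfolding L_def by (rule set_mult_N_subgroup[OF P0(1)])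
  interpret L: subgroup L G by (rule L)
  have NL: "N \<subseteq> L"
  proof
    fix n assume "n \<in> N"
    then have "n \<otimes> \<one> \<in> N <#> P0" unfolding set_mult_def using P0.one_closed by blast
    then show "n \<in> L" using NG[OF \<open>n \<in> N\<close>] by (simp add: L_def)
  qed
  have PL: "P0 \<subseteq> L"
  proof
    fix q assume q: "q \<in> P0"
    then have "\<one> \<otimes> q \<in> N <#> P0" unfolding set_mult_def using one_closed by blast
    then show "q \<in> L" using P0.mem_carrier[OF q] by (simp add: L_def)
  qed
  have AL: "v \<in> L" if "v \<in> A" for v using A_N[OF that] NL by auto
  have "x \<otimes> v0 \<otimes> inv v0 \<in> L" "inv w0 \<otimes> (w0 \<otimes> z) \<in> L"
    using PL P0 AL vw0 by auto
  then have xL: "x \<in> L" "z \<in> L" using xG zG vw0 AG by (simp_all add: group_word)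
  let ?L = "G\<lparr>carrier := L\<rparr>"
  interpret LG: group ?L by (rule subgroup.subgroup_is_group[OF L is_group])
  have finL: "finite (carrier ?L)" using fin L.subset finite_subset by simp blast
  have "subgroup P0 ?L" using subgroup_incl[OF P0(1) L PL] .
  then obtain Q b where Q: "subgroup Q ?L" "P0 \<subseteq> Q" "card Q = p ^ b" "\<not> p dvd card (rcosets\<^bsub>?L\<^esub> Q)"
    using LG.sylow_containing[OF finL prime_p _ P0(2)] by blast
  have QG: "subgroup Q G" using incl_subgroup[OF L Q(1)] .
  interpret Q: subgroup Q G by (rule QG)
  have conj: "\<exists>\<alpha> \<in> A. \<alpha> \<otimes> (x \<otimes> v) \<otimes> inv \<alpha> \<in> Q \<and> \<alpha> \<otimes> (w \<otimes> z) \<otimes> inv \<alpha> \<in> Q" if vw: "(v, w) \<in> \<Gamma>" for v w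
  proof -
    obtain P k where P: "subgroup P G" "card P = p ^ k" "x \<otimes> v \<in> P" "w \<otimes> z \<in> P" and vA: "v \<in> A" "w \<in> A"
      using vw by (auto simp: \<Gamma>_def)
    have PL: "subgroup (P \<inter> L) G" using subgroups_Inter_pair[OF P(1) L] .
    then have "card (P \<inter> L) dvd p ^ k" using card_subgroup_dvd[OF _ P(1)] P(2) by fastforce
    then obtain j where j: "card (P \<inter> L) = p ^ j" using prime_p divides_primepow_nat by blast
    have "subgroup (P \<inter> L) ?L" using subgroup_incl[OF PL L] by blast
    then obtain g where g: "g \<in> carrier ?L" "\<And>h. h \<in> P \<inter> L \<Longrightarrow> g \<otimes>\<^bsub>?L\<^esub> h \<otimes>\<^bsub>?L\<^esub> inv\<^bsub>?L\<^esub> g \<in> Q"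
      using LG.sylow_conj[OF finL Q(1) _ j prime_p Q(4)] by blast
    have gL: "g \<in> L" using g by simp
    then have gc: "g \<otimes> h \<otimes> inv g \<in> Q" if "h \<in> P" "h \<in> L" for h
      using g(2)[of h] that m_inv_consistent[OF L gL] by simp
    obtain n q where nq: "n \<in> N" "q \<in> P0" "inv g = n \<otimes> q"
      using L.m_inv_closed[OF gL] by (auto simp: L_def set_mult_def)
    have G: "n \<in> carrier G" "q \<in> carrier G" using nq NG P0.mem_carrier by auto
    have gG: "g \<in> carrier G" using gL by simp
    have "g = inv (n \<otimes> q)" using nq(3) gG by (metis inv_inv)
    define m where "m = inv n"
    have geq: "g = inv q \<otimes> m" using \<open>g = inv (n \<otimes> q)\<close> G by (simp add: inv_mult_group m_def)
    have nN: "m \<in> N" and mG: "m \<in> carrier G" using nq G by (auto simp: m_def)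
    have nc: "m \<otimes> h \<otimes> inv m \<in> Q" if h: "h \<in> P" "h \<in> L" for h
    proof -
      have hG: "h \<in> carrier G" using h by simp
      have "q \<otimes> (g \<otimes> h \<otimes> inv g) \<otimes> inv q \<in> Q" using gc[OF h] nq(2) Q(2) by auto
      moreover have "q \<otimes> (g \<otimes> h \<otimes> inv g) \<otimes> inv q = m \<otimes> h \<otimes> inv m"
        using G mG hG by (simp add: geq group_word)
      ultimately show ?thesis by simp
    qed
    define \<alpha> \<beta> where "\<alpha> = shift e m" and "\<beta> = shift f m"
    have ab: "\<alpha> \<in> A" "\<alpha> \<in> carrier G" "\<beta> \<in> carrier G" "\<alpha> \<otimes> \<beta> = m"
      using nN shift_closed shift_decomp by (auto simp: A_def \<alpha>_def \<beta>_def)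
    have ac: "\<alpha> \<otimes> h \<otimes> inv \<alpha> \<in> Q" if h: "h \<in> P" "h \<in> L" "h \<otimes> \<beta> = \<beta> \<otimes> h" for h
    proof -
      have hG: "h \<in> carrier G" using h by simp
      have "m \<otimes> h \<otimes> inv m = \<alpha> \<otimes> (\<beta> \<otimes> h \<otimes> inv \<beta>) \<otimes> inv \<alpha>"
        using ab(2,3) hG by (simp add: group_word flip: ab(4))
      also have "\<beta> \<otimes> h \<otimes> inv \<beta> = h \<otimes> \<beta> \<otimes> inv \<beta>" using h(3) by simp
      also have "\<dots> = h" using ab hG by (simp add: m_assoc)
      finally show ?thesis using nc[OF h(1,2)] by simp
    qed
    have vb: "u \<otimes> \<beta> = \<beta> \<otimes> u" if "u \<in> A" for u using shift_commute[OF A_N[OF that] nN] A_fix[OF that] by (simp add: \<beta>_def)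
    have "(x \<otimes> v) \<otimes> \<beta> = \<beta> \<otimes> (x \<otimes> v)"
      using commute_mult[of \<beta> x v] D_commute_shift(1)[OF c_D nN] vb[OF vA(1)] xG AG vA ab by (simp add: x_def \<beta>_def)
    moreover have "(w \<otimes> z) \<otimes> \<beta> = \<beta> \<otimes> (w \<otimes> z)"
      using commute_mult[of \<beta> w z] y(2)[OF nN] vb[OF vA(2)] zG AG vA ab by (simp add: z_def \<beta>_def)
    ultimately show ?thesis using ac[OF P(3)] ac[OF P(4)] xL AL vA ab(1) by auto
  qed
  define B where "B = A \<inter> Q"
  have B: "subgroup B G" unfolding B_def by (rule subgroups_Inter_pair[OF A_subgroup QG])
  have finB: "finite B" using finA by (simp add: B_def)
  have Aconj: "\<alpha> \<otimes> v \<otimes> inv \<alpha> \<in> A" if "\<alpha> \<in> A" "v \<in> A" for \<alpha> v using that by simp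
  \<comment> \<open>Instead of counting conjugates of \<open>Q\<close>, triples of a pair and an
    \<open>\<alpha>\<close> are counted twice: a pair admits at least \<open>card B\<close> values
    of \<open>\<alpha>\<close>, namely a coset of \<open>B\<close>, and each \<open>\<alpha>\<close>
    at most \<open>card B * card B\<close> pairs.\<close>
  let ?\<Theta> = "SIGMA (v, w):\<Gamma>. {\<alpha> \<in> A. \<alpha> \<otimes> (x \<otimes> v) \<otimes> inv \<alpha> \<in> Q \<and> \<alpha> \<otimes> (w \<otimes> z) \<otimes> inv \<alpha> \<in> Q}"
  have \<Gamma>A: "\<Gamma> \<subseteq> A \<times> A" by (auto simp: \<Gamma>_def)
  then have fin\<Gamma>: "finite \<Gamma>" using finA finite_subset by blast
  have lower: "card B \<le> card {\<alpha> \<in> A. \<alpha> \<otimes> (x \<otimes> v) \<otimes> inv \<alpha> \<in> Q \<and> \<alpha> \<otimes> (w \<otimes> z) \<otimes> inv \<alpha> \<in> Q}"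
    if vw: "(v, w) \<in> \<Gamma>" for v w
  proof -
    obtain \<alpha> where \<alpha>: "\<alpha> \<in> A" "\<alpha> \<otimes> (x \<otimes> v) \<otimes> inv \<alpha> \<in> Q" "\<alpha> \<otimes> (w \<otimes> z) \<otimes> inv \<alpha> \<in> Q"
      using conj[OF vw] by blast
    have G: "v \<in> carrier G" "w \<in> carrier G" "\<alpha> \<in> carrier G" using vw \<Gamma>A \<alpha> by auto
    have "(\<lambda>\<beta>. \<beta> \<otimes> \<alpha>) ` B \<subseteq> {\<alpha> \<in> A. \<alpha> \<otimes> (x \<otimes> v) \<otimes> inv \<alpha> \<in> Q \<and> \<alpha> \<otimes> (w \<otimes> z) \<otimes> inv \<alpha> \<in> Q}"
    proof (clarify, intro CollectI conjI)
      fix \<beta> assume \<beta>: "\<beta> \<in> B"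
      then have \<beta>': "\<beta> \<in> A" "\<beta> \<in> Q" "\<beta> \<in> carrier G" by (auto simp: B_def)
      show "\<beta> \<otimes> \<alpha> \<in> A" using \<beta>' \<alpha> by simp
      have *: "\<beta> \<otimes> \<alpha> \<otimes> h \<otimes> inv (\<beta> \<otimes> \<alpha>) \<in> Q" if "\<alpha> \<otimes> h \<otimes> inv \<alpha> \<in> Q" "h \<in> carrier G" for h
      proof -
        have "\<beta> \<otimes> (\<alpha> \<otimes> h \<otimes> inv \<alpha>) \<otimes> inv \<beta> \<in> Q" using that \<beta>' by simp
        moreover have "\<beta> \<otimes> (\<alpha> \<otimes> h \<otimes> inv \<alpha>) \<otimes> inv \<beta> = \<beta> \<otimes> \<alpha> \<otimes> h \<otimes> inv (\<beta> \<otimes> \<alpha>)"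
          using that G \<beta>' by (simp add: group_word)
        ultimately show ?thesis by simp
      qed
      show "\<beta> \<otimes> \<alpha> \<otimes> (x \<otimes> v) \<otimes> inv (\<beta> \<otimes> \<alpha>) \<in> Q" "\<beta> \<otimes> \<alpha> \<otimes> (w \<otimes> z) \<otimes> inv (\<beta> \<otimes> \<alpha>) \<in> Q"
        using * \<alpha> G xG zG by simp_all
    qed
    moreover have "inj_on (\<lambda>\<beta>. \<beta> \<otimes> \<alpha>) B" using G(3) subgroup.mem_carrier[OF B] by (auto simp: inj_on_def)
    ultimately show ?thesis using finA by (intro card_inj_on_le) auto
  qed
  \<comment> \<open>\<open>\<theta>\<close> and \<open>\<theta>'\<close> will be inversion and
    identity in either order: quotients \<open>inv v \<otimes> v'\<close> for the first components,
    \<open>v \<otimes> inv v'\<close> for the second.\<close>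
  have bound: "card U \<le> card B" if U: "U \<subseteq> A" and \<alpha>: "\<alpha> \<in> A"
    and diff: "\<And>v v'. v \<in> U \<Longrightarrow> v' \<in> U \<Longrightarrow> \<alpha> \<otimes> (\<theta> v \<otimes> \<theta>' v') \<otimes> inv \<alpha> \<in> Q"
    and AA: "\<And>v v'. v \<in> U \<Longrightarrow> v' \<in> U \<Longrightarrow> \<theta> v \<otimes> \<theta>' v' \<in> A"
    and inj: "\<And>v v' v''. v \<in> U \<Longrightarrow> v' \<in> U \<Longrightarrow> v'' \<in> U \<Longrightarrow> \<theta> v \<otimes> \<theta>' v' = \<theta> v \<otimes> \<theta>' v'' \<Longrightarrow> v' = v''"
    for U \<alpha> and \<theta> \<theta>' :: "'a \<Rightarrow> 'a"
  proof (cases "U = {}")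
    case False
    then obtain v where v: "v \<in> U" by blast
    let ?\<phi> = "\<lambda>v'. \<alpha> \<otimes> (\<theta> v \<otimes> \<theta>' v') \<otimes> inv \<alpha>"
    have "?\<phi> ` U \<subseteq> B" using diff[OF v] AA[OF v] Aconj[OF \<alpha>] by (auto simp: B_def)
    moreover have "inj_on ?\<phi> U"
    proof (rule inj_onI)
      fix s s' assume s: "s \<in> U" "s' \<in> U" "?\<phi> s = ?\<phi> s'"
      have G: "\<theta> v \<otimes> \<theta>' s \<in> carrier G" "\<theta> v \<otimes> \<theta>' s' \<in> carrier G" "\<alpha> \<in> carrier G"
        using AA[OF v] s \<alpha> by auto
      then have "\<theta> v \<otimes> \<theta>' s = \<theta> v \<otimes> \<theta>' s'" using s(3) by simp
      then show "s = s'" using inj[OF v s(1,2)] by blast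
    qed
    ultimately show ?thesis using finB card_inj_on_le by blast
  qed simp
  have upper: "card {(v, w). v \<in> A \<and> w \<in> A \<and> \<alpha> \<otimes> (x \<otimes> v) \<otimes> inv \<alpha> \<in> Q \<and> \<alpha> \<otimes> (w \<otimes> z) \<otimes> inv \<alpha> \<in> Q} \<le> card B * card B"
    if \<alpha>: "\<alpha> \<in> A" for \<alpha>
  proof -
    have \<alpha>G: "\<alpha> \<in> carrier G" using \<alpha> by simp
    let ?X = "{v \<in> A. \<alpha> \<otimes> (x \<otimes> v) \<otimes> inv \<alpha> \<in> Q}" and ?Y = "{w \<in> A. \<alpha> \<otimes> (w \<otimes> z) \<otimes> inv \<alpha> \<in> Q}"
    have "card ?X \<le> card B"
    proof (rule bound[of ?X \<alpha> "\<lambda>v. inv v" "\<lambda>v. v"])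
      fix v v' assume v: "v \<in> ?X" "v' \<in> ?X"
      have "inv (\<alpha> \<otimes> (x \<otimes> v) \<otimes> inv \<alpha>) \<otimes> (\<alpha> \<otimes> (x \<otimes> v') \<otimes> inv \<alpha>) \<in> Q" using v by simp
      moreover have "inv (\<alpha> \<otimes> (x \<otimes> v) \<otimes> inv \<alpha>) \<otimes> (\<alpha> \<otimes> (x \<otimes> v') \<otimes> inv \<alpha>) = \<alpha> \<otimes> (inv v \<otimes> v') \<otimes> inv \<alpha>"
        using v xG \<alpha>G AG by (simp add: group_word)
      ultimately show "\<alpha> \<otimes> (inv v \<otimes> v') \<otimes> inv \<alpha> \<in> Q" by simp
    qed (use \<alpha> AG in auto)
    moreover have "card ?Y \<le> card B"
    proof (rule bound[of ?Y \<alpha> "\<lambda>v. v" "\<lambda>v. inv v"])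
      fix v v' assume v: "v \<in> ?Y" "v' \<in> ?Y"
      have "(\<alpha> \<otimes> (v \<otimes> z) \<otimes> inv \<alpha>) \<otimes> inv (\<alpha> \<otimes> (v' \<otimes> z) \<otimes> inv \<alpha>) \<in> Q" using v by simp
      moreover have "(\<alpha> \<otimes> (v \<otimes> z) \<otimes> inv \<alpha>) \<otimes> inv (\<alpha> \<otimes> (v' \<otimes> z) \<otimes> inv \<alpha>) = \<alpha> \<otimes> (v \<otimes> inv v') \<otimes> inv \<alpha>"
        using v zG \<alpha>G AG by (simp add: group_word)
      ultimately show "\<alpha> \<otimes> (v \<otimes> inv v') \<otimes> inv \<alpha> \<in> Q" by simp
    next
      fix v v' v'' assume "v \<in> ?Y" "v' \<in> ?Y" "v'' \<in> ?Y" "v \<otimes> inv v' = v \<otimes> inv v''"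
      then show "v' = v''" using AG by (metis (no_types, lifting) inv_closed inv_inv l_cancel mem_Collect_eq)
    qed (use \<alpha> in auto)
    moreover have "{(v, w). v \<in> A \<and> w \<in> A \<and> \<alpha> \<otimes> (x \<otimes> v) \<otimes> inv \<alpha> \<in> Q \<and> \<alpha> \<otimes> (w \<otimes> z) \<otimes> inv \<alpha> \<in> Q} = ?X \<times> ?Y"
      by auto
    ultimately show ?thesis by (simp add: card_cartesian_product mult_le_mono)
  qed
  have "card \<Gamma> * card B = (\<Sum>\<gamma>\<in>\<Gamma>. card B)" by simp
  also have "\<dots> \<le> (\<Sum>(v, w)\<in>\<Gamma>. card {\<alpha> \<in> A. \<alpha> \<otimes> (x \<otimes> v) \<otimes> inv \<alpha> \<in> Q \<and> \<alpha> \<otimes> (w \<otimes> z) \<otimes> inv \<alpha> \<in> Q})"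
    by (rule sum_mono) (use lower in auto)
  also have "\<dots> = card ?\<Theta>"
    using fin\<Gamma> finA by (subst card_SigmaI) (auto simp: case_prod_unfold)
  also have "\<dots> \<le> card (SIGMA \<alpha>:A. {(v, w). v \<in> A \<and> w \<in> A \<and> \<alpha> \<otimes> (x \<otimes> v) \<otimes> inv \<alpha> \<in> Q \<and> \<alpha> \<otimes> (w \<otimes> z) \<otimes> inv \<alpha> \<in> Q})"
    (is "_ \<le> card ?\<Theta>'")
  proof (rule card_inj_on_le[of "\<lambda>(\<gamma>, \<alpha>). (\<alpha>, \<gamma>)"])
    show "inj_on (\<lambda>(\<gamma>, \<alpha>). (\<alpha>, \<gamma>)) ?\<Theta>" by (auto simp: inj_on_def)
    show "(\<lambda>(\<gamma>, \<alpha>). (\<alpha>, \<gamma>)) ` ?\<Theta> \<subseteq> ?\<Theta>'" using \<Gamma>A by auto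
    show "finite ?\<Theta>'" by (rule finite_subset[of _ "A \<times> (A \<times> A)"]) (use finA in auto)
  qed
  also have "\<dots> = (\<Sum>\<alpha>\<in>A. card {(v, w). v \<in> A \<and> w \<in> A \<and> \<alpha> \<otimes> (x \<otimes> v) \<otimes> inv \<alpha> \<in> Q \<and> \<alpha> \<otimes> (w \<otimes> z) \<otimes> inv \<alpha> \<in> Q})"
  proof (rule card_SigmaI[OF finA], rule ballI)
    fix \<alpha>
    show "finite {(v, w). v \<in> A \<and> w \<in> A \<and> \<alpha> \<otimes> (x \<otimes> v) \<otimes> inv \<alpha> \<in> Q \<and> \<alpha> \<otimes> (w \<otimes> z) \<otimes> inv \<alpha> \<in> Q}"
      by (rule finite_subset[of _ "A \<times> A"]) (use finA in auto)
  qed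
  also have "\<dots> \<le> (\<Sum>\<alpha>\<in>A. card B * card B)" by (rule sum_mono) (rule upper)
  also have "\<dots> = card A * card B * card B" by simp
  finally have "card \<Gamma> * card B \<le> card A * card B * card B" .
  moreover have "card B \<noteq> 0" using finB subgroup.one_closed[OF B] by auto
  ultimately have "card \<Gamma> \<le> card A * card B" by simp
  then have "card A * card A < card A * (2 * card B)" using half\<Gamma> by linarith
  then have "card A < 2 * card B" by simp
  then have "B = A" using subgroup_eq_if_large[OF B A_subgroup _ finA] by (simp add: B_def)
  then have "v \<in> Q" if "v \<in> A" for v using that by (auto simp: B_def)
  then show ?thesis using pow_card_subgroup[OF QG] Q(3) by metis
qed

text \<open>The value \<open>shift e v\<close> lies in the \<open>p\<close>-group \<open>A\<close>,
  and its order divides \<open>m\<close>.\<close>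

lemma
  assumes v: "v \<in> N" "v [^] (m::nat) = \<one>" "coprime m p"
  shows shift_e_trivial: "shift e v = \<one>" and shift_f_trivial: "shift f v = v"
proof -
  obtain k where "\<And>v. v \<in> A \<Longrightarrow> v [^] (p ^ k) = \<one>" using A_p_group by blast
  then have k: "shift e v [^] (p ^ k) = \<one>" using v(1) by (simp add: A_def)
  have "shift e v [^] m = shift e (v [^] m)" using shift_pow[OF v(1)] by simp
  then have "shift e v [^] m = \<one>" using v(2) shift_one[of e] by simp
  then show e: "shift e v = \<one>" using pow_coprime_one[OF shift_closed[OF v(1)] _ k] v(3) by simp
  show "shift f v = v" using shift_decomp[OF v(1)] e shift_closed[OF v(1)] by simp
qed

end

section \<open>Comparing the splittings for all primes\<close>

context dense_pairs begin

lemma dense_split: "primary_split p a t e f \<Longrightarrow> order G = p ^ a * t \<Longrightarrow> dense_split G N c S p a t e f"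
  using dense_pairs_axioms pow_order_eq_1
  by (auto simp: dense_split_def group_split_def group_split_axioms_def prime_split_def is_group)

text \<open>The crux is that \<open>shift e\<close> fixes the \<open>p\<close>-part \<open>w\<close>
  of an element of \<open>N\<close>, that is, that \<open>s = shift f w\<close> vanishes. For every
  prime \<open>q\<close> the \<open>q\<close>-version of \<open>shift e\<close> kills
  \<open>s\<close>: if \<open>q \<noteq> p\<close> because \<open>s\<close> is a
  \<open>p\<close>-element, if \<open>q = p\<close> by construction. So \<open>s\<close> commutes
  with all primary parts of \<open>c\<close>, hence with \<open>c\<close>, and this forces
  \<open>s [^] e = \<one>\<close>.\<close>

lemma N_parts_commute:
  assumes ps: "primary_split p a t e f" "order G = p ^ a * t" and v: "v \<in> N"
  shows "x \<in> N #> c \<Longrightarrow> x [^] e \<otimes> v [^] f = v [^] f \<otimes> x [^] e"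
    and "x \<in> N #> c \<Longrightarrow> x [^] f \<otimes> v [^] e = v [^] e \<otimes> x [^] f"
    and "u \<in> N \<Longrightarrow> u [^] e \<otimes> v [^] f = v [^] f \<otimes> u [^] e"
proof -
  interpret dense_split G N c S p a t e f by (rule dense_split[OF ps])
  have vG: "v \<in> carrier G" using v NG by simp
  have vN: "v [^] f \<in> N" using subgroup_pow_closed[OF subgroup_axioms v] .
  have tp: "coprime t p" using coprime_p_t by (simp add: coprime_commute)
  have v': "shift f (v [^] f) = v [^] f" using shift_f_trivial[OF vN part_pow_t[OF vG] tp] .
  show "x [^] e \<otimes> v [^] f = v [^] f \<otimes> x [^] e" if "x \<in> N #> c"
    using D_commute_shift(1)[OF that vN] v' by simp
  have e_part: "u [^] e \<in> N" "shift e (u [^] e) = u [^] e" if u: "u \<in> N" for u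
  proof -
    have uG: "u \<in> carrier G" using u NG by simp
    define w where "w = u [^] e"
    have wN: "w \<in> N" using subgroup_pow_closed[OF subgroup_axioms u] by (simp add: w_def)
    have wpa: "w [^] (p ^ a) = \<one>" using part_pow_pa[OF uG] by (simp add: w_def)
    define s where "s = shift f w"
    have sN: "s \<in> N" and sG: "s \<in> carrier G" using shift_in_N[OF wN] NG by (auto simp: s_def)
    have spa: "s [^] (p ^ a) = \<one>" using shift_pow[OF wN, of f "p ^ a"] wpa shift_one[of f] by (simp add: s_def)
    have es: "shift e s = \<one>" using shift_ef[OF wN] by (simp add: s_def)
    let ?C = "{g \<in> carrier G. \<forall>h \<in> {s}. g \<otimes> h = h \<otimes> g}"
    have "c \<in> ?C"
    proof (rule mem_subgroup_if_parts[OF _ c pow_order_eq_1[OF c]])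
      show "subgroup ?C G" using subgroup_centralizer[of "{s}"] sG by simp
      show "0 < order G" using fin order_gt_0_iff_finite by simp
      fix q b t' e' f' assume q: "primary_split q b t' e' f'" "order G = q ^ b * t'"
      interpret q: dense_split G N c S q b t' e' f' by (rule dense_split[OF q])
      have "q.shift e' s = \<one>"
      proof (cases "q = p")
        case False
        then have "coprime (p ^ a) q" using prime_p q.prime_p primes_coprime by (metis coprime_power_left_iff)
        then show ?thesis using q.shift_e_trivial[OF sN spa] by simp
      next
        case True
        \<comment> \<open>For the same prime the two splittings have the same \<open>a\<close> and
          \<open>t\<close> and congruent exponents, so their \<open>shift\<close> functions agree on
          \<open>s\<close>.\<close>
        have "q ^ b = p ^ a"
        proof -
          have "p ^ b dvd p ^ a * t" "p ^ a dvd p ^ b * t'" using ps(2) q(2) True by (metis dvd_triv_left)+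
          moreover have "coprime (p ^ b) t" "coprime (p ^ a) t'" using coprime_p_t q.coprime_p_t True by auto
          ultimately have "p ^ b dvd p ^ a" "p ^ a dvd p ^ b" by (simp_all add: coprime_dvd_mult_left_iff)
          then show ?thesis using True dvd_antisym by blast
        qed
        then have t': "t' = t" "b = a" using ps(2) q(2) True q.prime_p prime_gt_1_nat[OF prime_p] by auto
        have "[e' = e] (mod p ^ a * t)"
          by (rule cong_split) (use congs q.congs t' True in \<open>meson cong_sym cong_trans\<close>)+
        then have "z [^] e' = z [^] e" if "z \<in> carrier G" for z using pow_cong[OF that] by blast
        then have "q.shift e' s = shift e s" using c sG by (simp add: q.shift_def shift_def)
        then show ?thesis using es by simp
      qed
      then have "q.shift f' s = s" using q.shift_decomp[OF sN] q.shift_closed[OF sN] by simp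
      then have "c [^] e' \<otimes> s = s \<otimes> c [^] e'" using q.D_commute_shift(1)[OF c_D sN] by simp
      then show "c [^] e' \<in> ?C" using c by simp
    qed
    then have com: "c \<otimes> s = s \<otimes> c" by simp
    \<comment> \<open>Since \<open>c\<close> and \<open>s\<close> commute, the \<open>p\<close>-part
      of \<open>c \<otimes> s\<close> can be computed directly; comparison with the formula through
      \<open>shift\<close> gives \<open>s [^] e = \<one>\<close>, while \<open>s\<close>, being a
      \<open>p\<close>-element, equals \<open>s [^] e\<close>.\<close>
    have "c [^] e \<otimes> s [^] e = c [^] e \<otimes> shift e s"
      using pow_mult_distrib[OF com c sG, of e] pow_D_mult[OF c_D sN, of e] by simp
    then have "s [^] e = \<one>" using es c sG by simp
    moreover have "s [^] e = s" using part_e_id'[OF sG spa] .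
    ultimately have "s = \<one>" by simp
    then have "shift e w = w" using shift_decomp[OF wN] shift_closed[OF wN] by (simp add: s_def)
    then show "u [^] e \<in> N" "shift e (u [^] e) = u [^] e" using wN by (simp_all add: w_def)
  qed
  show "x [^] f \<otimes> v [^] e = v [^] e \<otimes> x [^] f" if "x \<in> N #> c"
    using D_commute_shift(2)[OF that e_part(1)[OF v]] e_part(2)[OF v] by simp
  show "u [^] e \<otimes> v [^] f = v [^] f \<otimes> u [^] e" if u: "u \<in> N"
    using shift_commute[OF e_part(1)[OF u] vN] e_part(2)[OF u] v' by simp
qed

end

section \<open>Groups with a hypercenter of finite index\<close>

context group begin

definition lprod :: "'a list \<Rightarrow> 'a" where
  "lprod xs = foldr (\<otimes>) xs \<one>"

lemma lprod_simps [simp]: "lprod [] = \<one>" "lprod (x # xs) = x \<otimes> lprod xs"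
  by (simp_all add: lprod_def)

lemma lprod_closed [simp]: "set xs \<subseteq> carrier G \<Longrightarrow> lprod xs \<in> carrier G"
  by (induct xs) auto

lemma lprod_append: "set xs \<subseteq> carrier G \<Longrightarrow> set ys \<subseteq> carrier G \<Longrightarrow> lprod (xs @ ys) = lprod xs \<otimes> lprod ys"
  by (induct xs) (auto simp: m_assoc)

lemma lprod_replicate: "x \<in> carrier G \<Longrightarrow> lprod (replicate n x) = x [^] n"
  by (induct n) (simp_all add: group_commutes_pow)

text \<open>Moving \<open>c\<close> to the left past a letter conjugates that letter by
  \<open>c\<close>, which keeps it in \<open>S\<close> and does not change the number of
  letters.\<close>

lemma lprod_collect:
  assumes S: "S \<subseteq> carrier G" and conj: "\<And>x. x \<in> S \<Longrightarrow> inv c \<otimes> x \<otimes> c \<in> S" and c: "c \<in> S"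
    and xs: "set xs \<subseteq> S"
  shows "\<exists>ys. set ys \<subseteq> S \<and> length ys + count_list xs c = length xs \<and>
    lprod xs = c [^] count_list xs c \<otimes> lprod ys"
  using xs
proof (induct xs)
  case (Cons x xs)
  let ?k = "count_list xs c"
  obtain ys where ys: "set ys \<subseteq> S" "length ys + ?k = length xs" "lprod xs = c [^] ?k \<otimes> lprod ys"
    using Cons by auto
  have G: "c \<in> carrier G" "x \<in> carrier G" "lprod ys \<in> carrier G" using c Cons S ys by auto
  show ?case
  proof (cases "x = c")
    case True
    then have "lprod (x # xs) = c [^] Suc ?k \<otimes> lprod ys"
      using G ys(3) by (simp add: group_commutes_pow flip: m_assoc)
    then show ?thesis using True ys by auto
  next
    case False
    have powconj: "inv (c [^] j) \<otimes> x \<otimes> c [^] j \<in> S" for j :: nat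
    proof (induct j)
      case 0 then show ?case using Cons(2) G by simp
    next
      case (Suc j)
      have "inv (c [^] Suc j) \<otimes> x \<otimes> c [^] Suc j = inv c \<otimes> (inv (c [^] j) \<otimes> x \<otimes> c [^] j) \<otimes> c"
        using G by (simp add: group_word)
      then show ?case using conj[OF Suc] by simp
    qed
    let ?x = "inv (c [^] ?k) \<otimes> x \<otimes> c [^] ?k"
    have "lprod (x # xs) = c [^] ?k \<otimes> lprod (?x # ys)"
      using G ys(3) by (simp add: group_word)
    then show ?thesis using False ys powconj[of ?k]
      by (intro exI[of _ "?x # ys"]) simp
  qed
qed simp

text \<open>Dietzmann's lemma: a long product contains one generator \<open>c\<close> often, the occurrences of
  \<open>c\<close> can be moved to the front, and the resulting power of \<open>c\<close> can be shortened.\<close>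

lemma lprod_shorten:
  assumes S: "S \<subseteq> carrier G" "finite S" and conj: "\<And>c x. c \<in> S \<Longrightarrow> x \<in> S \<Longrightarrow> inv c \<otimes> x \<otimes> c \<in> S"
    and pow: "\<And>c. c \<in> S \<Longrightarrow> \<exists>k zs. k \<le> E \<and> set zs \<subseteq> S \<and> length zs < k \<and> c [^] k = lprod zs"
    and xs: "set xs \<subseteq> S"
  shows "\<exists>ys. set ys \<subseteq> S \<and> length ys \<le> card S * E \<and> lprod ys = lprod xs"
  using xs
proof (induct "length xs" arbitrary: xs rule: less_induct)
  case less
  show ?case
  proof (cases "length xs \<le> card S * E")
    case False
    have "\<exists>c \<in> S. E < count_list xs c"
    proof (rule ccontr)
      assume "\<not> ?thesis"
      then have "(\<Sum>c\<in>S. count_list xs c) \<le> (\<Sum>c\<in>S. E)" by (intro sum_mono) force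
      then show False using False sum_count_set[OF less.prems S(2)] by simp
    qed
    then obtain c where c: "c \<in> S" "E < count_list xs c" by blast
    let ?m = "count_list xs c"
    obtain ys where ys: "set ys \<subseteq> S" "length ys + ?m = length xs" "lprod xs = c [^] ?m \<otimes> lprod ys"
      using lprod_collect[OF S(1) conj[OF c(1)] c(1) less.prems] by blast
    obtain k zs where k: "k \<le> E" "set zs \<subseteq> S" "length zs < k" "c [^] k = lprod zs"
      using pow[OF c(1)] by blast
    have G: "c \<in> carrier G" "set zs \<subseteq> carrier G" "set ys \<subseteq> carrier G" using c k ys S by auto
    let ?xs = "zs @ replicate (?m - k) c @ ys"
    have "c [^] k \<otimes> c [^] (?m - k) = c [^] ?m" using G c(2) k(1) by (simp add: nat_pow_mult)
    then have "lprod xs = c [^] k \<otimes> (c [^] (?m - k) \<otimes> lprod ys)" using ys(3) G by (simp flip: m_assoc)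
    also have "\<dots> = lprod ?xs"
    proof -
      have "set (replicate (?m - k) c) \<subseteq> carrier G" using G(1) by auto
      then show ?thesis using G k(4) by (simp add: lprod_append lprod_replicate)
    qed
    finally have eq: "lprod xs = lprod ?xs" .
    have "length ?xs < length xs" using k(1,3) c(2) ys(2) by simp
    moreover have "set ?xs \<subseteq> S" using k(2) ys(1) c(1) by auto
    ultimately show ?thesis using less.hyps eq by metis
  qed (use less.prems in blast)
qed

text \<open>No inverses are allowed; in a finite group such products already make up the subgroup
  generated by \<open>S\<close>.\<close>

definition words :: "'a set \<Rightarrow> 'a set" where
  "words S = {lprod xs | xs. set xs \<subseteq> S}"

lemma words_incl: "S \<subseteq> carrier G \<Longrightarrow> x \<in> S \<Longrightarrow> x \<in> words S"
  unfolding words_def by (intro CollectI exI[of _ "[x]"]) auto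

lemma words_mono: "S \<subseteq> S' \<Longrightarrow> words S \<subseteq> words S'"
  unfolding words_def by blast

lemma words_subgroup:
  assumes fin: "finite (carrier G)" and S: "S \<subseteq> carrier G"
  shows "subgroup (words S) G"
proof -
  have closed: "words S \<subseteq> carrier G" using S unfolding words_def by (auto intro!: lprod_closed)
  have one: "\<one> \<in> words S" unfolding words_def by (intro CollectI exI[of _ "[]"]) auto
  have mult: "x \<otimes> y \<in> words S" if xy: "x \<in> words S" "y \<in> words S" for x y
  proof -
    obtain xs ys where l: "x = lprod xs" "set xs \<subseteq> S" "y = lprod ys" "set ys \<subseteq> S"
      using xy unfolding words_def by blast
    then have "x \<otimes> y = lprod (xs @ ys)" using S by (simp add: lprod_append)
    then show ?thesis using l unfolding words_def by (intro CollectI exI[of _ "xs @ ys"]) auto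
  qed
  have pow: "x [^] (n::nat) \<in> words S" if "x \<in> words S" for x n
    by (induct n) (use that one mult in auto)
  have "inv x \<in> words S" if x: "x \<in> words S" for x
  proof -
    have xG: "x \<in> carrier G" using x closed by blast
    have "0 < order G" using fin order_gt_0_iff_finite by simp
    then have "x [^] (order G - 1) \<otimes> x = \<one>" using pow_order_eq_1[OF xG] by (metis Suc_diff_1 nat_pow_Suc)
    then have "inv x = x [^] (order G - 1)" using xG by (simp add: inv_equality)
    then show ?thesis using pow[OF x] by simp
  qed
  then show ?thesis using closed one mult by (intro subgroupI) auto
qed

lemma words_normal:
  assumes fin: "finite (carrier G)" and S: "S \<subseteq> carrier G"
    and conj: "\<And>g x. g \<in> carrier G \<Longrightarrow> x \<in> S \<Longrightarrow> g \<otimes> x \<otimes> inv g \<in> S"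
  shows "words S \<lhd> G"
proof -
  have "g \<otimes> lprod xs \<otimes> inv g \<in> words S" if g: "g \<in> carrier G" and "set xs \<subseteq> S" for g xs
    using that(2)
  proof (induct xs)
    case Nil
    then show ?case using g subgroup.one_closed[OF words_subgroup[OF fin S]] by simp
  next
    case (Cons x xs)
    have G: "x \<in> carrier G" "lprod xs \<in> carrier G" using Cons(2) S by auto
    have "g \<otimes> lprod (x # xs) \<otimes> inv g = (g \<otimes> x \<otimes> inv g) \<otimes> (g \<otimes> lprod xs \<otimes> inv g)"
      using g G by (simp add: group_word)
    moreover have "g \<otimes> x \<otimes> inv g \<in> words S" using conj[OF g] Cons(2) words_incl[OF S] by simp
    ultimately show ?case using Cons subgroup.m_closed[OF words_subgroup[OF fin S]] by simp
  qed
  then show ?thesis using words_subgroup[OF fin S] unfolding normal_inv_iff words_def by blast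
qed

lemma words_bounded:
  assumes S: "S \<subseteq> carrier G" "finite S" "card S \<le> s"
    and conj: "\<And>c x. c \<in> S \<Longrightarrow> x \<in> S \<Longrightarrow> inv c \<otimes> x \<otimes> c \<in> S"
    and pow: "\<And>c. c \<in> S \<Longrightarrow> \<exists>k zs. k \<le> E \<and> set zs \<subseteq> S \<and> length zs < k \<and> c [^] k = lprod zs"
  shows "x \<in> words S \<Longrightarrow> \<exists>ys. set ys \<subseteq> S \<and> length ys \<le> s * E \<and> x = lprod ys"
    and "card (words S) \<le> (\<Sum>i\<le>s * E. s ^ i)"
proof -
  show 1: "\<exists>ys. set ys \<subseteq> S \<and> length ys \<le> s * E \<and> x = lprod ys" if x: "x \<in> words S" for x
  proof -
    obtain xs where xs: "x = lprod xs" "set xs \<subseteq> S" using x unfolding words_def by blast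
    obtain ys where ys: "set ys \<subseteq> S" "length ys \<le> card S * E" "lprod ys = lprod xs"
      using lprod_shorten[OF S(1,2) conj pow xs(2)] by blast
    moreover have "card S * E \<le> s * E" using S(3) by simp
    ultimately show ?thesis using xs(1) by (metis order_trans)
  qed
  let ?L = "{ys. set ys \<subseteq> S \<and> length ys \<le> s * E}"
  have "words S \<subseteq> lprod ` ?L" using 1 by blast
  then have "card (words S) \<le> card ?L"
    using finite_lists_length_le[OF S(2), of "s * E"] by (meson card_image_le card_mono finite_imageI order_trans)
  also have "\<dots> = (\<Sum>i\<le>s * E. card S ^ i)" by (rule card_lists_length_le[OF S(2)])
  also have "\<dots> \<le> (\<Sum>i\<le>s * E. s ^ i)" using S(3) by (intro sum_mono power_mono) auto
  finally show "card (words S) \<le> (\<Sum>i\<le>s * E. s ^ i)" .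
qed

section \<open>Commutators of elements of coprime order\<close>

lemma commutator_pow_Suc_left:
  "x \<in> carrier G \<Longrightarrow> y \<in> carrier G \<Longrightarrow>
    commutator G (x [^] Suc k) y = x \<otimes> commutator G (x [^] k) y \<otimes> inv x \<otimes> commutator G x y"
  by (simp add: commutator_def group_commutes_pow[of x x] group_word)

lemma commutator_pow_Suc_right:
  "x \<in> carrier G \<Longrightarrow> y \<in> carrier G \<Longrightarrow>
    commutator G x (y [^] Suc k) = commutator G x y \<otimes> (y \<otimes> commutator G x (y [^] k) \<otimes> inv y)"
  by (simp add: commutator_def group_commutes_pow[of y y] group_word)

lemma conj_commutator:
  "g \<in> carrier G \<Longrightarrow> x \<in> carrier G \<Longrightarrow> y \<in> carrier G \<Longrightarrow>
    g \<otimes> commutator G x y \<otimes> inv g = commutator G (g \<otimes> x \<otimes> inv g) (g \<otimes> y \<otimes> inv g)"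
  by (simp add: commutator_def group_word)

definition coprime_pair :: "nat \<Rightarrow> 'a \<Rightarrow> 'a \<Rightarrow> bool" where
  "coprime_pair p x y \<longleftrightarrow> Factorial_Ring.prime p \<and> x \<in> carrier G \<and> y \<in> carrier G \<and>
     (\<exists>j. x [^] (p ^ j) = \<one>) \<and> (\<exists>s. coprime s p \<and> y [^] (s::nat) = \<one>)"

definition coprime_commutators :: "'a set" where
  "coprime_commutators = {commutator G x y | p x y. coprime_pair p x y}"

lemma coprime_pair_conj:
  "coprime_pair p x y \<Longrightarrow> g \<in> carrier G \<Longrightarrow> coprime_pair p (g \<otimes> x \<otimes> inv g) (g \<otimes> y \<otimes> inv g)"
  unfolding coprime_pair_def by (metis conj_pow inv_closed m_closed r_inv r_one)

lemma coprime_commutators_closed: "coprime_commutators \<subseteq> carrier G"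
  unfolding coprime_commutators_def coprime_pair_def by auto

lemma coprime_commutators_conj:
  "c \<in> coprime_commutators \<Longrightarrow> g \<in> carrier G \<Longrightarrow> g \<otimes> c \<otimes> inv g \<in> coprime_commutators"
  unfolding coprime_commutators_def using conj_commutator coprime_pair_conj
  by (smt (verit) coprime_pair_def mem_Collect_eq)

lemma coprime_pair_pow:
  assumes "coprime_pair p x y"
  shows "coprime_pair p (x [^] (i::nat)) (y [^] (k::nat))"
proof -
  obtain j s where js: "x [^] (p ^ j) = \<one>" "coprime s p" "y [^] s = \<one>" and G: "x \<in> carrier G" "y \<in> carrier G"
    using assms unfolding coprime_pair_def by blast
  have "(x [^] i) [^] (p ^ j) = \<one>" "(y [^] k) [^] s = \<one>"
    using js G by (metis mult.commute nat_pow_one nat_pow_pow)+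
  then show ?thesis using assms G js unfolding coprime_pair_def by auto
qed

lemma coprime_pair_hypercentral:
  assumes xy: "coprime_pair p x y" and z: "z \<in> central_above G {\<one>} n"
  shows "coprime s p \<Longrightarrow> z [^] (s::nat) = \<one> \<Longrightarrow> z \<otimes> x = x \<otimes> z"
    and "z [^] (p ^ l) = \<one> \<Longrightarrow> z \<otimes> y = y \<otimes> z"
  using xy hypercentral_coprime_commute[OF z] unfolding coprime_pair_def
  by (auto simp: coprime_commute)

text \<open>The commutator is a product of two \<open>p'\<close>-elements, \<open>x y inv x\<close>
  and \<open>inv y\<close>, and also of two \<open>p\<close>-elements, \<open>x\<close> and the
  inverse of \<open>y x inv y\<close>. The \<open>p\<close>-part of \<open>z\<close> commutes with
  the former two, its \<open>p'\<close>-part with the latter two.\<close>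

lemma hypercentral_centralizes_coprime_commutators:
  assumes fin: "finite (carrier G)" and c: "c \<in> coprime_commutators" and z: "z \<in> central_above G {\<one>} n"
  shows "z \<otimes> c = c \<otimes> z"
proof -
  obtain p x y where xy: "coprime_pair p x y" "c = commutator G x y"
    using c unfolding coprime_commutators_def by blast
  then have G: "x \<in> carrier G" "y \<in> carrier G" and p: "Factorial_Ring.prime p" unfolding coprime_pair_def by auto
  have "0 < order G" using fin order_gt_0_iff_finite by simp
  then obtain a t e f where s: "primary_split p a t e f" "order G = p ^ a * t"
    using primary_split_exists[OF p] by blast
  interpret group_split G p a t e f using s pow_order_eq_1 by unfold_locales auto
  have Z: "subgroup (central_above G {\<one>} n) G"
    using normal_imp_subgroup normal_central_above one_is_normal by blast
  have zG: "z \<in> carrier G" using z Z subgroup.mem_carrier by metis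
  have zZ: "z [^] e \<in> central_above G {\<one>} n" "z [^] f \<in> central_above G {\<one>} n"
    using subgroup_pow_closed[OF Z z] by blast+
  have tp: "coprime t p" using coprime_p_t by (simp add: coprime_commute)
  note xc = coprime_pair_conj[OF xy(1) G(1)] and yc = coprime_pair_conj[OF xy(1) G(2)]
  have e: "z [^] e \<otimes> y = y \<otimes> z [^] e" "z [^] e \<otimes> (x \<otimes> y \<otimes> inv x) = (x \<otimes> y \<otimes> inv x) \<otimes> z [^] e"
    using coprime_pair_hypercentral(2)[OF xy(1) zZ(1) part_pow_pa[OF zG]]
      coprime_pair_hypercentral(2)[OF xc zZ(1) part_pow_pa[OF zG]] by auto
  have f: "z [^] f \<otimes> x = x \<otimes> z [^] f" "z [^] f \<otimes> (y \<otimes> x \<otimes> inv y) = (y \<otimes> x \<otimes> inv y) \<otimes> z [^] f"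
    using coprime_pair_hypercentral(1)[OF xy(1) zZ(2) tp part_pow_t[OF zG]]
      coprime_pair_hypercentral(1)[OF yc zZ(2) tp part_pow_t[OF zG]] by auto
  have "z [^] e \<otimes> ((x \<otimes> y \<otimes> inv x) \<otimes> inv y) = ((x \<otimes> y \<otimes> inv x) \<otimes> inv y) \<otimes> z [^] e"
    by (rule commute_mult[OF _ _ _ e(2) commute_inv[OF _ _ e(1)]]) (use G zG in auto)
  then have ec: "c \<otimes> z [^] e = z [^] e \<otimes> c" using xy(2) by (simp add: commutator_def)
  have "z [^] f \<otimes> (x \<otimes> inv (y \<otimes> x \<otimes> inv y)) = (x \<otimes> inv (y \<otimes> x \<otimes> inv y)) \<otimes> z [^] f"
    by (rule commute_mult[OF _ _ _ f(1) commute_inv[OF _ _ f(2)]]) (use G zG in auto)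
  moreover have "x \<otimes> inv (y \<otimes> x \<otimes> inv y) = c" using xy(2) G by (simp add: commutator_def group_word)
  ultimately have fc: "c \<otimes> z [^] f = z [^] f \<otimes> c" by simp
  have "c \<otimes> (z [^] e \<otimes> z [^] f) = (z [^] e \<otimes> z [^] f) \<otimes> c"
    by (rule commute_mult[OF _ _ _ ec fc]) (use xy(2) G zG in auto)
  then show ?thesis using part_mult[OF zG] by simp
qed

text \<open>Both primary parts of \<open>c [^] i\<close> are shown to be trivial. For the
  \<open>p\<close>-part \<open>y\<close> is replaced by its powers, for the \<open>p'\<close>-part
  \<open>x\<close> is, until the power is \<open>\<one>\<close> and the commutator
  disappears.\<close>

lemma pow_coprime_commutator_trivial:
  assumes fin: "finite (carrier G)"
    and com: "\<And>c d. c \<in> coprime_commutators \<Longrightarrow> d \<in> coprime_commutators \<Longrightarrow> c \<otimes> d = d \<otimes> c"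
    and c: "c \<in> coprime_commutators" and z: "c [^] (i::nat) \<in> central_above G {\<one>} n"
  shows "c [^] i = \<one>"
proof -
  obtain p x y where xy: "coprime_pair p x y" "c = commutator G x y"
    using c unfolding coprime_commutators_def by blast
  then have G: "x \<in> carrier G" "y \<in> carrier G" and p: "Factorial_Ring.prime p" unfolding coprime_pair_def by auto
  have "0 < order G" using fin order_gt_0_iff_finite by simp
  then obtain a t e f where s: "primary_split p a t e f" "order G = p ^ a * t"
    using primary_split_exists[OF p] by blast
  interpret group_split G p a t e f using s pow_order_eq_1 by unfold_locales auto
  have Z: "subgroup (central_above G {\<one>} n) G"
    using normal_imp_subgroup normal_central_above one_is_normal by blast
  let ?z = "c [^] i"
  have cG: "c \<in> carrier G" and zG: "?z \<in> carrier G" using c coprime_commutators_closed by auto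
  have zZ: "?z [^] e \<in> central_above G {\<one>} n" "?z [^] f \<in> central_above G {\<one>} n"
    using subgroup_pow_closed[OF Z z] by blast+
  have tp: "coprime t p" using coprime_p_t by (simp add: coprime_commute)
  obtain j m where jm: "x [^] (p ^ j) = \<one>" "coprime m p" "y [^] m = \<one>"
    using xy(1) unfolding coprime_pair_def by blast
  have in_C: "commutator G (x [^] (k::nat)) (y [^] (l::nat)) \<in> coprime_commutators" for k l
    using coprime_pair_pow[OF xy(1)] unfolding coprime_commutators_def by blast
  have "?z [^] e = \<one>"
  proof (rule pow_coprime_one)
    have yz: "?z [^] e \<otimes> y = y \<otimes> ?z [^] e"
      using coprime_pair_hypercentral(2)[OF xy(1) zZ(1) part_pow_pa[OF zG]] .
    \<comment> \<open>The hypercentral \<open>p\<close>-part of \<open>?z\<close> commutes with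
      \<open>y\<close>, and the commutators involved commute with each other, so this power is
      multiplicative in \<open>k\<close>. At \<open>k = m\<close> a \<open>p\<close>-element gets an
      exponent prime to \<open>p\<close>.\<close>
    have "commutator G x (y [^] k) [^] (i * e) = (?z [^] e) [^] k" for k :: nat
    proof (induct k)
      case 0 then show ?case using G by (simp add: commutator_def)
    next
      case (Suc k)
      let ?d = "commutator G x (y [^] k)"
      have dC: "?d \<in> coprime_commutators" using in_C[of 1 k] G by simp
      then have ydC: "y \<otimes> ?d \<otimes> inv y \<in> coprime_commutators" using coprime_commutators_conj G by simp
      have "commutator G x (y [^] Suc k) [^] (i * e) = (c \<otimes> (y \<otimes> ?d \<otimes> inv y)) [^] (i * e)"
        using commutator_pow_Suc_right[OF G] xy(2) by simp
      also have "\<dots> = c [^] (i * e) \<otimes> (y \<otimes> ?d \<otimes> inv y) [^] (i * e)"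
        by (rule pow_mult_distrib[OF com[OF c ydC]]) (use cG G in auto)
      also have "(y \<otimes> ?d \<otimes> inv y) [^] (i * e) = y \<otimes> (?z [^] e) [^] k \<otimes> inv y"
        using conj_pow[of y ?d "i * e"] Suc G by simp
      also have "y \<otimes> (?z [^] e) [^] k = (?z [^] e) [^] k \<otimes> y"
        using group_commutes_pow[OF yz] zG G by simp
      also have "(?z [^] e) [^] k \<otimes> y \<otimes> inv y = (?z [^] e) [^] k" using zG G by (simp add: m_assoc)
      also have "c [^] (i * e) = ?z [^] e" using cG by (simp add: nat_pow_pow)
      also have "?z [^] e \<otimes> (?z [^] e) [^] k = (?z [^] e) [^] Suc k"
        using group_commutes_pow[of "?z [^] e" "?z [^] e" k] zG by simp
      finally show ?case .
    qed
    from this[of m] show "(?z [^] e) [^] m = \<one>" using jm(3) G by (simp add: commutator_def)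
    show "(?z [^] e) [^] (p ^ a) = \<one>" using part_pow_pa[OF zG] .
  qed (use zG jm(2) in auto)
  moreover have "?z [^] f = \<one>"
  proof (rule pow_coprime_one)
    have xz: "?z [^] f \<otimes> x = x \<otimes> ?z [^] f"
      using coprime_pair_hypercentral(1)[OF xy(1) zZ(2) tp part_pow_t[OF zG]] .
    have "commutator G (x [^] k) y [^] (i * f) = (?z [^] f) [^] k" for k :: nat
    proof (induct k)
      case 0 then show ?case using G by (simp add: commutator_def)
    next
      case (Suc k)
      let ?d = "commutator G (x [^] k) y"
      have dC: "?d \<in> coprime_commutators" using in_C[of k 1] G by simp
      then have xdC: "x \<otimes> ?d \<otimes> inv x \<in> coprime_commutators" using coprime_commutators_conj G by simp
      have "commutator G (x [^] Suc k) y [^] (i * f) = ((x \<otimes> ?d \<otimes> inv x) \<otimes> c) [^] (i * f)"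
        using commutator_pow_Suc_left[OF G] xy(2) by simp
      also have "\<dots> = (x \<otimes> ?d \<otimes> inv x) [^] (i * f) \<otimes> c [^] (i * f)"
        by (rule pow_mult_distrib[OF com[OF xdC c]]) (use cG G in auto)
      also have "(x \<otimes> ?d \<otimes> inv x) [^] (i * f) = x \<otimes> (?z [^] f) [^] k \<otimes> inv x"
        using conj_pow[of x ?d "i * f"] Suc G by simp
      also have "x \<otimes> (?z [^] f) [^] k = (?z [^] f) [^] k \<otimes> x"
        using group_commutes_pow[OF xz] zG G by simp
      also have "(?z [^] f) [^] k \<otimes> x \<otimes> inv x = (?z [^] f) [^] k" using zG G by (simp add: m_assoc)
      also have "c [^] (i * f) = ?z [^] f" using cG by (simp add: nat_pow_pow)
      finally show ?case by simp
    qed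
    from this[of "p ^ j"] show "(?z [^] f) [^] (p ^ j) = \<one>" using jm(1) G by (simp add: commutator_def)
    show "(?z [^] f) [^] t = \<one>" using part_pow_t[OF zG] .
  qed (use zG coprime_p_t in auto)
  ultimately show ?thesis using part_mult[OF zG] by simp
qed

end

section \<open>Bounding the nilpotent residual\<close>

context group begin

lemma words_minimal:
  assumes "subgroup H G" "S \<subseteq> H"
  shows "words S \<subseteq> H"
proof -
  have "lprod xs \<in> H" if "set xs \<subseteq> S" for xs
    using that assms by (induct xs) (auto simp: subgroup.one_closed subgroup.m_closed)
  then show ?thesis unfolding words_def by blast
qed

text \<open>The right-hand side is a product of only \<open>i + 1\<close> commutators, since conjugates of commutators are
  commutators.\<close>

lemma commutator_pow_shorten:
  assumes x: "x \<in> carrier G" and y: "y \<in> carrier G"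
    and com: "commutator G x y [^] Suc i \<otimes> y = y \<otimes> commutator G x y [^] Suc i"
  shows "commutator G x y [^] Suc (Suc i) =
    commutator G x (y \<otimes> y) \<otimes> (y \<otimes> commutator G x y \<otimes> inv y) [^] i"
proof -
  let ?c = "commutator G x y"
  have c: "?c \<in> carrier G" using x y by simp
  have "?c [^] Suc i = y \<otimes> ?c [^] Suc i \<otimes> inv y"
    using com c y by (metis inv_solve_right' m_closed nat_pow_closed)
  also have "\<dots> = y \<otimes> (?c \<otimes> ?c [^] i) \<otimes> inv y" using nat_pow_Suc2[OF c] by simp
  also have "\<dots> = y \<otimes> ?c \<otimes> inv y \<otimes> (y \<otimes> ?c [^] i \<otimes> inv y)" using c y by (simp add: group_word)
  also have "y \<otimes> ?c [^] i \<otimes> inv y = (y \<otimes> ?c \<otimes> inv y) [^] i" by (rule conj_pow[OF y c, symmetric])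
  finally have "?c \<otimes> ?c [^] Suc i = ?c \<otimes> (y \<otimes> ?c \<otimes> inv y \<otimes> (y \<otimes> ?c \<otimes> inv y) [^] i)" by (simp only:)
  also have "\<dots> = (?c \<otimes> (y \<otimes> ?c \<otimes> inv y)) \<otimes> (y \<otimes> ?c \<otimes> inv y) [^] i"
    by (rule m_assoc[symmetric]) (use c y in auto)
  finally have "?c \<otimes> ?c [^] Suc i = (?c \<otimes> (y \<otimes> ?c \<otimes> inv y)) \<otimes> (y \<otimes> ?c \<otimes> inv y) [^] i" .
  moreover have "?c \<otimes> (y \<otimes> ?c \<otimes> inv y) = commutator G x (y \<otimes> y)"
    using x y by (simp add: commutator_def group_word)
  ultimately show ?thesis using nat_pow_Suc2[OF c, of "Suc i"] by simp
qed

end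

context group_split begin

lemma hypercentral_part_mult:
  assumes fin: "finite (carrier G)" and u: "u \<in> carrier G" and z: "z \<in> central_above G {\<one>} n"
  shows "(u \<otimes> z) [^] e = u [^] e \<otimes> z [^] e" "(u \<otimes> z) [^] f = u [^] f \<otimes> z [^] f"
proof -
  let ?K = "generate G {u, z}" and ?H = "G\<lparr>carrier := generate G {u, z}\<rparr>"
  have zG: "z \<in> carrier G"
    using z normal_central_above[OF one_is_normal] normal_imp_subgroup subgroup.mem_carrier by metis
  have K: "subgroup ?K G" using generate_is_subgroup u zG by simp
  interpret H: group_split ?H p a t e f by (rule subgroup_split[OF K])
  have finK: "finite (carrier ?H)" using fin subgroup.subset[OF K] finite_subset by simp blast
  have uz: "u \<in> carrier ?H" "z \<in> carrier ?H" by (auto intro: generate.incl)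
  show "(u \<otimes> z) [^] e = u [^] e \<otimes> z [^] e" "(u \<otimes> z) [^] f = u [^] f \<otimes> z [^] f"
    using H.nilpotent_part_mult(1,2)[OF nilpotent_generate_hypercentral[OF z u] finK uz]
    by (simp_all flip: nat_pow_consistent)
qed

end

text \<open>Here \<open>m\<close> bounds the index of the hypercenter, and words are formed from the
  coprime commutators and the set \<open>D\<close> of commutators of elements of the group
  \<open>K\<close> that they generate. \<open>l\<close> bounds word lengths over \<open>D\<close>:
  \<open>m * m\<close> letters, exponent \<open>m + 1\<close>. \<open>s\<close> bounds the alphabet:
  the trivial commutator, at most \<open>m\<close> primes with \<open>m * m\<close> commutators
  each, and \<open>D\<close>. \<open>k\<close> bounds the exponents at which powers of letters
  shorten. The sum counts lists of length at most \<open>s * k\<close>.\<close>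

definition residual_bound :: "nat \<Rightarrow> nat" where
  "residual_bound m =
     (let l = m * m * (m + 1); s = 1 + m * (m * m) + m * m; k = m * (l + 1) + (m + 1)
      in \<Sum>i\<le>s * k. s ^ i)"

context group begin

lemma card_coset_image_le:
  assumes fin: "finite (carrier G)" and Z: "subgroup Z G" and m: "card (rcosets Z) \<le> m"
    and S: "S \<subseteq> (\<lambda>(U, V). \<theta> U V) ` ((rcosets Z) \<times> (rcosets Z))"
  shows "finite S" "card S \<le> m * m"
proof -
  have finR: "finite (rcosets Z)" using fin by (simp add: RCOSETS_def)
  then show "finite S" using S finite_subset by blast
  have "card S \<le> card ((\<lambda>(U, V). \<theta> U V) ` ((rcosets Z) \<times> (rcosets Z)))" using finR S by (intro card_mono) auto
  also have "\<dots> \<le> card ((rcosets Z) \<times> (rcosets Z))" using finR by (intro card_image_le) auto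
  also have "\<dots> \<le> m * m" using m by (simp add: card_cartesian_product mult_le_mono)
  finally show "card S \<le> m * m" .
qed

lemma commutator_absorb_left:
  "x \<in> carrier G \<Longrightarrow> y \<in> carrier G \<Longrightarrow> z \<in> carrier G \<Longrightarrow> z \<otimes> y = y \<otimes> z \<Longrightarrow>
    commutator G (x \<otimes> z) y = commutator G x y"
proof -
  assume G: "x \<in> carrier G" "y \<in> carrier G" "z \<in> carrier G" and zy: "z \<otimes> y = y \<otimes> z"
  have "commutator G (x \<otimes> z) y = x \<otimes> (z \<otimes> y) \<otimes> inv z \<otimes> inv x \<otimes> inv y"
    using G by (simp add: commutator_def group_word)
  then show ?thesis unfolding zy using G by (simp add: commutator_def group_word)
qed

lemma commutator_absorb_right:
  "x \<in> carrier G \<Longrightarrow> y \<in> carrier G \<Longrightarrow> z \<in> carrier G \<Longrightarrow> z \<otimes> x = x \<otimes> z \<Longrightarrow>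
    commutator G x (y \<otimes> z) = commutator G x y"
proof -
  assume G: "x \<in> carrier G" "y \<in> carrier G" "z \<in> carrier G" and zx: "z \<otimes> x = x \<otimes> z"
  have "z \<otimes> inv x = inv x \<otimes> z" using commute_inv[OF G(3,1) zx] .
  then have "commutator G x (y \<otimes> z) = x \<otimes> y \<otimes> (inv x \<otimes> z) \<otimes> inv z \<otimes> inv y"
    using G by (simp add: commutator_def group_word)
  then show ?thesis using G by (simp add: commutator_def group_word)
qed

lemma coset_representative:
  assumes "subgroup Z G" "x \<in> carrier G"
  shows "(SOME u. u \<in> Z #> x) \<in> Z #> x"
  using someI[of "\<lambda>u. u \<in> Z #> x"] rcos_self[OF assms(2,1)] by blast

lemma mem_rcoset_obtain_right:
  assumes Z: "Z \<lhd> G" and x: "x \<in> carrier G" and u: "u \<in> Z #> x"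
  obtains z where "z \<in> Z" "x = u \<otimes> z" "u \<in> carrier G"
proof -
  interpret normal Z G by (rule Z)
  obtain z where z: "z \<in> Z" "u = z \<otimes> x" using u by (auto simp: r_coset_def)
  have zG: "z \<in> carrier G" using z by simp
  have "inv x \<otimes> inv z \<otimes> x \<in> Z" using z x inv_op_closed1 by simp
  moreover have "x = u \<otimes> (inv x \<otimes> inv z \<otimes> x)" using z(2) zG x by (simp add: group_word)
  ultimately show thesis using that z zG x by blast
qed

text \<open>The hypercenter \<open>Z\<close> centralizes \<open>K\<close>, so \<open>D\<close> is
  small and Schur's argument controls the derived subgroup \<open>M\<close> of \<open>K\<close>.
  Modulo \<open>M\<close> the coprime commutators commute, so their powers with exponent the index
  \<open>i\<close>, being hypercentral, vanish: \<open>c [^] i\<close> is a word in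
  \<open>D\<close>. This provides the shortening of powers that Dietzmann's lemma demands of the
  letters in \<open>?C \<union> D\<close>.\<close>

theorem exists_bounded_nilpotent_residual:
  assumes fin: "finite (carrier G)" and m: "card (rcosets (finite_hypercenter G)) \<le> m"
  shows "\<exists>K. K \<lhd> G \<and> card K \<le> residual_bound m \<and> nilpotent_group (G Mod K)"
proof -
  obtain k where k: "\<And>n. central_above G {\<one>} n \<subseteq> central_above G {\<one>} k"
    using central_above_stable[OF one_is_normal fin] by blast
  define Z where "Z = central_above G {\<one>} k"
  have ZH: "finite_hypercenter G = Z" using k unfolding finite_hypercenter_eq Z_def by blast
  have ZN: "Z \<lhd> G" unfolding Z_def by (rule normal_central_above[OF one_is_normal])
  interpret Z: normal Z G by (rule ZN)
  interpret QZ: group "G Mod Z" by (rule Z.factorgroup_is_group)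
  define i where "i = card (rcosets Z)"
  have im: "i \<le> m" using m ZH by (simp add: i_def)
  have ordG: "0 < order G" using fin order_gt_0_iff_finite by simp
  then have i0: "0 < i" using lagrange[OF Z.subgroup_axioms] by (metis i_def mult_0 gr0I)
  have ordQ: "order (G Mod Z) = i" by (simp add: order_def FactGroup_def i_def)
  have coset: "Z #> u \<in> carrier (G Mod Z)" if "u \<in> carrier G" for u using that by (auto simp: carrier_FactGroup)
  have qpow: "(Z #> u) [^]\<^bsub>G Mod Z\<^esub> i = \<one>\<^bsub>G Mod Z\<^esub>" if "u \<in> carrier G" for u
    using QZ.pow_order_eq_1[OF coset[OF that]] ordQ by simp
  have powZ: "u [^] i \<in> Z" if "u \<in> carrier G" for u
    using qpow[OF that] that rcoset_eq_self_iff[OF Z.subgroup_axioms] by (simp add: Z.FactGroup_pow)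
  let ?C = coprime_commutators
  have CG: "?C \<subseteq> carrier G" by (rule coprime_commutators_closed)
  have finC: "finite ?C" using CG fin finite_subset by blast
  define Cp where "Cp = (\<lambda>p. {commutator G x y | x y. coprime_pair p x y})"
  \<comment> \<open>Passing to representatives of the cosets of \<open>Z\<close> changes the
    relevant parts only by hypercentral factors, which the commutator absorbs; so it depends on two
    cosets only.\<close>
  have Cp: "finite (Cp p)" "card (Cp p) \<le> m * m" if p: "Factorial_Ring.prime p" for p
  proof -
    obtain a t e f where s: "primary_split p a t e f" "order G = p ^ a * t"
      using primary_split_exists[OF p ordG] by blast
    interpret group_split G p a t e f using s pow_order_eq_1 by unfold_locales auto
    define r where "r = (\<lambda>U. SOME u. u \<in> (U :: 'a set))"
    define \<theta> where "\<theta> = (\<lambda>U V. commutator G (r U [^] e) (r V [^] f))"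
    have "Cp p \<subseteq> (\<lambda>(U, V). \<theta> U V) ` ((rcosets Z) \<times> (rcosets Z))"
    proof
      fix c assume "c \<in> Cp p"
      then obtain x y where xy: "coprime_pair p x y" "c = commutator G x y" by (auto simp: Cp_def)
      then obtain j s where js: "x [^] (p ^ j) = \<one>" "coprime s p" "y [^] s = \<one>"
        and G: "x \<in> carrier G" "y \<in> carrier G" by (auto simp: coprime_pair_def)
      obtain z where z: "z \<in> Z" "x = r (Z #> x) \<otimes> z" "r (Z #> x) \<in> carrier G"
        using mem_rcoset_obtain_right[OF ZN G(1)] coset_representative[OF Z.subgroup_axioms G(1)]
        unfolding r_def by blast
      obtain w where w: "w \<in> Z" "y = r (Z #> y) \<otimes> w" "r (Z #> y) \<in> carrier G"
        using mem_rcoset_obtain_right[OF ZN G(2)] coset_representative[OF Z.subgroup_axioms G(2)]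
        unfolding r_def by blast
      define u v where "u = r (Z #> x)" and "v = r (Z #> y)"
      have uv: "u \<in> carrier G" "v \<in> carrier G" "x = u \<otimes> z" "y = v \<otimes> w" "z \<in> carrier G" "w \<in> carrier G"
        using z w by (auto simp: u_def v_def)
      have "x = x [^] e" "y = y [^] f" using part_e_id'[OF G(1) js(1)] part_f_id(1)[OF G(2) js(3,2)] by auto
      then have xe: "x = u [^] e \<otimes> z [^] e" and yf: "y = v [^] f \<otimes> w [^] f"
        using hypercentral_part_mult[OF fin _ z(1)[unfolded Z_def], of u]
          hypercentral_part_mult[OF fin _ w(1)[unfolded Z_def], of v] uv by simp_all
      have zZ: "z [^] e \<in> central_above G {\<one>} k" "w [^] f \<in> central_above G {\<one>} k"
        using subgroup_pow_closed[OF Z.subgroup_axioms] z w by (auto simp: Z_def)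
      have "z [^] e \<otimes> y = y \<otimes> z [^] e"
        by (rule coprime_pair_hypercentral(2)[OF xy(1) zZ(1) part_pow_pa[OF uv(5)]])
      then have "c = commutator G (u [^] e) y"
        using xy(2) commutator_absorb_left[of "u [^] e" y "z [^] e"] xe uv(1,5) G by simp
      moreover have "w [^] f \<otimes> u [^] e = u [^] e \<otimes> w [^] f"
        by (rule hypercentral_coprime_commute[OF zZ(2) _ part_pow_t[OF uv(6)] part_pow_pa[OF uv(1)]])
          (use uv coprime_p_t in \<open>auto simp: coprime_commute\<close>)
      ultimately have "c = commutator G (u [^] e) (v [^] f)"
        using commutator_absorb_right[of "u [^] e" "v [^] f" "w [^] f"] yf uv by simp
      then have "c = \<theta> (Z #> x) (Z #> y)" by (simp add: \<theta>_def u_def v_def)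
      moreover have "Z #> x \<in> rcosets Z" "Z #> y \<in> rcosets Z" using G by (auto simp: RCOSETS_def)
      ultimately show "c \<in> (\<lambda>(U, V). \<theta> U V) ` ((rcosets Z) \<times> (rcosets Z))" by force
    qed
    then show "finite (Cp p)" "card (Cp p) \<le> m * m"
      using card_coset_image_le[OF fin Z.subgroup_axioms im[unfolded i_def]] by blast+
  qed
  let ?P = "{p. Factorial_Ring.prime p \<and> p \<le> m}"
  have C_sub: "?C \<subseteq> insert \<one> (\<Union>p\<in>?P. Cp p)"
  proof
    fix c assume "c \<in> ?C"
    then obtain p x y where xy: "coprime_pair p x y" "c = commutator G x y"
      by (auto simp: coprime_commutators_def)
    then obtain j s where js: "x [^] (p ^ j) = \<one>" "coprime s p" "y [^] s = \<one>" "Factorial_Ring.prime p"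
      and G: "x \<in> carrier G" "y \<in> carrier G" by (auto simp: coprime_pair_def)
    show "c \<in> insert \<one> (\<Union>p\<in>?P. Cp p)"
    proof (cases "p \<le> m")
      case True
      then show ?thesis using xy js by (auto simp: Cp_def)
    next
      case False
      \<comment> \<open>For \<open>p > m\<close> the index is prime to \<open>p\<close>, so the
        \<open>p\<close>-element \<open>x\<close> lies in \<open>Z\<close> and commutes with
        \<open>y\<close>.\<close>
      have "\<not> p dvd i"
      proof
        assume "p dvd i"
        then have "p \<le> i" using i0 by (rule dvd_imp_le)
        then show False using False im by simp
      qed
      then have cop: "coprime (p ^ j) i" using prime_imp_coprime[OF js(4)] by simp
      have "(Z #> x) [^]\<^bsub>G Mod Z\<^esub> (p ^ j) = \<one>\<^bsub>G Mod Z\<^esub>"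
        using js(1) G Z.subset by (simp add: Z.FactGroup_pow)
      then have "Z #> x = Z" using QZ.pow_coprime_one[OF coset[OF G(1)] _ qpow[OF G(1)] cop] by simp
      then have "x \<in> Z" using rcoset_eq_self_iff[OF Z.subgroup_axioms G(1)] by simp
      then have "x \<otimes> y = y \<otimes> x"
        using hypercentral_coprime_commute[OF _ G(2) js(1,3)] js(2) unfolding Z_def
        by (simp add: coprime_commute)
      then show ?thesis using xy(2) commutator_eq_one_iff[OF G] by simp
    qed
  qed
  have cardC: "card ?C \<le> 1 + m * (m * m)"
  proof -
    have P1: "?P \<subseteq> {1..m}"
    proof
      fix p assume "p \<in> ?P"
      then show "p \<in> {1..m}" using prime_ge_1_nat[of p] by simp
    qed
    have finP: "finite ?P" by (rule finite_subset[OF P1]) simp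
    have cardP: "card ?P \<le> m" using card_mono[OF _ P1] by simp
    have finU: "finite (\<Union>p\<in>?P. Cp p)" using finP Cp by auto
    have "card (\<Union>p\<in>?P. Cp p) \<le> (\<Sum>p\<in>?P. card (Cp p))" by (rule card_UN_le[OF finP])
    also have "\<dots> \<le> (\<Sum>p\<in>?P. m * m)" by (rule sum_mono) (use Cp in auto)
    also have "\<dots> \<le> m * (m * m)" using cardP by simp
    finally have "card (insert \<one> (\<Union>p\<in>?P. Cp p)) \<le> 1 + m * (m * m)" using card_insert_le_m1 finU
      by (simp add: card_insert_if)
    then show ?thesis using card_mono[OF _ C_sub] finU by simp
  qed
  define K where "K = words ?C"
  have KN: "K \<lhd> G" unfolding K_def
    by (rule words_normal[OF fin CG coprime_commutators_conj])
  interpret K: normal K G by (rule KN)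
  have CK: "?C \<subseteq> K" using words_incl[OF CG] by (auto simp: K_def)
  have nil: "nilpotent_group (G Mod K)"
  proof (rule group.nilpotent_if_parts_commute[OF K.factorgroup_is_group, of "order G"])
    show "finite (carrier (G Mod K))" using fin by (simp add: carrier_FactGroup)
    show "x [^]\<^bsub>G Mod K\<^esub> order G = \<one>\<^bsub>G Mod K\<^esub>" if x: "x \<in> carrier (G Mod K)" for x
    proof -
      obtain u where u: "u \<in> carrier G" "x = K #> u" using x by (auto simp: carrier_FactGroup)
      then have "x [^]\<^bsub>G Mod K\<^esub> order G = K #> u [^] order G" by (simp add: K.FactGroup_pow)
      also have "\<dots> = K" using pow_order_eq_1[OF u(1)] K.subset by simp
      finally show ?thesis by simp
    qed
    show "0 < order G" by fact
    fix p a t e f x y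
    assume s: "primary_split p a t e f" "order G = p ^ a * t"
      and "x \<in> carrier (G Mod K)" "y \<in> carrier (G Mod K)"
    then obtain u v where uv: "u \<in> carrier G" "x = K #> u" "v \<in> carrier G" "y = K #> v"
      by (auto simp: carrier_FactGroup)
    interpret group_split G p a t e f using s pow_order_eq_1 by unfold_locales auto
    have "coprime_pair p (u [^] e) (v [^] f)"
      using part_pow_pa[OF uv(1)] part_pow_t[OF uv(3)] coprime_p_t prime_p uv
      unfolding coprime_pair_def by (auto simp: coprime_commute)
    then have "commutator G (u [^] e) (v [^] f) \<in> K" using CK by (auto simp: coprime_commutators_def)
    then show "x [^]\<^bsub>G Mod K\<^esub> e \<otimes>\<^bsub>G Mod K\<^esub> y [^]\<^bsub>G Mod K\<^esub> f = y [^]\<^bsub>G Mod K\<^esub> f \<otimes>\<^bsub>G Mod K\<^esub> x [^]\<^bsub>G Mod K\<^esub> e"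
      using commutator_mem_iff[OF KN, of "u [^] e" "v [^] f"] uv by (simp add: K.FactGroup_pow)
  qed
  have KZ: "z \<otimes> w = w \<otimes> z" if z: "z \<in> Z" and w: "w \<in> K" for z w
  proof -
    have "K \<subseteq> {g \<in> carrier G. \<forall>x \<in> {z}. g \<otimes> x = x \<otimes> g}" unfolding K_def
    proof (rule words_minimal)
      show "subgroup {g \<in> carrier G. \<forall>x \<in> {z}. g \<otimes> x = x \<otimes> g} G"
        using subgroup_centralizer[of "{z}"] z by simp
      show "?C \<subseteq> {g \<in> carrier G. \<forall>x \<in> {z}. g \<otimes> x = x \<otimes> g}"
        using CG hypercentral_centralizes_coprime_commutators[OF fin _ z[unfolded Z_def]] by auto
    qed
    then show ?thesis using w by auto
  qed
  define D where "D = {commutator G x y | x y. x \<in> K \<and> y \<in> K}"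
  have DK: "D \<subseteq> K" using commutator_mem_normal[OF KN] by (auto simp: D_def)
  have DG: "D \<subseteq> carrier G" using DK K.subset by blast
  have D_conj: "g \<otimes> d \<otimes> inv g \<in> D" if "g \<in> carrier G" "d \<in> D" for g d
    using that conj_commutator K.inv_op_closed2 unfolding D_def by (auto, metis K.mem_carrier)
  have cardD: "finite D" "card D \<le> m * m"
  proof -
    \<comment> \<open>Representatives are taken inside \<open>K\<close>, because \<open>Z\<close>
      commutes with \<open>K\<close>.\<close>
    define r where "r = (\<lambda>U. SOME u. u \<in> K \<and> u \<in> (U :: 'a set))"
    have r: "r (Z #> x) \<in> K" "r (Z #> x) \<in> Z #> x" if "x \<in> K" for x
      using someI[of "\<lambda>u. u \<in> K \<and> u \<in> Z #> x" x] that rcos_self[OF _ Z.subgroup_axioms]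
      by (auto simp: r_def)
    have "D \<subseteq> (\<lambda>(U, V). commutator G (r U) (r V)) ` ((rcosets Z) \<times> (rcosets Z))"
    proof
      fix d assume "d \<in> D"
      then obtain x y where xy: "x \<in> K" "y \<in> K" "d = commutator G x y" by (auto simp: D_def)
      have G: "x \<in> carrier G" "y \<in> carrier G" using xy by auto
      obtain z where z: "z \<in> Z" "x = r (Z #> x) \<otimes> z" "r (Z #> x) \<in> carrier G"
        using mem_rcoset_obtain_right[OF ZN G(1) r(2)[OF xy(1)]] by blast
      obtain w where w: "w \<in> Z" "y = r (Z #> y) \<otimes> w" "r (Z #> y) \<in> carrier G"
        using mem_rcoset_obtain_right[OF ZN G(2) r(2)[OF xy(2)]] by blast
      have "d = commutator G (r (Z #> x)) y"
        using xy(3) z commutator_absorb_left[OF z(3) G(2) _ KZ[OF z(1) xy(2)]] by simp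
      also have "\<dots> = commutator G (r (Z #> x)) (r (Z #> y))"
        using w commutator_absorb_right[OF z(3) w(3) _ KZ[OF w(1) r(1)[OF xy(1)]]] by simp
      finally show "d \<in> (\<lambda>(U, V). commutator G (r U) (r V)) ` ((rcosets Z) \<times> (rcosets Z))"
        using G by (force simp: RCOSETS_def)
    qed
    then show "finite D" "card D \<le> m * m"
      using card_coset_image_le[OF fin Z.subgroup_axioms im[unfolded i_def]] by blast+
  qed
  have D_inv_conj: "inv c \<otimes> x \<otimes> c \<in> D" if "c \<in> D" "x \<in> D" for c x
    using D_conj[of "inv c" x] that DG by auto
  \<comment> \<open>The power of \<open>d\<close> with exponent \<open>i = Suc l\<close> lies in
    \<open>Z\<close> and so commutes with \<open>y\<close>; Schur's identity then writes the power
    \<open>i + 1\<close> as a product of \<open>i\<close> letters.\<close>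
  have D_pow: "\<exists>j zs. j \<le> m + 1 \<and> set zs \<subseteq> D \<and> length zs < j \<and> d [^] j = lprod zs" if d: "d \<in> D" for d
  proof -
    obtain x y where xy: "x \<in> K" "y \<in> K" "d = commutator G x y" using d by (auto simp: D_def)
    have G: "x \<in> carrier G" "y \<in> carrier G" using xy by auto
    obtain l where l: "i = Suc l" using i0 by (cases i) auto
    have "d [^] Suc l \<in> Z" using powZ[of d] d DG l by auto
    then have "d [^] Suc l \<otimes> y = y \<otimes> d [^] Suc l" using KZ xy(2) by blast
    then have "d [^] Suc i = commutator G x (y \<otimes> y) \<otimes> (y \<otimes> d \<otimes> inv y) [^] l"
      using commutator_pow_shorten[OF G, of l] xy(3) l by simp
    also have "\<dots> = lprod (commutator G x (y \<otimes> y) # replicate l (y \<otimes> d \<otimes> inv y))"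
      using G xy(3) by (simp add: lprod_replicate)
    finally have eq: "d [^] Suc i = lprod (commutator G x (y \<otimes> y) # replicate l (y \<otimes> d \<otimes> inv y))" .
    have "commutator G x (y \<otimes> y) \<in> D" using xy by (auto simp: D_def)
    moreover have "y \<otimes> d \<otimes> inv y \<in> D" using D_conj G d by simp
    ultimately have "set (commutator G x (y \<otimes> y) # replicate l (y \<otimes> d \<otimes> inv y)) \<subseteq> D" by auto
    then show ?thesis using eq l im
      by (intro exI[of _ "Suc i"] exI[of _ "commutator G x (y \<otimes> y) # replicate l (y \<otimes> d \<otimes> inv y)"]) auto
  qed
  define l where "l = m * m * (m + 1)"
  have D_words: "\<exists>ys. set ys \<subseteq> D \<and> length ys \<le> l \<and> x = lprod ys" if "x \<in> words D" for x
    unfolding l_def by (rule words_bounded(1)[OF DG cardD D_inv_conj D_pow that])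
  define M where "M = words D"
  have MN: "M \<lhd> G" unfolding M_def by (rule words_normal[OF fin DG D_conj])
  interpret M: normal M G by (rule MN)
  interpret QM: group "G Mod M" by (rule M.factorgroup_is_group)
  have DM: "D \<subseteq> M" using words_incl[OF DG] by (auto simp: M_def)
  have C_pow: "c [^] i \<in> M" if c: "c \<in> ?C" for c
  proof -
    have cG: "c \<in> carrier G" using c CG by blast
    \<comment> \<open>Coprime pairs of the quotient lift: replacing representatives by their primary
      parts does not change the cosets.\<close>
    have QC: "\<exists>d \<in> ?C. X1 = M #> d" if X1: "X1 \<in> QM.coprime_commutators" for X1
    proof -
      obtain p U V where UV: "QM.coprime_pair p U V" "X1 = commutator (G Mod M) U V"
        using X1 by (auto simp: QM.coprime_commutators_def)
      then obtain j s where js: "U [^]\<^bsub>G Mod M\<^esub> (p ^ j) = \<one>\<^bsub>G Mod M\<^esub>" "coprime s p" "V [^]\<^bsub>G Mod M\<^esub> s = \<one>\<^bsub>G Mod M\<^esub>"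
        "Factorial_Ring.prime p" and G: "U \<in> carrier (G Mod M)" "V \<in> carrier (G Mod M)"
        by (auto simp: QM.coprime_pair_def)
      obtain a t e f where s: "primary_split p a t e f" "order G = p ^ a * t"
        using primary_split_exists[OF js(4) ordG] by blast
      interpret group_split G p a t e f using s pow_order_eq_1 by unfold_locales auto
      interpret q: group_split "G Mod M" p a t e f by (rule quotient_split[OF MN])
      obtain u v where uv: "u \<in> carrier G" "U = M #> u" "v \<in> carrier G" "V = M #> v"
        using G by (auto simp: carrier_FactGroup)
      have "U = M #> u [^] e" "V = M #> v [^] f"
        using q.part_e_id'[OF G(1) js(1)] q.part_f_id(1)[OF G(2) js(3,2)] uv by (auto simp: M.FactGroup_pow)
      then have "X1 = M #> commutator G (u [^] e) (v [^] f)"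
        using UV(2) group_hom.hom_commutator[OF M.coset_hom, of "u [^] e" "v [^] f"] uv by simp
      moreover have "coprime_pair p (u [^] e) (v [^] f)"
        using part_pow_pa[OF uv(1)] part_pow_t[OF uv(3)] coprime_p_t prime_p uv
        unfolding coprime_pair_def by (auto simp: coprime_commute)
      ultimately show ?thesis by (auto simp: coprime_commutators_def)
    qed
    have comQ: "X1 \<otimes>\<^bsub>G Mod M\<^esub> X2 = X2 \<otimes>\<^bsub>G Mod M\<^esub> X1"
      if X12: "X1 \<in> QM.coprime_commutators" "X2 \<in> QM.coprime_commutators" for X1 X2
    proof -
      obtain d d' where d: "d \<in> ?C" "X1 = M #> d" "d' \<in> ?C" "X2 = M #> d'" using QC X12 by meson
      then have "commutator G d d' \<in> M" using DM CK by (auto simp: D_def)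
      then show ?thesis using commutator_mem_iff[OF MN, of d d'] d CG by auto
    qed
    obtain p x y where xy: "coprime_pair p x y" "c = commutator G x y"
      using c by (auto simp: coprime_commutators_def)
    obtain j s where js: "x [^] (p ^ j) = \<one>" "coprime s p" "y [^] s = \<one>" "Factorial_Ring.prime p"
      and G: "x \<in> carrier G" "y \<in> carrier G"
      using xy(1) by (auto simp: coprime_pair_def)
    have "(M #> x) [^]\<^bsub>G Mod M\<^esub> (p ^ j) = \<one>\<^bsub>G Mod M\<^esub>" "(M #> y) [^]\<^bsub>G Mod M\<^esub> s = \<one>\<^bsub>G Mod M\<^esub>"
      using js G M.subset by (simp_all add: M.FactGroup_pow)
    then have "QM.coprime_pair p (M #> x) (M #> y)"
      using js G unfolding QM.coprime_pair_def by (auto simp: carrier_FactGroup)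
    moreover have "M #> c = commutator (G Mod M) (M #> x) (M #> y)"
      using xy group_hom.hom_commutator[OF M.coset_hom] by (simp add: coprime_pair_def)
    ultimately have Mc: "M #> c \<in> QM.coprime_commutators" by (auto simp: QM.coprime_commutators_def)
    have "c [^] i \<in> central_above G {\<one>} k" using powZ[OF cG] by (simp add: Z_def)
    then have "c [^] i \<in> central_above G M k" using central_above_mono[of "{\<one>}" M G k] M.one_closed by blast
    then have "M #> c [^] i \<in> finite_hypercenter (G Mod M)"
      using M.finite_hypercenter_Mod_iff[of "c [^] i"] cG by auto
    then obtain n where "(M #> c) [^]\<^bsub>G Mod M\<^esub> i \<in> central_above (G Mod M) {\<one>\<^bsub>G Mod M\<^esub>} n"
      using cG by (auto simp: QM.finite_hypercenter_eq M.FactGroup_pow)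
    then have "(M #> c) [^]\<^bsub>G Mod M\<^esub> i = \<one>\<^bsub>G Mod M\<^esub>"
      using QM.pow_coprime_commutator_trivial[OF _ comQ Mc] fin by (simp add: carrier_FactGroup)
    then show ?thesis using cG rcoset_eq_self_iff[OF M.subgroup_axioms, of "c [^] i"] by (simp add: M.FactGroup_pow)
  qed
  let ?S = "?C \<union> D"
  define s where "s = 1 + m * (m * m) + m * m"
  define E where "E = m * (l + 1) + (m + 1)"
  have SG: "?S \<subseteq> carrier G" using CG DG by blast
  have cardS: "card ?S \<le> s" using cardC cardD(2) card_Un_le[of ?C D] by (simp add: s_def)
  have S_conj: "inv c \<otimes> x \<otimes> c \<in> ?S" if "c \<in> ?S" "x \<in> ?S" for c x
    using that SG D_conj[of "inv c" x] coprime_commutators_conj[of x "inv c"] by auto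
  have S_pow: "\<exists>j zs. j \<le> E \<and> set zs \<subseteq> ?S \<and> length zs < j \<and> c [^] j = lprod zs" if c: "c \<in> ?S" for c
  proof (cases "c \<in> D")
    case True
    then obtain j zs where "j \<le> m + 1" "set zs \<subseteq> D" "length zs < j" "c [^] j = lprod zs" using D_pow by blast
    then show ?thesis by (intro exI[of _ j] exI[of _ zs]) (auto simp: E_def)
  next
    case False
    then have cC: "c \<in> ?C" using c by blast
    have cG: "c \<in> carrier G" using cC CG by blast
    \<comment> \<open>The exponent \<open>l + 1\<close> is chosen because elements of
      \<open>M\<close> have words of length at most \<open>l\<close> over \<open>D\<close>: the word
      is then shorter than \<open>i * (l + 1)\<close> even when \<open>i = 1\<close>.\<close>
    have "(c [^] i) [^] (l + 1) \<in> M" using subgroup_pow_closed[OF M.subgroup_axioms C_pow[OF cC]] .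
    then obtain zs where zs: "set zs \<subseteq> D" "length zs \<le> l" "(c [^] i) [^] (l + 1) = lprod zs"
      using D_words unfolding M_def by blast
    have "l + 1 \<le> i * (l + 1)" using i0 by (cases i) simp_all
    then have "length zs < i * (l + 1)" using zs(2) by linarith
    moreover have "i * (l + 1) \<le> E" 
      using mult_le_mono1[OF im, of "l + 1"] unfolding E_def by linarith
    moreover have "c [^] (i * (l + 1)) = lprod zs" using zs(3) nat_pow_pow[OF cG, of i "l + 1"] by (simp only:)
    moreover have "set zs \<subseteq> ?S" using zs(1) by blast
    ultimately show ?thesis by blast
  qed
  have "K \<subseteq> words ?S" unfolding K_def by (rule words_mono) blast
  moreover have "finite (words ?S)" using subgroup.subset[OF words_subgroup[OF fin SG]] fin finite_subset by blast
  ultimately have "card K \<le> card (words ?S)" by (rule card_mono[rotated])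
  also have "\<dots> \<le> (\<Sum>i\<le>s * E. s ^ i)"
    by (rule words_bounded(2)[OF SG _ cardS S_conj S_pow]) (use finC cardD in auto)
  also have "\<dots> = residual_bound m" by (simp add: residual_bound_def Let_def s_def E_def l_def)
  finally show ?thesis using KN nil by blast
qed

end

section \<open>Open normal subgroups of profinite groups\<close>

text \<open>\<open>U\<close> and the complements of finitely many members cover the space, and some
  member lies below those finitely many. With \<open>U = {}\<close> this gives points common to all
  members.\<close>

lemma compact_directed_closed:
  assumes comp: "compact_space T" and ne: "\<F> \<noteq> {}" and closed: "\<And>A. A \<in> \<F> \<Longrightarrow> closedin T A"
    and dir: "\<And>A B. A \<in> \<F> \<Longrightarrow> B \<in> \<F> \<Longrightarrow> \<exists>C \<in> \<F>. C \<subseteq> A \<inter> B"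
    and U: "openin T U" "\<Inter>\<F> \<subseteq> U"
  obtains A where "A \<in> \<F>" "A \<subseteq> U"
proof -
  let ?\<U> = "insert U ((\<lambda>A. topspace T - A) ` \<F>)"
  have "\<forall>V \<in> ?\<U>. openin T V" using U(1) closed by auto
  moreover have "topspace T \<subseteq> \<Union>?\<U>" using U(2) ne by auto
  ultimately obtain \<V> where \<V>: "finite \<V>" "\<V> \<subseteq> ?\<U>" "topspace T \<subseteq> \<Union>\<V>"
    using comp unfolding compact_space_alt by meson
  have "\<V> - {U} \<subseteq> (\<lambda>A. topspace T - A) ` \<F>" using \<V>(2) by blast
  then obtain \<G> where \<G>: "\<G> \<subseteq> \<F>" "finite \<G>" "\<V> - {U} = (\<lambda>A. topspace T - A) ` \<G>"
    using finite_subset_image \<V>(1) by (metis finite_Diff)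
  have "\<exists>C \<in> \<F>. \<forall>A \<in> \<G>. C \<subseteq> A" using \<G>(2,1)
  proof (induct \<G>)
    case empty then show ?case using ne by blast
  next
    case (insert A \<G>)
    then obtain C where C: "C \<in> \<F>" "\<forall>A \<in> \<G>. C \<subseteq> A" by blast
    have "A \<in> \<F>" using insert by blast
    then obtain D where "D \<in> \<F>" "D \<subseteq> A \<inter> C" using dir[OF _ C(1)] by blast
    then show ?case using C(2) by blast
  qed
  then obtain C where C: "C \<in> \<F>" "\<And>A. A \<in> \<G> \<Longrightarrow> C \<subseteq> A" by blast
  have "C \<subseteq> U"
  proof
    fix x assume x: "x \<in> C"
    then have "x \<in> topspace T" using closed[OF C(1)] closedin_subset by blast
    then obtain V where V: "V \<in> \<V>" "x \<in> V" using \<V>(3) by blast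
    show "x \<in> U"
    proof (rule ccontr)
      assume "x \<notin> U"
      then have "V \<in> \<V> - {U}" using V by blast
      then obtain A where "A \<in> \<G>" "V = topspace T - A" using \<G>(3) by blast
      then show False using C(2) x V by blast
    qed
  qed
  then show thesis using that C(1) by blast
qed

context topological_group begin

definition open_normal :: "'a set \<Rightarrow> bool" where
  "open_normal N \<longleftrightarrow> N \<lhd> G \<and> openin T N"

lemma continuous_mult_right: "g \<in> carrier G \<Longrightarrow> continuous_map T T (\<lambda>x. x \<otimes> g)"
  using continuous_map_compose[OF _ continuous_mult, of T "\<lambda>x. (x, g)"]
  by (simp add: o_def continuous_map_paired topspace_eq)

lemma openin_carrier: "openin T U \<Longrightarrow> U \<subseteq> carrier G"
  using openin_subset topspace_eq by blast

lemma openin_r_coset: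
  assumes U: "openin T U" and g: "g \<in> carrier G"
  shows "openin T (U #> g)"
proof -
  have "U #> g = {x \<in> topspace T. x \<otimes> inv g \<in> U}"
  proof (intro equalityI subsetI)
    fix x assume "x \<in> U #> g"
    then obtain u where "u \<in> U" "x = u \<otimes> g" by (auto simp: r_coset_def)
    then show "x \<in> {x \<in> topspace T. x \<otimes> inv g \<in> U}"
      using g openin_carrier[OF U] by (auto simp: topspace_eq m_assoc)
  next
    fix x assume x: "x \<in> {x \<in> topspace T. x \<otimes> inv g \<in> U}"
    then have "x = (x \<otimes> inv g) \<otimes> g" using g by (simp add: topspace_eq m_assoc)
    then show "x \<in> U #> g" using x unfolding r_coset_def by blast
  qed
  then show ?thesis
    using openin_continuous_map_preimage[OF continuous_mult_right[OF inv_closed[OF g]] U] by simp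
qed

lemma openin_saturated:
  assumes N: "openin T N" "\<one> \<in> N" and B: "B \<subseteq> carrier G" "\<And>x. x \<in> B \<Longrightarrow> N #> x \<subseteq> B"
  shows "openin T B"
proof -
  have "B = (\<Union>x\<in>B. N #> x)"
  proof
    show "B \<subseteq> (\<Union>x\<in>B. N #> x)"
    proof
      fix x assume x: "x \<in> B"
      then have "\<one> \<otimes> x \<in> N #> x" using N(2) unfolding r_coset_def by blast
      moreover have "\<one> \<otimes> x = x" using x B(1) by auto
      ultimately show "x \<in> (\<Union>x\<in>B. N #> x)" using x by auto
    qed
  qed (use B(2) in blast)
  moreover have "openin T (\<Union>x\<in>B. N #> x)" using openin_r_coset[OF N(1)] B(1) by blast
  ultimately show ?thesis by simp
qed

lemma r_coset_mem_eq:
  assumes N: "subgroup N G" and x: "x \<in> carrier G" and y: "y \<in> N #> x"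
  shows "y \<in> carrier G" "N #> y = N #> x"
  using assms repr_independence[OF y x N] r_coset_subset_G[OF subgroup.subset[OF N] x] by auto

lemma saturated_clopen:
  assumes N: "open_normal N" and B: "B \<subseteq> carrier G" "\<And>x y. x \<in> B \<Longrightarrow> y \<in> carrier G \<Longrightarrow> N #> y = N #> x \<Longrightarrow> y \<in> B"
  shows "openin T B" "closedin T B"
proof -
  have sN: "subgroup N G" and oN: "openin T N" using N by (auto simp: open_normal_def normal_imp_subgroup)
  have "openin T B"
  proof (rule openin_saturated[OF oN subgroup.one_closed[OF sN] B(1)])
    fix x assume x: "x \<in> B"
    show "N #> x \<subseteq> B"
    proof
      fix y assume y: "y \<in> N #> x"
      have xG: "x \<in> carrier G" using x B(1) by blast
      note yx = r_coset_mem_eq[OF sN xG y]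
      show "y \<in> B" by (rule B(2)[OF x yx])
    qed
  qed
  moreover have "openin T (carrier G - B)"
  proof (rule openin_saturated[OF oN subgroup.one_closed[OF sN]])
    fix x assume x: "x \<in> carrier G - B"
    show "N #> x \<subseteq> carrier G - B"
    proof
      fix y assume y: "y \<in> N #> x"
      have xG: "x \<in> carrier G" and xB: "x \<notin> B" using x by blast+
      note yx = r_coset_mem_eq[OF sN xG y]
      have "y \<notin> B" using B(2)[OF _ xG yx(2)[symmetric]] xB by blast
      then show "y \<in> carrier G - B" using yx(1) by blast
    qed
  qed auto
  ultimately show "openin T B" "closedin T B"
    using B(1) by (auto simp: closedin_def topspace_eq)
qed

lemma open_normal_Int: "open_normal M \<Longrightarrow> open_normal N \<Longrightarrow> open_normal (M \<inter> N)"
  by (simp add: open_normal_def normal_subgroup_intersect openin_Int)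

lemma open_normal_carrier: "open_normal (carrier G)"
  using normal_self openin_topspace[of T] by (simp add: open_normal_def topspace_eq)

lemma open_normal_clopen: "open_normal N \<Longrightarrow> closedin T N"
proof (rule saturated_clopen(2))
  assume N: "open_normal N"
  then have sN: "subgroup N G" by (simp add: open_normal_def normal_imp_subgroup)
  show "N \<subseteq> carrier G" using sN subgroup.subset by blast
  fix x y assume xy: "x \<in> N" "y \<in> carrier G" "N #> y = N #> x"
  then have "N #> x = N" using rcoset_eq_self_iff[OF sN] subgroup.mem_carrier[OF sN] by blast
  then show "y \<in> N" using xy rcoset_eq_self_iff[OF sN] by simp
qed

lemma normal_open_if_contains:
  assumes N: "open_normal N" and H: "H \<lhd> G" "N \<subseteq> H"
  shows "open_normal H"
proof -
  have sN: "subgroup N G" and oN: "openin T N" using N by (auto simp: open_normal_def normal_imp_subgroup)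
  have sH: "subgroup H G" using H normal_imp_subgroup by blast
  have "openin T H"
    by (rule openin_saturated[OF oN subgroup.one_closed[OF sN] subgroup.subset[OF sH]])
      (use H(2) subgroup.m_closed[OF sH] in \<open>auto simp: r_coset_def\<close>)
  then show ?thesis using H by (simp add: open_normal_def)
qed

end

section \<open>Open normal subgroups as a neighbourhood base\<close>

context profinite_group begin

text \<open>A clopen neighbourhood \<open>V\<close> of the identity contains the normal subgroup of all \<open>x\<close> for
  which \<open>g x h \<in> V \<longleftrightarrow> g h \<in> V\<close> for all \<open>g\<close> and \<open>h\<close>; it is open by the tube lemma.\<close>

lemma open_normal_base:
  assumes U: "openin T U" "\<one> \<in> U"
  obtains N where "open_normal N" "N \<subseteq> U"
proof -
  \<comment> \<open>In a compact Hausdorff space two closed sets can be separated by a clopen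
    partition unless a connected set meets both, and here connected sets have at most one
    point.\<close>
  have "separated_between T {\<one>} (topspace T - U)"
  proof (rule cut_wire_fence_theorem[OF compact Hausdorff])
    show "closedin T {\<one>}" using closedin_Hausdorff_singleton[OF Hausdorff] by (simp add: topspace_eq)
    show "closedin T (topspace T - U)" using U(1) by blast
    fix C assume "connectedin T C"
    then show "disjnt C {\<one>} \<or> disjnt C (topspace T - U)"
      using totally_disconnected[of C] U(2) by (auto simp: disjnt_def)
  qed
  then obtain V W where VW: "openin T V" "openin T W" "V \<union> W = topspace T" "disjnt V W" "\<one> \<in> V"
      "topspace T - U \<subseteq> W"
    unfolding separated_between_def by auto
  have VU: "V \<subseteq> U" using VW openin_subset[OF VW(1)] by (auto simp: disjnt_def)
  have "closedin T V"
  proof -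
    have "topspace T - V = W" using VW openin_subset[OF VW(2)] by (auto simp: disjnt_def)
    then show ?thesis using VW(1,2) openin_subset by (simp add: closedin_def)
  qed
  define N where "N = {x \<in> carrier G. \<forall>g \<in> carrier G. \<forall>h \<in> carrier G. g \<otimes> x \<otimes> h \<in> V \<longleftrightarrow> g \<otimes> h \<in> V}"
  have N: "g \<otimes> x \<otimes> h \<in> V \<longleftrightarrow> g \<otimes> h \<in> V" if "x \<in> N" "g \<in> carrier G" "h \<in> carrier G" for x g h
    using that by (simp add: N_def)
  have NG: "N \<subseteq> carrier G" by (auto simp: N_def)
  have NU: "N \<subseteq> U"
  proof
    fix x assume x: "x \<in> N"
    have "x \<in> carrier G" using x NG by blast
    then have "x \<in> V" using N[OF x one_closed one_closed] VW(5) by simp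
    then show "x \<in> U" using VU by blast
  qed
  have sub: "subgroup N G"
  proof
    show "N \<subseteq> carrier G" by (rule NG)
    show "\<one> \<in> N" by (simp add: N_def)
  next
    fix x y assume x: "x \<in> N" and y: "y \<in> N"
    have "g \<otimes> (x \<otimes> y) \<otimes> h \<in> V \<longleftrightarrow> g \<otimes> h \<in> V" if g: "g \<in> carrier G" "h \<in> carrier G" for g h
    proof -
      have G: "x \<in> carrier G" "y \<in> carrier G" using x y NG by auto
      have "g \<otimes> (x \<otimes> y) \<otimes> h = g \<otimes> x \<otimes> (y \<otimes> h)" "g \<otimes> (y \<otimes> h) = g \<otimes> y \<otimes> h" using g G by (simp_all add: m_assoc)
      then show ?thesis using N[OF x g(1), of "y \<otimes> h"] N[OF y g] g G by simp
    qed
    then show "x \<otimes> y \<in> N" using x y NG by (auto simp: N_def)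
  next
    fix x assume x: "x \<in> N"
    have "g \<otimes> inv x \<otimes> h \<in> V \<longleftrightarrow> g \<otimes> h \<in> V" if g: "g \<in> carrier G" "h \<in> carrier G" for g h
    proof -
      have G: "x \<in> carrier G" using x NG by auto
      have "g \<otimes> inv x \<otimes> x \<otimes> h = g \<otimes> h" using g G by (simp add: m_assoc)
      then show ?thesis using N[OF x _ g(2), of "g \<otimes> inv x"] g G by simp
    qed
    then show "inv x \<in> N" using x NG by (auto simp: N_def)
  qed
  have "k \<otimes> x \<otimes> inv k \<in> N" if k: "k \<in> carrier G" and x: "x \<in> N" for k x
  proof -
    have G: "x \<in> carrier G" using x NG by auto
    have "g \<otimes> (k \<otimes> x \<otimes> inv k) \<otimes> h \<in> V \<longleftrightarrow> g \<otimes> h \<in> V" if g: "g \<in> carrier G" "h \<in> carrier G" for g h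
    proof -
      have "g \<otimes> (k \<otimes> x \<otimes> inv k) \<otimes> h = (g \<otimes> k) \<otimes> x \<otimes> (inv k \<otimes> h)" "(g \<otimes> k) \<otimes> (inv k \<otimes> h) = g \<otimes> h"
        using g G k by (simp_all add: group_word)
      then show ?thesis using N[OF x, of "g \<otimes> k" "inv k \<otimes> h"] g k by simp
    qed
    then show ?thesis using k G by (simp add: N_def)
  qed
  then have normal: "N \<lhd> G" using sub by (simp add: normal_inv_iff)
  have "openin T N"
  proof -
    let ?X = "prod_topology T T" and ?Y = "prod_topology (prod_topology T T) T"
    have fst1: "continuous_map ?Y T (\<lambda>z. fst (fst z))" "continuous_map ?Y T (\<lambda>z. snd (fst z))" "continuous_map ?Y T snd"
      using continuous_map_compose[OF continuous_map_fst continuous_map_fst, of T T T]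
        continuous_map_compose[OF continuous_map_fst continuous_map_snd, of T T T] continuous_map_snd
      by (simp_all add: o_def)
    have mult: "continuous_map ?Y T (\<lambda>z. \<alpha> z \<otimes> \<beta> z)" if "continuous_map ?Y T \<alpha>" "continuous_map ?Y T \<beta>" for \<alpha> \<beta>
      using continuous_map_compose[OF _ continuous_mult, of ?Y "\<lambda>z. (\<alpha> z, \<beta> z)"] that
      by (simp add: o_def continuous_map_paired)
    have c1: "continuous_map ?Y T (\<lambda>z. fst (fst z) \<otimes> snd z \<otimes> snd (fst z))"
      and c2: "continuous_map ?Y T (\<lambda>z. fst (fst z) \<otimes> snd (fst z))"
      using mult[OF mult[OF fst1(1,3)] fst1(2)] mult[OF fst1(1,2)] .
    let ?A = "{z \<in> topspace ?Y. fst (fst z) \<otimes> snd z \<otimes> snd (fst z) \<in> V}"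
    let ?B = "{z \<in> topspace ?Y. fst (fst z) \<otimes> snd (fst z) \<in> V}"
    have A: "openin ?Y ?A" "closedin ?Y ?A"
      using openin_continuous_map_preimage[OF c1 VW(1)] closedin_continuous_map_preimage[OF c1 \<open>closedin T V\<close>] .
    have B: "openin ?Y ?B" "closedin ?Y ?B"
      using openin_continuous_map_preimage[OF c2 VW(1)] closedin_continuous_map_preimage[OF c2 \<open>closedin T V\<close>] .
    \<comment> \<open>The triples violating the condition form a closed set, and projection along
      the compact factor of pairs \<open>(g, h)\<close> is a closed map; the complement of the
      projection is \<open>N\<close>.\<close>
    let ?D = "(?A - ?B) \<union> (?B - ?A)"
    have "closedin ?Y ?D" using A B by (intro closedin_Un closedin_diff)
    moreover have "closed_map ?Y T snd"
      by (rule closed_map_snd) (simp add: compact_space_prod_topology compact)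
    ultimately have "closedin T (snd ` ?D)" by (simp add: closed_map_def)
    moreover have "N = topspace T - snd ` ?D"
    proof (intro equalityI subsetI)
      fix x assume x: "x \<in> N"
      then have "x \<in> topspace T" using NG topspace_eq by auto
      moreover have "x \<notin> snd ` ?D" using N[OF x] by (auto simp: topspace_eq)
      ultimately show "x \<in> topspace T - snd ` ?D" by blast
    next
      fix x assume x: "x \<in> topspace T - snd ` ?D"
      have "g \<otimes> x \<otimes> h \<in> V \<longleftrightarrow> g \<otimes> h \<in> V" if g: "g \<in> carrier G" "h \<in> carrier G" for g h
      proof (rule ccontr)
        assume "\<not> ?thesis"
        then have "((g, h), x) \<in> ?D" using x g by (auto simp: topspace_eq)
        then show False using x by force
      qed
      then show "x \<in> N" using x by (simp add: N_def topspace_eq)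
    qed
    ultimately show ?thesis by blast
  qed
  then show thesis using that normal NU by (simp add: open_normal_def)
qed

lemma finite_rcosets:
  assumes N: "open_normal N"
  shows "finite (rcosets N)"
proof -
  have sN: "subgroup N G" and oN: "openin T N" using N by (auto simp: open_normal_def normal_imp_subgroup)
  have "\<forall>U \<in> rcosets N. openin T U" using openin_r_coset[OF oN] by (auto simp: RCOSETS_def)
  moreover have "topspace T \<subseteq> \<Union>(rcosets N)" using rcosets_part_G[OF sN] topspace_eq by simp
  ultimately obtain \<F> where \<F>: "finite \<F>" "\<F> \<subseteq> rcosets N" "topspace T \<subseteq> \<Union>\<F>"
    using compact unfolding compact_space_alt by meson
  have "rcosets N \<subseteq> \<F>"
  proof
    fix C assume C: "C \<in> rcosets N"
    then obtain x where x: "x \<in> carrier G" "C = N #> x" by (auto simp: RCOSETS_def)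
    have xC: "x \<in> C" using rcos_self[OF x(1) sN] x(2) by simp
    then obtain F where F: "F \<in> \<F>" "x \<in> F" using \<F>(3) x(1) topspace_eq by blast
    then have "F = C" using rcos_disjoint[OF sN] \<F>(2) C xC by (auto simp: pairwise_def disjnt_def)
    then show "C \<in> \<F>" using F by simp
  qed
  then show ?thesis using \<F>(1) finite_subset by blast
qed

lemma finite_quotient: "open_normal N \<Longrightarrow> finite (carrier (G Mod N))"
  using finite_rcosets by (simp add: FactGroup_def)

lemma quotient_group: "open_normal N \<Longrightarrow> group (G Mod N)"
  by (simp add: open_normal_def normal.factorgroup_is_group)

lemma quotient_hom: "open_normal N \<Longrightarrow> group_hom G (G Mod N) (\<lambda>x. N #> x)"
  by (simp add: open_normal_def normal.coset_hom)

end

section \<open>Nilpotent pairs in quotients\<close>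

context group begin

lemma nil_partners_closed: "y \<in> nil_partners G x \<Longrightarrow> y \<in> carrier G"
  by (simp add: nil_partners_def)

text \<open>Both pairs generate the same subgroup. This is what makes a set of partners stable under
  translation by the coset of \<open>x\<close>.\<close>

lemma nil_partners_mult:
  assumes x: "x \<in> carrier G" and y: "y \<in> nil_partners G x"
  shows "x \<otimes> y \<in> nil_partners G x"
proof -
  have yG: "y \<in> carrier G" using y nil_partners_closed by blast
  have 1: "subgroup (generate G {x, y}) G" and 2: "subgroup (generate G {x, x \<otimes> y}) G"
    using generate_is_subgroup x yG by simp_all
  have i1: "x \<in> generate G {x, y}" "y \<in> generate G {x, y}"
    and i2: "x \<in> generate G {x, x \<otimes> y}" "x \<otimes> y \<in> generate G {x, x \<otimes> y}"
    by (auto intro: generate.incl)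
  have "x \<otimes> y \<in> generate G {x, y}" using subgroup.m_closed[OF 1 i1] .
  then have "generate G {x, x \<otimes> y} \<subseteq> generate G {x, y}"
    using i1 generate_subgroup_incl[OF _ 1] by simp
  moreover have "inv x \<otimes> (x \<otimes> y) \<in> generate G {x, x \<otimes> y}"
    using subgroup.m_closed[OF 2 subgroup.m_inv_closed[OF 2 i2(1)] i2(2)] .
  then have "y \<in> generate G {x, x \<otimes> y}" using x yG by (simp add: inv_cancel_left)
  then have "generate G {x, y} \<subseteq> generate G {x, x \<otimes> y}"
    using i2 generate_subgroup_incl[OF _ 2] by simp
  ultimately show ?thesis using y x yG by (simp add: nil_partners_def)
qed

text \<open>If \<open>z\<close> is a partner of every element, its \<open>p\<close>-part commutes
  with all \<open>p'\<close>-parts, which suffices for hypercentrality. This is the finite case of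
  the identification of \<open>Omega\<close> with the hypercenter.\<close>

lemma finite_hypercenter_iff_nil_partners:
  assumes fin: "finite (carrier G)" and z: "z \<in> carrier G"
  shows "z \<in> finite_hypercenter G \<longleftrightarrow> (\<forall>x \<in> carrier G. z \<in> nil_partners G x)"
proof
  assume "z \<in> finite_hypercenter G"
  then obtain n where "z \<in> central_above G {\<one>} n" by (auto simp: finite_hypercenter_eq)
  then show "\<forall>x \<in> carrier G. z \<in> nil_partners G x"
    using nilpotent_generate_hypercentral z by (simp add: nil_partners_def)
next
  assume nil: "\<forall>x \<in> carrier G. z \<in> nil_partners G x"
  have ordG: "0 < order G" using fin order_gt_0_iff_finite by simp
  have "\<exists>k. z \<in> central_above G {\<one>} k"
  proof (rule hypercentral_if_parts_commute[OF fin pow_order_eq_1 ordG z])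
    fix p a t e f y assume s: "primary_split p a t e f" "order G = p ^ a * t" and y: "y \<in> carrier G"
    interpret group_split G p a t e f using s pow_order_eq_1 by unfold_locales auto
    show "z [^] e \<otimes> y [^] f = y [^] f \<otimes> z [^] e" using nil_partners_parts(4)[OF fin y] nil y by blast
  qed
  then show "z \<in> finite_hypercenter G" by (auto simp: finite_hypercenter_eq)
qed

end

lemma (in normal) nilpotent_image_subgroup_iff:
  assumes A: "subgroup A G"
  shows "nilpotent_group ((G Mod H)\<lparr>carrier := (\<lambda>x. H #> x) ` A\<rparr>) \<longleftrightarrow>
    (\<exists>n. central_above (G\<lparr>carrier := A\<rparr>) (H \<inter> A) n = A)"
proof -
  let ?Q = "(G Mod H)\<lparr>carrier := (\<lambda>x. H #> x) ` A\<rparr>"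
  have sub: "subgroup ((\<lambda>x. H #> x) ` A) (G Mod H)"
    using group_hom.subgroup_img_is_subgroup[OF coset_hom A] .
  have AG: "A \<subseteq> carrier G" using A subgroup.subset by blast
  interpret h: group_hom "G\<lparr>carrier := A\<rparr>" ?Q "\<lambda>x. H #> x"
  proof (unfold group_hom_def group_hom_axioms_def, intro conjI)
    show "group (G\<lparr>carrier := A\<rparr>)" using A is_group subgroup.subgroup_is_group by blast
    show "group ?Q" using sub factorgroup_is_group subgroup.subgroup_is_group by blast
    show "(\<lambda>x. H #> x) \<in> hom (G\<lparr>carrier := A\<rparr>) ?Q"
      using AG by (auto simp: hom_def rcos_sum subset_iff)
  qed
  have "{x \<in> A. H #> x = H} = H \<inter> A"
    using AG rcoset_eq_self_iff[OF subgroup_axioms] by blast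
  then show ?thesis using h.nilpotent_image_iff by simp
qed

section \<open>Partners at the level of an open normal subgroup\<close>

context profinite_group begin

text \<open>The clopen approximation of \<open>Omega_elt\<close> at level \<open>N\<close>;
  \<open>Omega_elt\<close> is the intersection of these sets over all \<open>N\<close>.\<close>

definition nil_pairs :: "'a set \<Rightarrow> 'a \<Rightarrow> 'a set" where
  "nil_pairs N x = {g \<in> carrier G. N #> g \<in> nil_partners (G Mod N) (N #> x)}"

lemma nil_pairs_closed: "nil_pairs N x \<subseteq> carrier G"
  by (auto simp: nil_pairs_def)

lemma nil_pairs_iff:
  assumes N: "open_normal N" and x: "x \<in> carrier G" and g: "g \<in> carrier G"
  shows "g \<in> nil_pairs N x \<longleftrightarrow>
    nilpotent_group ((G Mod N)\<lparr>carrier := (\<lambda>x. N #> x) ` generate G {x, g}\<rparr>)"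
proof -
  interpret h: group_hom G "G Mod N" "\<lambda>x. N #> x" by (rule quotient_hom[OF N])
  have "generate (G Mod N) {N #> x, N #> g} = (\<lambda>x. N #> x) ` generate G {x, g}"
    using h.generate_img[of "{x, g}"] x g by simp
  then show ?thesis using g h.hom_closed by (simp add: nil_pairs_def nil_partners_def)
qed

lemma nil_pairs_mono:
  assumes M: "open_normal M" and N: "open_normal N" and MN: "M \<subseteq> N" and x: "x \<in> carrier G"
  shows "nil_pairs M x \<subseteq> nil_pairs N x"
proof
  fix g assume g: "g \<in> nil_pairs M x"
  then have gG: "g \<in> carrier G" using nil_pairs_closed by blast
  let ?A = "generate G {x, g}"
  have A: "subgroup ?A G" using generate_is_subgroup x gG by simp
  interpret M: normal M G using M by (simp add: open_normal_def)
  interpret N: normal N G using N by (simp add: open_normal_def)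
  interpret A: group "G\<lparr>carrier := ?A\<rparr>" using A is_group subgroup.subgroup_is_group by blast
  obtain n where n: "central_above (G\<lparr>carrier := ?A\<rparr>) (M \<inter> ?A) n = ?A"
    using g nil_pairs_iff[OF M x gG] M.nilpotent_image_subgroup_iff[OF A] by auto
  have "N \<inter> ?A \<lhd> G\<lparr>carrier := ?A\<rparr>" using normal_Int_subgroup[OF A N.normal_axioms] .
  then have "central_above (G\<lparr>carrier := ?A\<rparr>) (N \<inter> ?A) n \<subseteq> ?A"
    using subgroup.subset[OF normal_imp_subgroup[OF A.normal_central_above[of "N \<inter> ?A" n]]] by simp
  moreover have "central_above (G\<lparr>carrier := ?A\<rparr>) (M \<inter> ?A) n \<subseteq> central_above (G\<lparr>carrier := ?A\<rparr>) (N \<inter> ?A) n"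
    by (rule central_above_mono) (use MN in blast)
  ultimately have "central_above (G\<lparr>carrier := ?A\<rparr>) (N \<inter> ?A) n = ?A" using n by blast
  then show "g \<in> nil_pairs N x"
    using nil_pairs_iff[OF N x gG] N.nilpotent_image_subgroup_iff[OF A] by blast
qed

lemma nil_pairs_saturated:
  "g \<in> nil_pairs N x \<Longrightarrow> g' \<in> carrier G \<Longrightarrow> N #> g' = N #> g \<Longrightarrow> g' \<in> nil_pairs N x"
  by (simp add: nil_pairs_def)

lemma nil_pairs_mult:
  assumes N: "open_normal N" and x: "x \<in> carrier G" and x': "x' \<in> N #> x" and g: "g \<in> nil_pairs N x"
  shows "x' \<otimes> g \<in> nil_pairs N x"
proof -
  have sN: "subgroup N G" using N by (simp add: open_normal_def normal_imp_subgroup)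
  interpret h: group_hom G "G Mod N" "\<lambda>x. N #> x" by (rule quotient_hom[OF N])
  note xx = r_coset_mem_eq[OF sN x x']
  have gG: "g \<in> carrier G" using g nil_pairs_closed by blast
  have "N #> (x' \<otimes> g) = (N #> x) \<otimes>\<^bsub>G Mod N\<^esub> (N #> g)" using h.hom_mult[OF xx(1) gG] xx(2) by simp
  moreover have "N #> g \<in> nil_partners (G Mod N) (N #> x)" using g by (simp add: nil_pairs_def)
  ultimately show ?thesis
    using h.H.nil_partners_mult[OF h.hom_closed[OF x]] xx(1) gG by (simp add: nil_pairs_def)
qed

lemma nil_pairs_clopen:
  assumes "open_normal N"
  shows "openin T (nil_pairs N x)" "closedin T (nil_pairs N x)"
  using saturated_clopen[OF assms nil_pairs_closed] nil_pairs_saturated by blast+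

text \<open>The cosets of open normal subgroups are a base of the topology, so the closure is
  detected in finite quotients.\<close>

lemma mem_closure_iff:
  assumes A: "A \<subseteq> carrier G"
  shows "y \<in> T closure_of A \<longleftrightarrow> y \<in> carrier G \<and> (\<forall>N. open_normal N \<longrightarrow> (\<exists>a \<in> A. N #> y = N #> a))"
proof (intro iffI conjI allI impI)
  assume y: "y \<in> T closure_of A"
  then show yG: "y \<in> carrier G" by (simp add: in_closure_of topspace_eq)
  fix N assume N: "open_normal N"
  then have sN: "subgroup N G" "openin T N" by (simp_all add: open_normal_def normal_imp_subgroup)
  have "y \<in> N #> y" "openin T (N #> y)" using rcos_self[OF yG sN(1)] openin_r_coset[OF sN(2) yG] .
  then obtain a where "a \<in> A" "a \<in> N #> y" using y by (auto simp: in_closure_of)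
  then show "\<exists>a \<in> A. N #> y = N #> a" using r_coset_mem_eq(2)[OF sN(1) yG] by metis
next
  assume y: "y \<in> carrier G \<and> (\<forall>N. open_normal N \<longrightarrow> (\<exists>a \<in> A. N #> y = N #> a))"
  have "\<exists>a. a \<in> A \<and> a \<in> U" if U: "y \<in> U" "openin T U" for U
  proof -
    have UG: "U \<subseteq> carrier G" using openin_carrier[OF U(2)] .
    have "openin T (U #> inv y)" using openin_r_coset[OF U(2)] y by simp
    moreover have "y \<otimes> inv y \<in> U #> inv y" using U(1) by (auto simp: r_coset_def)
    then have "\<one> \<in> U #> inv y" using y by simp
    ultimately obtain N where N: "open_normal N" "N \<subseteq> U #> inv y" using open_normal_base by blast
    have sN: "subgroup N G" using N by (simp add: open_normal_def normal_imp_subgroup)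
    obtain a where a: "a \<in> A" "N #> y = N #> a" using y N(1) by blast
    then have "a \<in> N #> y" using rcos_self[OF _ sN] A by blast
    then obtain n where n: "n \<in> N" "a = n \<otimes> y" by (auto simp: r_coset_def)
    then obtain u where u: "u \<in> U" "n = u \<otimes> inv y" using N(2) by (auto simp: r_coset_def)
    have "a = u" using n u y UG by (simp add: m_assoc subset_iff)
    then show ?thesis using a u by blast
  qed
  then show "y \<in> T closure_of A" using y by (auto simp: in_closure_of topspace_eq)
qed

lemma subgroup_closure:
  assumes A: "subgroup A G"
  shows "subgroup (T closure_of A) G"
proof -
  have AG: "A \<subseteq> carrier G" using A subgroup.subset by blast
  note mem = mem_closure_iff[OF AG]
  show ?thesis
  proof
    show "T closure_of A \<subseteq> carrier G" using mem by blast
    show "\<one> \<in> T closure_of A" using mem subgroup.one_closed[OF A] by auto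
  next
    fix x y assume x: "x \<in> T closure_of A" and y: "y \<in> T closure_of A"
    have "\<exists>a \<in> A. N #> (x \<otimes> y) = N #> a" if N: "open_normal N" for N
    proof -
      interpret normal N G using N by (simp add: open_normal_def)
      obtain a b where "a \<in> A" "N #> x = N #> a" "b \<in> A" "N #> y = N #> b" using x y mem N by meson
      moreover have "N #> (x \<otimes> y) = (N #> x) <#> (N #> y)" using x y mem by (simp add: rcos_sum)
      moreover have "N #> (a \<otimes> b) = (N #> a) <#> (N #> b)" if "a \<in> A" "b \<in> A" for a b
        using that AG by (simp add: rcos_sum subset_iff)
      ultimately show ?thesis using subgroup.m_closed[OF A] by metis
    qed
    then show "x \<otimes> y \<in> T closure_of A" using x y mem by simp
  next
    fix x assume x: "x \<in> T closure_of A"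
    have "\<exists>a \<in> A. N #> inv x = N #> a" if N: "open_normal N" for N
    proof -
      interpret h: group_hom G "G Mod N" "\<lambda>x. N #> x" by (rule quotient_hom[OF N])
      obtain a where a: "a \<in> A" "N #> x = N #> a" using x mem N by blast
      have "N #> inv x = inv\<^bsub>G Mod N\<^esub> (N #> x)" using h.hom_inv[of x] x mem by simp
      also have "\<dots> = N #> inv a" using h.hom_inv[of a] a AG by (simp add: subset_iff)
      finally show ?thesis using subgroup.m_inv_closed[OF A a(1)] by blast
    qed
    then show "inv x \<in> T closure_of A" using x mem by simp
  qed
qed

text \<open>An open normal subgroup of \<open>L\<close> need not be of the form
  \<open>N \<inter> L\<close>, but it contains such a subgroup, and a central series above the
  smaller subgroup yields one above the larger.\<close>

lemma pronilpotent_subgroup_iff: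
  assumes L: "subgroup L G"
  shows "pronilpotent (G\<lparr>carrier := L\<rparr>) (subtopology T L) \<longleftrightarrow>
    (\<forall>N. open_normal N \<longrightarrow> nilpotent_group ((G Mod N)\<lparr>carrier := (\<lambda>x. N #> x) ` L\<rparr>))"
proof -
  let ?L = "G\<lparr>carrier := L\<rparr>"
  interpret LG: group ?L using L is_group subgroup.subgroup_is_group by blast
  have iff: "nilpotent_group ((G Mod N)\<lparr>carrier := (\<lambda>x. N #> x) ` L\<rparr>) \<longleftrightarrow>
      (\<exists>n. central_above ?L (N \<inter> L) n = L)" if "open_normal N" for N
    using normal.nilpotent_image_subgroup_iff[of N G L] that L by (simp add: open_normal_def)
  show ?thesis
  proof (intro iffI allI impI)
    fix N assume pro: "pronilpotent ?L (subtopology T L)" and N: "open_normal N"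
    have NL: "N \<inter> L \<lhd> ?L" using normal_Int_subgroup[OF L] N by (simp add: open_normal_def)
    moreover have "openin (subtopology T L) (N \<inter> L)"
      using N by (auto simp: open_normal_def openin_subtopology)
    ultimately have "nilpotent_group (?L Mod (N \<inter> L))" using pro by (simp add: pronilpotent_def)
    then show "nilpotent_group ((G Mod N)\<lparr>carrier := (\<lambda>x. N #> x) ` L\<rparr>)"
      using normal.nilpotent_Mod_iff[OF NL] iff[OF N] by simp
  next
    assume nil: "\<forall>N. open_normal N \<longrightarrow> nilpotent_group ((G Mod N)\<lparr>carrier := (\<lambda>x. N #> x) ` L\<rparr>)"
    show "pronilpotent ?L (subtopology T L)"
      unfolding pronilpotent_def
    proof (intro allI impI)
      fix H assume H: "H \<lhd> ?L" "openin (subtopology T L) H"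
      obtain U where U: "openin T U" "H = U \<inter> L" using H(2) by (auto simp: openin_subtopology)
      have "\<one> \<in> U" using subgroup.one_closed[OF normal_imp_subgroup[OF H(1)]] U(2) by simp
      then obtain N where N: "open_normal N" "N \<subseteq> U" using open_normal_base U(1) by blast
      obtain n where n: "central_above ?L (N \<inter> L) n = L" using nil N iff by blast
      have "central_above ?L (N \<inter> L) n \<subseteq> central_above ?L H n"
        by (rule central_above_mono) (use N(2) U(2) in blast)
      moreover have "central_above ?L H n \<subseteq> L"
        using subgroup.subset[OF normal_imp_subgroup[OF LG.normal_central_above[OF H(1), of n]]] by simp
      ultimately have "central_above ?L H n = carrier ?L" using n by auto
      then show "nilpotent_group (?L Mod H)" using normal.nilpotent_Mod_iff[OF H(1)] by blast
    qed
  qed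
qed

text \<open>A subgroup and its closure have the same image in every quotient by an open normal
  subgroup, so the closure disappears from the definition.\<close>

lemma Omega_elt_eq:
  assumes x: "x \<in> carrier G"
  shows "Omega_elt G T x = {g \<in> carrier G. \<forall>N. open_normal N \<longrightarrow> g \<in> nil_pairs N x}"
proof -
  have "(let H = closed_subgroup_generated G T {x, g}
      in pronilpotent (G\<lparr>carrier := H\<rparr>) (subtopology T H)) \<longleftrightarrow>
    (\<forall>N. open_normal N \<longrightarrow> g \<in> nil_pairs N x)" if g: "g \<in> carrier G" for g
  proof -
    let ?A = "generate G {x, g}"
    have A: "subgroup ?A G" using generate_is_subgroup x g by simp
    have AG: "?A \<subseteq> carrier G" using A subgroup.subset by blast
    have "(\<lambda>x. N #> x) ` (T closure_of ?A) = (\<lambda>x. N #> x) ` ?A" if "open_normal N" for N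
    proof
      show "(\<lambda>x. N #> x) ` (T closure_of ?A) \<subseteq> (\<lambda>x. N #> x) ` ?A"
        using mem_closure_iff[OF AG] that by blast
      have "?A \<subseteq> T closure_of ?A" using closure_of_subset AG topspace_eq by metis
      then show "(\<lambda>x. N #> x) ` ?A \<subseteq> (\<lambda>x. N #> x) ` (T closure_of ?A)" by blast
    qed
    then show ?thesis
      using pronilpotent_subgroup_iff[OF subgroup_closure[OF A]] nil_pairs_iff[OF _ x g]
      by (auto simp: closed_subgroup_generated_def Let_def)
  qed
  then show ?thesis unfolding Omega_elt_def by blast
qed

lemma Omega_elt_subset: "x \<in> carrier G \<Longrightarrow> open_normal N \<Longrightarrow> Omega_elt G T x \<subseteq> nil_pairs N x"
  by (auto simp: Omega_elt_eq)

lemma Omega_elt_closed: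
  assumes "x \<in> carrier G"
  shows "closedin T (Omega_elt G T x)"
proof -
  have "Omega_elt G T x = (\<Inter>N \<in> {N. open_normal N}. nil_pairs N x)"
    
    using Omega_elt_eq[OF assms] nil_pairs_closed open_normal_carrier by blast
  moreover have "closedin T (\<Inter>N \<in> {N. open_normal N}. nil_pairs N x)"
    by (rule closedin_INT) (use open_normal_carrier nil_pairs_clopen in auto)
  ultimately show ?thesis by simp
qed

lemma hypercenter_eq:
  "hypercenter G T = {x \<in> carrier G. \<forall>N. open_normal N \<longrightarrow> (\<exists>n. x \<in> central_above G N n)}"
proof -
  have "N #> x \<in> finite_hypercenter (G Mod N) \<longleftrightarrow> (\<exists>n. x \<in> central_above G N n)"
    if "N \<lhd> G" "x \<in> carrier G" for N x
    using normal.finite_hypercenter_Mod_iff[OF that] .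
  then show ?thesis unfolding hypercenter_def open_normal_def by blast
qed

lemma Omega_eq_hypercenter: "Omega G T = hypercenter G T"
proof -
  have "g \<in> Omega G T \<longleftrightarrow> g \<in> hypercenter G T" if g: "g \<in> carrier G" for g
  proof -
    have "(\<forall>x \<in> carrier G. g \<in> nil_pairs N x) \<longleftrightarrow> N #> g \<in> finite_hypercenter (G Mod N)"
      if N: "open_normal N" for N
    proof -
      interpret Q: group "G Mod N" by (rule quotient_group[OF N])
      have gN: "N #> g \<in> carrier (G Mod N)" using g by (auto simp: carrier_FactGroup)
      have "(\<forall>x \<in> carrier G. g \<in> nil_pairs N x) \<longleftrightarrow>
          (\<forall>U \<in> carrier (G Mod N). N #> g \<in> nil_partners (G Mod N) U)"
        using g by (auto simp: carrier_FactGroup nil_pairs_def)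
      then show ?thesis using Q.finite_hypercenter_iff_nil_partners[OF finite_quotient[OF N] gN] by simp
    qed
    then show ?thesis
      using g by (auto simp: Omega_def Omega_elt_eq hypercenter_def open_normal_def)
  qed
  moreover have "Omega G T \<subseteq> carrier G" using Omega_elt_eq[OF one_closed] by (auto simp: Omega_def)
  moreover have "hypercenter G T \<subseteq> carrier G" by (auto simp: hypercenter_def)
  ultimately show ?thesis by blast
qed

lemma hypercenter_normal: "hypercenter G T \<lhd> G"
proof -
  let ?Z = "hypercenter G T"
  have N: "central_above G N n \<lhd> G" if "open_normal N" for N n
    using normal_central_above that by (simp add: open_normal_def)
  have sN: "subgroup (central_above G N n) G" if "open_normal N" for N n
    using N[OF that] normal_imp_subgroup by blast
  have "subgroup ?Z G"
  proof
    show "?Z \<subseteq> carrier G" by (auto simp: hypercenter_def)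
    show "\<one> \<in> ?Z" using subgroup.one_closed[OF sN] by (auto simp: hypercenter_eq)
  next
    fix x y assume x: "x \<in> ?Z" and y: "y \<in> ?Z"
    have "\<exists>n. x \<otimes> y \<in> central_above G M n" if M: "open_normal M" for M
    proof -
      obtain i j where "x \<in> central_above G M i" "y \<in> central_above G M j" 
        using x y M unfolding hypercenter_eq by blast
      then have "x \<in> central_above G M (max i j)" "y \<in> central_above G M (max i j)"
        using central_above_le[of M i "max i j"] central_above_le[of M j "max i j"] M
        by (auto simp: open_normal_def)
      then show ?thesis using subgroup.m_closed[OF sN[OF M]] by blast
    qed
    then show "x \<otimes> y \<in> ?Z" using x y by (simp add: hypercenter_eq)
  next
    fix x assume x: "x \<in> ?Z"
    then show "inv x \<in> ?Z" using subgroup.m_inv_closed[OF sN] by (simp add: hypercenter_eq) blast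
  qed
  moreover have "g \<otimes> x \<otimes> inv g \<in> ?Z" if "g \<in> carrier G" "x \<in> ?Z" for g x
    using that normal.inv_op_closed2[OF N] by (simp add: hypercenter_eq) blast
  ultimately show ?thesis by (simp add: normal_inv_iff)
qed

end

section \<open>Haar measure\<close>

locale profinite_haar = profinite_group G T + normalized_haar_measure G T \<mu>
  for G (structure) and T and \<mu>
begin

sublocale finite_measure \<mu>
  by (rule finite_measureI) (simp add: space_haar normalized)

lemma measure_carrier: "measure \<mu> (carrier G) = 1"
  by (simp add: measure_def normalized)

lemma open_sets: "openin T U \<Longrightarrow> U \<in> sets \<mu>"
  by (simp add: sets_haar)

lemma closed_sets: "closedin T C \<Longrightarrow> C \<in> sets \<mu>"
proof -
  assume C: "closedin T C"
  then have "C = space \<mu> - (topspace T - C)"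
    using closedin_subset[OF C] by (auto simp: space_haar topspace_eq)
  moreover have "topspace T - C \<in> sets \<mu>" using C open_sets by blast
  ultimately show ?thesis by (metis sets.compl_sets)
qed

lemma measure_coset:
  assumes N: "open_normal N" and x: "x \<in> carrier G"
  shows "measure \<mu> (N #> x) = measure \<mu> N"
proof -
  have "N #> x = x <# N" using N x by (simp add: open_normal_def normal.coset_eq)
  moreover have "N \<in> sets \<mu>" using N open_sets by (simp add: open_normal_def)
  ultimately show ?thesis using left_invariant[OF x] by (simp add: measure_def)
qed

lemma measure_Union_cosets:
  assumes N: "open_normal N" and C: "\<C> \<subseteq> rcosets N"
  shows "measure \<mu> (\<Union>\<C>) = card \<C> * measure \<mu> N"
proof -
  have sN: "subgroup N G" and oN: "openin T N" using N by (auto simp: open_normal_def normal_imp_subgroup)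
  have fin: "finite \<C>" using finite_rcosets[OF N] C finite_subset by blast
  have sets: "U \<in> sets \<mu> \<and> measure \<mu> U = measure \<mu> N" if "U \<in> \<C>" for U
    using that C openin_r_coset[OF oN] open_sets measure_coset[OF N] by (auto simp: RCOSETS_def)
  have disj: "disjoint_family_on (\<lambda>U. U) \<C>"
    using rcos_disjoint[OF sN] C by (auto simp: disjoint_family_on_def pairwise_def disjnt_def)
  have "measure \<mu> (\<Union>U\<in>\<C>. U) = (\<Sum>U\<in>\<C>. measure \<mu> U)"
    by (rule finite_measure_finite_Union[OF fin _ disj]) (use sets in auto)
  also have "\<dots> = (\<Sum>U\<in>\<C>. measure \<mu> N)" by (rule sum.cong) (use sets in auto)
  finally show ?thesis by simp
qed

lemma measure_open_normal:
  assumes N: "open_normal N"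
  shows "card (rcosets N) * measure \<mu> N = 1"
proof -
  have "\<Union>(rcosets N) = carrier G" using rcosets_part_G N by (simp add: open_normal_def normal_imp_subgroup)
  then show ?thesis using measure_Union_cosets[OF N subset_refl] measure_carrier by simp
qed

text \<open>Translates inequalities between measures of unions of cosets into inequalities between
  cardinalities in \<open>G Mod N\<close>.\<close>

lemma measure_saturated:
  assumes N: "open_normal N" and B: "B \<subseteq> carrier G" "\<And>x y. x \<in> B \<Longrightarrow> y \<in> carrier G \<Longrightarrow> N #> y = N #> x \<Longrightarrow> y \<in> B"
  shows "card ((\<lambda>x. N #> x) ` B) = measure \<mu> B * card (rcosets N)"
proof -
  have sN: "subgroup N G" using N by (simp add: open_normal_def normal_imp_subgroup)
  have "\<Union>((\<lambda>x. N #> x) ` B) = B"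
  proof
    show "\<Union>((\<lambda>x. N #> x) ` B) \<subseteq> B"
    proof
      fix y assume "y \<in> \<Union>((\<lambda>x. N #> x) ` B)"
      then obtain x where x: "x \<in> B" "y \<in> N #> x" by blast
      then have xG: "x \<in> carrier G" using B(1) by blast
      show "y \<in> B" by (rule B(2)[OF x(1) r_coset_mem_eq[OF sN xG x(2)]])
    qed
    show "B \<subseteq> \<Union>((\<lambda>x. N #> x) ` B)" using rcos_self[OF _ sN] B(1) by blast
  qed
  then have "measure \<mu> B = card ((\<lambda>x. N #> x) ` B) * measure \<mu> N"
    using measure_Union_cosets[OF N, of "(\<lambda>x. N #> x) ` B"] B(1) by (auto simp: RCOSETS_def)
  then have "measure \<mu> B * card (rcosets N) = card ((\<lambda>x. N #> x) ` B) * (card (rcosets N) * measure \<mu> N)"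
    by (simp add: ac_simps)
  then show ?thesis using measure_open_normal[OF N] by simp
qed

lemma measure_Omega:
  assumes "openin T (hypercenter G T)"
  shows "measure \<mu> (Omega G T) = inverse (real (card (rcosets (hypercenter G T))))"
    and "0 < card (rcosets (hypercenter G T))"
proof -
  have Z: "open_normal (hypercenter G T)" using assms hypercenter_normal by (simp add: open_normal_def)
  note m = measure_open_normal[OF Z]
  have "card (rcosets (hypercenter G T)) \<noteq> 0"
  proof
    assume "card (rcosets (hypercenter G T)) = 0"
    with m show False by simp
  qed
  then show "0 < card (rcosets (hypercenter G T))" by simp
  show "measure \<mu> (Omega G T) = inverse (real (card (rcosets (hypercenter G T))))"
    using m unfolding Omega_eq_hypercenter by (metis inverse_unique)
qed

lemma bounded_positive_if_open:
  assumes Z: "openin T (hypercenter G T)"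
  shows "nilpotent_bounded_positive G T \<mu>"
proof -
  let ?\<eta> = "measure \<mu> (Omega G T)"
  have pos: "0 < ?\<eta>" using measure_Omega[OF Z] by simp
  have "?\<eta> \<le> P_elt G T \<mu> x" if x: "x \<in> carrier G" for x
    unfolding P_elt_def
    by (rule finite_measure_mono) (use x closed_sets Omega_elt_closed in \<open>auto simp: Omega_def\<close>)
  \<comment> \<open>Half of the measure is taken because the bound has to be strict.\<close>
  then show ?thesis using pos unfolding nilpotent_bounded_positive_def
    by (intro exI[of _ "?\<eta> / 2"]) fastforce
qed

end

section \<open>Positivity implies an open hypercenter\<close>

lemma (in group) normal_centralizer:
  assumes V: "V \<subseteq> carrier G" and conj: "\<And>g v. g \<in> carrier G \<Longrightarrow> v \<in> V \<Longrightarrow> inv g \<otimes> v \<otimes> g \<in> V"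
  shows "{g \<in> carrier G. \<forall>x \<in> V. g \<otimes> x = x \<otimes> g} \<lhd> G"
    (is "?Z \<lhd> G")
proof -
  have "g \<otimes> z \<otimes> inv g \<in> ?Z" if g: "g \<in> carrier G" and z: "z \<in> ?Z" for g z
  proof -
    have zG: "z \<in> carrier G" using z by simp
    have "(g \<otimes> z \<otimes> inv g) \<otimes> v = v \<otimes> (g \<otimes> z \<otimes> inv g)" if v: "v \<in> V" for v
    proof -
      let ?v = "inv g \<otimes> v \<otimes> g"
      have vG: "v \<in> carrier G" using v V by blast
      have com: "z \<otimes> ?v = ?v \<otimes> z" using conj[OF g v] z by simp
      have "(g \<otimes> z \<otimes> inv g) \<otimes> v = g \<otimes> (z \<otimes> ?v) \<otimes> inv g" using g zG vG by (simp add: group_word)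
      also have "\<dots> = g \<otimes> (?v \<otimes> z) \<otimes> inv g" by (simp only: com)
      also have "\<dots> = v \<otimes> (g \<otimes> z \<otimes> inv g)" using g zG vG by (simp add: group_word)
      finally show ?thesis .
    qed
    then show ?thesis using g zG by simp
  qed
  then show ?thesis using subgroup_centralizer[OF V] normal_inv_iff by blast
qed

section \<open>Dense cosets\<close>

context profinite_haar begin

text \<open>For \<open>x\<close> in \<open>N #> a\<close> the set of partners at level
  \<open>N\<close> is that of \<open>a\<close>, so the difference measures what is lost at the finer
  level \<open>M\<close>: less than a twelfth. The strict inequality, with \<open>M = N\<close> and
  \<open>x = a\<close>, forces \<open>nil_pairs N a\<close> to have positive measure.\<close>

definition dense_coset :: "'a set \<Rightarrow> 'a \<Rightarrow> bool" where
  "dense_coset N a \<longleftrightarrow> (\<forall>M x. open_normal M \<longrightarrow> M \<subseteq> N \<longrightarrow> x \<in> N #> a \<longrightarrow>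
     12 * (measure \<mu> (nil_pairs N a) - measure \<mu> (nil_pairs M x)) < measure \<mu> (nil_pairs N a))"

text \<open>Otherwise one constructs a decreasing sequence of cosets along which the measure of the set
  of partners shrinks geometrically; a common point \<open>x\<close> of these cosets has \<open>P(x, G) = 0\<close>.\<close>

lemma exists_dense_coset:
  assumes pos: "nilpotent_positive G T \<mu>" and b: "b \<in> carrier G" and N0: "open_normal N0"
  obtains N a where "open_normal N" "N \<subseteq> N0" "a \<in> N0 #> b" "dense_coset N a"
proof (rule ccontr)
  assume "\<not> thesis"
  then have not: "\<not> dense_coset N a" if "open_normal N" "N \<subseteq> N0" "a \<in> N0 #> b" for N a
    using that \<open>\<And>N a. open_normal N \<Longrightarrow> N \<subseteq> N0 \<Longrightarrow> a \<in> N0 #> b \<Longrightarrow> dense_coset N a \<Longrightarrow> thesis\<close> by blast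
  define P where "P = (\<lambda>(N, a). open_normal N \<and> N \<subseteq> N0 \<and> a \<in> N0 #> b)"
  \<comment> \<open>Failure of density at \<open>(N, a)\<close> supplies a finer level and a point
    at which at least a twelfth of the measure is lost.\<close>
  define Q where "Q = (\<lambda>(N, a) (M, x). M \<subseteq> N \<and> x \<in> N #> a \<and>
      measure \<mu> (nil_pairs M x) \<le> 11 / 12 * measure \<mu> (nil_pairs N a))"
  have sub: "subgroup N G" if "open_normal N" for N using that by (simp add: open_normal_def normal_imp_subgroup)
  have mono: "N #> a \<subseteq> M #> a" if "N \<subseteq> M" for N M a using that by (auto simp: r_coset_def)
  have step: "\<exists>s'. P s' \<and> Q s s'" if Ps: "P s" for s
  proof -
    obtain N a where s: "s = (N, a)" by (cases s)
    have N: "open_normal N" "N \<subseteq> N0" "a \<in> N0 #> b" using Ps s by (auto simp: P_def)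
    obtain M x where M: "open_normal M" "M \<subseteq> N" "x \<in> N #> a"
        "\<not> 12 * (measure \<mu> (nil_pairs N a) - measure \<mu> (nil_pairs M x)) < measure \<mu> (nil_pairs N a)"
      using not[OF N] unfolding dense_coset_def by blast
    have "N0 #> a = N0 #> b" using r_coset_mem_eq(2)[OF sub[OF N0] b N(3)] .
    then have "x \<in> N0 #> b" using M(3) mono[OF N(2)] by blast
    then show ?thesis using M N s by (intro exI[of _ "(M, x)"]) (auto simp: P_def Q_def)
  qed
  have P0: "P (N0, b)" using N0 rcos_self[OF b sub[OF N0]] by (simp add: P_def)
  have "\<exists>s. \<forall>n. P (s n) \<and> Q (s n) (s (Suc n))"
    using dependent_nat_choice[of "\<lambda>_. P" "\<lambda>_. Q"] P0 step by metis
  then obtain s where s: "\<And>n. P (s n)" "\<And>n. Q (s n) (s (Suc n))" by blast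
  define Ns as where "Ns = (\<lambda>n. fst (s n))" and "as = (\<lambda>n. snd (s n))"
  have Ns: "open_normal (Ns n)" "as n \<in> N0 #> b" "Ns (Suc n) \<subseteq> Ns n" "as (Suc n) \<in> Ns n #> as n"
    "measure \<mu> (nil_pairs (Ns (Suc n)) (as (Suc n))) \<le> 11 / 12 * measure \<mu> (nil_pairs (Ns n) (as n))" for n
    using s[of n] by (auto simp: P_def Q_def Ns_def as_def case_prod_unfold)
  have asG: "as n \<in> carrier G" for n using Ns(2) r_coset_mem_eq(1)[OF sub[OF N0] b] by blast
  define C where "C = (\<lambda>n. Ns n #> as n)"
  have "C (Suc n) \<subseteq> C n" for n
  proof -
    have "C (Suc n) \<subseteq> Ns n #> as (Suc n)" unfolding C_def by (rule mono[OF Ns(3)])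
    also have "\<dots> = C n" unfolding C_def by (rule r_coset_mem_eq(2)[OF sub[OF Ns(1)] asG Ns(4)])
    finally show ?thesis .
  qed
  then have dec: "C n \<subseteq> C m" if "m \<le> n" for m n using lift_Suc_antimono_le[of C] that by blast
  have closed: "closedin T (C n)" for n
  proof (unfold C_def, rule saturated_clopen(2)[OF Ns(1)[of n]])
    show "Ns n #> as n \<subseteq> carrier G" using r_coset_mem_eq(1)[OF sub[OF Ns(1)] asG] by blast
    fix x y assume "x \<in> Ns n #> as n" "y \<in> carrier G" "Ns n #> y = Ns n #> x"
    then show "y \<in> Ns n #> as n"
      using r_coset_mem_eq(2)[OF sub[OF Ns(1)] asG] rcos_self[OF _ sub[OF Ns(1)]] by metis
  qed
  have "\<Inter>(range C) \<noteq> {}"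
  proof
    assume "\<Inter>(range C) = {}"
    then have empty: "\<Inter>(range C) \<subseteq> {}" by simp
    have dir: "\<exists>D \<in> range C. D \<subseteq> A \<inter> B" if AB: "A \<in> range C" "B \<in> range C" for A B
    proof -
      obtain i j where "A = C i" "B = C j" using AB by blast
      then show ?thesis using dec[of i "max i j"] dec[of j "max i j"] by auto
    qed
    \<comment> \<open>If the nested closed cosets had empty intersection, compactness would make one
      of them empty.\<close>
    obtain A where "A \<in> range C" "A \<subseteq> {}"
      by (rule compact_directed_closed[OF compact _ _ dir openin_empty empty]) (use closed in auto)
    moreover have "as n \<in> C n" for n using rcos_self[OF asG sub[OF Ns(1)]] by (simp add: C_def)
    ultimately show False by blast
  qed
  then obtain x where x: "\<And>n. x \<in> C n" by blast
  have xG: "x \<in> carrier G" using x[of 0] r_coset_mem_eq(1)[OF sub[OF Ns(1)] asG] by (simp add: C_def)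
  have le: "measure \<mu> (Omega_elt G T x) \<le> (11 / 12) ^ n" for n
  proof -
    have "Ns n #> x = Ns n #> as n" using r_coset_mem_eq(2)[OF sub[OF Ns(1)] asG] x[of n] by (simp add: C_def)
    then have "nil_pairs (Ns n) x = nil_pairs (Ns n) (as n)" by (simp add: nil_pairs_def)
    then have "Omega_elt G T x \<subseteq> nil_pairs (Ns n) (as n)" using Omega_elt_subset[OF xG Ns(1)] by metis
    then have "measure \<mu> (Omega_elt G T x) \<le> measure \<mu> (nil_pairs (Ns n) (as n))"
      by (rule finite_measure_mono) (use open_sets nil_pairs_clopen(1)[OF Ns(1)] in blast)
    also have "\<dots> \<le> (11 / 12) ^ n"
    proof (induct n)
      case 0
      have "nil_pairs (Ns 0) (as 0) \<subseteq> carrier G" by (rule nil_pairs_closed)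
      then have "measure \<mu> (nil_pairs (Ns 0) (as 0)) \<le> measure \<mu> (carrier G)"
        by (rule finite_measure_mono) (metis sets.top space_haar)
      then show ?case using measure_carrier by simp
    next
      case (Suc n)
      then show ?case using Ns(5)[of n] by simp
    qed
    finally show ?thesis .
  qed
  have "0 < measure \<mu> (Omega_elt G T x)" using pos xG by (simp add: nilpotent_positive_def P_elt_def)
  then obtain n where "(11 / 12) ^ n < measure \<mu> (Omega_elt G T x)"
    using real_arch_pow_inv[of "measure \<mu> (Omega_elt G T x)" "11 / 12"] by auto
  then show False using le[of n] by simp
qed

text \<open>The image of \<open>nil_pairs N a\<close> plays the role of \<open>S\<close>. It is a
  union of cosets of \<open>N\<close> because membership is decided modulo \<open>N\<close>. Both
  partner sets are unions of cosets of \<open>M\<close>, so measures turn into cardinalities times a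
  common factor.\<close>

lemma quotient_dense_pairs:
  assumes N: "open_normal N" and a: "a \<in> carrier G" and M: "open_normal M" "M \<subseteq> N"
    and dense: "dense_coset N a"
  shows "dense_pairs (G Mod M) ((\<lambda>x. M #> x) ` N) (M #> a) ((\<lambda>x. M #> x) ` nil_pairs N a)"
proof -
  let ?q = "\<lambda>x. M #> x" and ?S = "nil_pairs N a"
  interpret N: normal N G using N by (simp add: open_normal_def)
  interpret M: normal M G using M by (simp add: open_normal_def)
  interpret q: group_hom G "G Mod M" ?q by (rule M.coset_hom)
  have sat: "y \<in> ?S" if "x \<in> ?S" "y \<in> carrier G" "M #> y = M #> x" for x y
  proof -
    have xG: "x \<in> carrier G" using that(1) nil_pairs_closed by blast
    have "y \<in> M #> x" using rcos_self[OF that(2) M.subgroup_axioms] that(3) by simp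
    then have "y \<in> N #> x" using M(2) by (auto simp: r_coset_def)
    then show ?thesis using nil_pairs_saturated[OF that(1,2)] r_coset_mem_eq(2)[OF N.subgroup_axioms xG] by blast
  qed
  have Scard: "card (?q ` ?S) = measure \<mu> ?S * card (rcosets M)"
    by (rule measure_saturated[OF M(1) nil_pairs_closed sat])
  have Nq: "?q ` N \<lhd> G Mod M" using N.surj_hom_normal_subgroup[OF q.group_hom_axioms M.coset_image] .
  have Dq: "\<exists>x \<in> N #> a. U = ?q x" if U: "U \<in> (?q ` N) #>\<^bsub>G Mod M\<^esub> (?q a)" for U
  proof -
    obtain n where n: "n \<in> N" "U = ?q n \<otimes>\<^bsub>G Mod M\<^esub> ?q a" using U by (auto simp: r_coset_def)
    then have "U = ?q (n \<otimes> a)" using q.hom_mult[of n a] a by simp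
    then show ?thesis using n(1) by (auto simp: r_coset_def)
  qed
  have xG: "x \<in> carrier G" if "x \<in> N #> a" for x using r_coset_mem_eq(1)[OF N.subgroup_axioms a that] .
  show ?thesis
  proof (intro dense_pairs.intro dense_pairs_axioms.intro)
    show "group (G Mod M)" by (rule M.factorgroup_is_group)
    show "?q ` N \<lhd> G Mod M" by (rule Nq)
    show "finite (carrier (G Mod M))" by (rule finite_quotient[OF M(1)])
    show "?q a \<in> carrier (G Mod M)" using a q.hom_closed by blast
    show "?q ` ?S \<subseteq> carrier (G Mod M)" using nil_pairs_closed q.hom_closed by blast
  next
    fix V Y assume "V \<in> ?q ` N" "Y \<in> ?q ` ?S"
    then obtain v y where vy: "v \<in> N" "V = ?q v" "y \<in> ?S" "Y = ?q y" by blast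
    have G: "v \<in> carrier G" "y \<in> carrier G" using vy nil_pairs_closed by auto
    have "N #> (v \<otimes> y) = N #> y"
      using r_coset_mem_eq(2)[OF N.subgroup_axioms G(2), of "v \<otimes> y"] vy(1) by (auto simp: r_coset_def)
    then have "v \<otimes> y \<in> ?S" using nil_pairs_saturated[OF vy(3)] G by simp
    then show "V \<otimes>\<^bsub>G Mod M\<^esub> Y \<in> ?q ` ?S" using q.hom_mult[OF G] vy by (metis imageI)
  next
    fix U Y assume U: "U \<in> (?q ` N) #>\<^bsub>G Mod M\<^esub> (?q a)" and Y: "Y \<in> ?q ` ?S"
    obtain x y where xy: "x \<in> N #> a" "U = ?q x" "y \<in> ?S" "Y = ?q y" using Dq[OF U] Y by blast
    have G: "x \<in> carrier G" "y \<in> carrier G" using xy xG nil_pairs_closed by auto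
    have "x \<otimes> y \<in> ?S" by (rule nil_pairs_mult[OF N a xy(1,3)])
    then show "U \<otimes>\<^bsub>G Mod M\<^esub> Y \<in> ?q ` ?S" using q.hom_mult[OF G] xy by (metis imageI)
  next
    fix U assume U: "U \<in> (?q ` N) #>\<^bsub>G Mod M\<^esub> (?q a)"
    obtain x where x: "x \<in> N #> a" "U = ?q x" using Dq[OF U] by blast
    let ?B = "?S - nil_pairs M x"
    have eq: "?q ` ?S - nil_partners (G Mod M) U = ?q ` ?B"
      using x(2) nil_pairs_closed by (auto simp: nil_pairs_def)
    have "nil_pairs N x = ?S"
      using r_coset_mem_eq(2)[OF N.subgroup_axioms a x(1)] by (simp add: nil_pairs_def)
    then have sub: "nil_pairs M x \<subseteq> ?S" using nil_pairs_mono[OF M(1) N M(2) xG[OF x(1)]] by simp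
    have "measure \<mu> ?B = measure \<mu> ?S - measure \<mu> (nil_pairs M x)"
      by (rule finite_measure_Diff[OF _ _ sub]) (use open_sets nil_pairs_clopen(1) N M in auto)
    then have lt: "12 * measure \<mu> ?B < measure \<mu> ?S" 
      using dense M x(1) unfolding dense_coset_def by simp
    have "real (card (?q ` ?B)) = measure \<mu> ?B * card (rcosets M)"
    proof (rule measure_saturated[OF M(1)])
      show "?B \<subseteq> carrier G" using nil_pairs_closed by blast
      fix y z assume yz: "y \<in> ?B" "z \<in> carrier G" "M #> z = M #> y"
      have "y \<in> carrier G" using yz(1) nil_pairs_closed by blast
      then have "z \<notin> nil_pairs M x" using nil_pairs_saturated[of z M x y] yz by auto
      then show "z \<in> ?B" using sat[of y z] yz by blast
    qed
    moreover have "0 < real (card (rcosets M))"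
    proof -
      have "card (rcosets M) \<noteq> 0" using measure_open_normal[OF M(1)] by (metis mult_zero_left of_nat_0 zero_neq_one)
      then show ?thesis by simp
    qed
    ultimately have "12 * real (card (?q ` ?B)) < real (card (?q ` ?S))"
      using lt Scard by simp
    then have "12 * card (?q ` ?B) < card (?q ` ?S)" by linarith
    then show "12 * card (?q ` ?S - nil_partners (G Mod M) U) < card (?q ` ?S)" using eq by simp
  qed
qed

lemma open_normal_INT:
  assumes "finite \<C>" "open_normal N" "\<And>C. C \<in> \<C> \<Longrightarrow> open_normal (F C)"
  shows "open_normal (N \<inter> (\<Inter>C\<in>\<C>. F C))"
  using assms
proof (induct \<C>)
  case (insert C \<C>)
  have "open_normal (N \<inter> (\<Inter>C\<in>\<C>. F C))"
    using insert.hyps(3)[OF insert.prems(1)] insert.prems(2) by blast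
  then have "open_normal (F C \<inter> (N \<inter> (\<Inter>C\<in>\<C>. F C)))"
    using open_normal_Int insert.prems(2) by blast
  moreover have "F C \<inter> (N \<inter> (\<Inter>C\<in>\<C>. F C)) = N \<inter> (\<Inter>C\<in>insert C \<C>. F C)" by blast
  ultimately show ?case by (simp only:)
qed simp

text \<open>Two kinds of dense cosets cooperate in a finite quotient: one for \<open>N\<close> makes
  the \<open>p\<close>-parts of \<open>W\<close> commute with the \<open>p'\<close>-parts of
  \<open>N\<close>, and one inside each coset of \<open>N\<close> makes them commute with the
  \<open>p'\<close>-part of at least one element \<open>b\<close> of that coset. Together these
  reach an arbitrary \<open>p'\<close>-part.\<close>

theorem hypercenter_open_if_positive:
  assumes pos: "nilpotent_positive G T \<mu>"
  shows "openin T (hypercenter G T)"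
proof -
  obtain N a where N: "open_normal N" "a \<in> carrier G #> \<one>" "dense_coset N a"
    by (rule exists_dense_coset[OF pos one_closed open_normal_carrier]) (rule that)
  have aG: "a \<in> carrier G" using N(2) by (auto simp: r_coset_def)
  interpret N: normal N G using N by (simp add: open_normal_def)
  have ex: "\<exists>s. open_normal (fst s) \<and> fst s \<subseteq> N \<and> snd s \<in> C \<and> dense_coset (fst s) (snd s)"
    if C: "C \<in> rcosets N" for C
  proof -
    obtain b where b: "b \<in> carrier G" "C = N #> b" using C by (auto simp: RCOSETS_def)
    obtain N' a' where "open_normal N'" "N' \<subseteq> N" "a' \<in> N #> b" "dense_coset N' a'"
      using exists_dense_coset[OF pos b(1) N(1)] by blast
    then show ?thesis using b(2) by (intro exI[of _ "(N', a')"]) auto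
  qed
  obtain s where s: "\<And>C. C \<in> rcosets N \<Longrightarrow> open_normal (fst (s C)) \<and> fst (s C) \<subseteq> N \<and> snd (s C) \<in> C \<and>
      dense_coset (fst (s C)) (snd (s C))"
    using bchoice[of "rcosets N" "\<lambda>C s. open_normal (fst s) \<and> fst s \<subseteq> N \<and> snd s \<in> C \<and>
      dense_coset (fst s) (snd s)"] ex by blast
  define W where "W = N \<inter> (\<Inter>C\<in>rcosets N. fst (s C))"
  have W: "open_normal W" unfolding W_def
    by (rule open_normal_INT[OF finite_rcosets[OF N(1)] N(1)]) (use s in blast)
  interpret W: normal W G using W by (simp add: open_normal_def)
  have WN: "W \<subseteq> N" by (auto simp: W_def)
  have "W \<subseteq> hypercenter G T"
  proof
    fix w assume w: "w \<in> W"
    have wG: "w \<in> carrier G" using w by simp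
    have "\<exists>n. w \<in> central_above G M0 n" if M0: "open_normal M0" for M0
    proof -
      define M where "M = M0 \<inter> W"
      have M: "open_normal M" "M \<subseteq> W" unfolding M_def using open_normal_Int[OF M0 W] by auto
      interpret M: normal M G using M by (simp add: open_normal_def)
      let ?q = "\<lambda>x. M #> x" and ?Q = "G Mod M"
      interpret Q: group ?Q by (rule M.factorgroup_is_group)
      interpret q: group_hom G ?Q ?q by (rule M.coset_hom)
      have finQ: "finite (carrier ?Q)" by (rule finite_quotient[OF M(1)])
      then have ordQ: "0 < order ?Q" using Q.order_gt_0_iff_finite by simp
      have DN: "dense_pairs ?Q (?q ` N) (?q a) (?q ` nil_pairs N a)"
        by (rule quotient_dense_pairs[OF N(1) aG M(1)]) (use M WN N(3) in auto)
      have Wq: "?q ` W \<lhd> ?Q" using W.surj_hom_normal_subgroup[OF q.group_hom_axioms M.coset_image] .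
      have "\<exists>k. ?q w \<in> central_above ?Q {\<one>\<^bsub>?Q\<^esub>} k"
      proof (rule Q.hypercentral_if_parts_commute[OF finQ Q.pow_order_eq_1 ordQ])
        show "?q w \<in> carrier ?Q" using wG q.hom_closed by blast
        fix p a' t e f y assume sp: "primary_split p a' t e f" "order ?Q = p ^ a' * t" and y: "y \<in> carrier ?Q"
        interpret g: group_split ?Q p a' t e f using sp Q.pow_order_eq_1 by unfold_locales auto
        define V where "V = (\<lambda>v. v [^]\<^bsub>?Q\<^esub> e) ` (?q ` W)"
        have VQ: "V \<subseteq> carrier ?Q" using q.hom_closed by (auto simp: V_def)
        define Z where "Z = {g \<in> carrier ?Q. \<forall>x \<in> V. g \<otimes>\<^bsub>?Q\<^esub> x = x \<otimes>\<^bsub>?Q\<^esub> g}"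
        have sZ: "subgroup Z ?Q" unfolding Z_def by (rule Q.subgroup_centralizer[OF VQ])
        have V_conj: "inv\<^bsub>?Q\<^esub> g \<otimes>\<^bsub>?Q\<^esub> v \<otimes>\<^bsub>?Q\<^esub> g \<in> V" if g: "g \<in> carrier ?Q" and v: "v \<in> V" for g v
        proof -
          obtain u where u: "u \<in> ?q ` W" "v = u [^]\<^bsub>?Q\<^esub> e" using v by (auto simp: V_def)
          have uQ: "u \<in> carrier ?Q" using u(1) q.hom_closed by auto
          have "inv\<^bsub>?Q\<^esub> g \<otimes>\<^bsub>?Q\<^esub> u \<otimes>\<^bsub>?Q\<^esub> g \<in> ?q ` W" using normal.inv_op_closed1[OF Wq g u(1)] .
          moreover have "inv\<^bsub>?Q\<^esub> g \<otimes>\<^bsub>?Q\<^esub> v \<otimes>\<^bsub>?Q\<^esub> g = (inv\<^bsub>?Q\<^esub> g \<otimes>\<^bsub>?Q\<^esub> u \<otimes>\<^bsub>?Q\<^esub> g) [^]\<^bsub>?Q\<^esub> e"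
            using Q.conj_pow[OF Q.inv_closed[OF g] uQ, of e] g u(2) by simp
          ultimately show ?thesis unfolding V_def by blast
        qed
        have ZN: "Z \<lhd> ?Q" unfolding Z_def by (rule Q.normal_centralizer[OF VQ V_conj])
        interpret Z: normal Z ?Q by (rule ZN)
        interpret QZ: group "?Q Mod Z" by (rule Z.factorgroup_is_group)
        obtain y0 where y0: "y0 \<in> carrier G" "y = ?q y0" using y by (auto simp: carrier_FactGroup)
        define g where "g = y0 [^] f"
        have gG: "g \<in> carrier G" using y0 by (simp add: g_def)
        define u where "u = y [^]\<^bsub>?Q\<^esub> f"
        have uQ: "u \<in> carrier ?Q" using y by (simp add: u_def)
        have uq: "u = ?q g" using y0 by (simp add: u_def g_def M.FactGroup_pow)
        have C: "N #> g \<in> rcosets N" using gG by (auto simp: RCOSETS_def)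
        define N' b where "N' = fst (s (N #> g))" and "b = snd (s (N #> g))"
        have b: "open_normal N'" "N' \<subseteq> N" "b \<in> N #> g" "dense_coset N' b" using s[OF C] by (auto simp: N'_def b_def)
        have bG: "b \<in> carrier G" "N #> b = N #> g" using r_coset_mem_eq[OF N.subgroup_axioms gG b(3)] by auto
        have WN': "W \<subseteq> N'" using C by (auto simp: W_def N'_def)
        have DN': "dense_pairs ?Q (?q ` N') (?q b) (?q ` nil_pairs N' b)"
          by (rule quotient_dense_pairs[OF b(1) bG(1) M(1)]) (use M WN' b(4) in auto)
        \<comment> \<open>The \<open>p'\<close>-part \<open>u\<close>, equal to its own power
          \<open>f\<close>, differs from the \<open>p'\<close>-part of \<open>b\<close> by an
          element \<open>n\<close> of \<open>N\<close>.\<close>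
        have "N #> g [^] f = N #> b [^] f" using bG gG by (simp flip: N.FactGroup_pow)
        then have "g [^] f \<in> N #> b [^] f" using rcos_self[OF nat_pow_closed[OF gG] N.subgroup_axioms] by metis
        then obtain n where n: "n \<in> N" "g [^] f = n \<otimes> b [^] f" by (auto simp: r_coset_def)
        have nG: "n \<in> carrier G" using n by simp
        let ?n = "?q n" and ?b = "?q b"
        have nb: "?n \<in> carrier ?Q" "?b \<in> carrier ?Q" using nG bG q.hom_closed by blast+
        have "u = u [^]\<^bsub>?Q\<^esub> f" using g.part_ff[OF y] by (simp add: u_def)
        also have "\<dots> = ?q (g [^] f)" using uq gG by (simp add: M.FactGroup_pow)
        also have "\<dots> = ?n \<otimes>\<^bsub>?Q\<^esub> ?b [^]\<^bsub>?Q\<^esub> f"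
          using n(2) q.hom_mult[OF nG, of "b [^] f"] bG by (simp add: M.FactGroup_pow)
        also have "?n = ?n [^]\<^bsub>?Q\<^esub> e \<otimes>\<^bsub>?Q\<^esub> ?n [^]\<^bsub>?Q\<^esub> f" using g.part_mult[OF nb(1)] by simp
        finally have u_eq: "u = ?n [^]\<^bsub>?Q\<^esub> e \<otimes>\<^bsub>?Q\<^esub> (?n [^]\<^bsub>?Q\<^esub> f \<otimes>\<^bsub>?Q\<^esub> ?b [^]\<^bsub>?Q\<^esub> f)"
          using Q.m_assoc nb by simp
        have nZ: "?n [^]\<^bsub>?Q\<^esub> f \<in> Z"
        proof -
          have "?n [^]\<^bsub>?Q\<^esub> f \<otimes>\<^bsub>?Q\<^esub> x = x \<otimes>\<^bsub>?Q\<^esub> ?n [^]\<^bsub>?Q\<^esub> f" if x: "x \<in> V" for x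
          proof -
            obtain v where v: "v \<in> W" "x = ?q v [^]\<^bsub>?Q\<^esub> e" using x by (auto simp: V_def)
            show ?thesis using dense_pairs.N_parts_commute(3)[OF DN sp, of ?n "?q v"] n(1) v WN by auto
          qed
          moreover have "?n [^]\<^bsub>?Q\<^esub> f \<in> carrier ?Q" by (rule Q.nat_pow_closed[OF nb(1)])
          ultimately show ?thesis unfolding Z_def by blast
        qed
        have bZ: "?b [^]\<^bsub>?Q\<^esub> f \<in> Z"
        proof -
          have bb: "?b \<in> (?q ` N') #>\<^bsub>?Q\<^esub> ?b"
            using dense_pairs.c_D[OF DN'] .
          have "?b [^]\<^bsub>?Q\<^esub> f \<otimes>\<^bsub>?Q\<^esub> x = x \<otimes>\<^bsub>?Q\<^esub> ?b [^]\<^bsub>?Q\<^esub> f" if x: "x \<in> V" for x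
          proof -
            obtain v where v: "v \<in> W" "x = ?q v [^]\<^bsub>?Q\<^esub> e" using x by (auto simp: V_def)
            show ?thesis using dense_pairs.N_parts_commute(2)[OF DN' sp, of "?q v" ?b] bb v WN' by auto
          qed
          moreover have "?b [^]\<^bsub>?Q\<^esub> f \<in> carrier ?Q" by (rule Q.nat_pow_closed[OF nb(2)])
          ultimately show ?thesis unfolding Z_def by blast
        qed
        let ?k = "\<lambda>x. Z #>\<^bsub>?Q\<^esub> x"
        interpret k: group_hom ?Q "?Q Mod Z" ?k by (rule Z.coset_hom)
        have cZ: "?n [^]\<^bsub>?Q\<^esub> f \<otimes>\<^bsub>?Q\<^esub> ?b [^]\<^bsub>?Q\<^esub> f \<in> Z" using Z.m_closed[OF nZ bZ] .
        then have kc: "?k (?n [^]\<^bsub>?Q\<^esub> f \<otimes>\<^bsub>?Q\<^esub> ?b [^]\<^bsub>?Q\<^esub> f) = \<one>\<^bsub>?Q Mod Z\<^esub>"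
          using Q.rcoset_eq_self_iff[OF sZ Z.mem_carrier[OF cZ]] by (simp del: mult_FactGroup)
        have ne: "?n [^]\<^bsub>?Q\<^esub> e \<in> carrier ?Q" by (rule Q.nat_pow_closed[OF nb(1)])
        \<comment> \<open>Modulo the centralizer \<open>Z\<close> of \<open>V\<close>, the
          \<open>p'\<close>-parts of \<open>n\<close> and \<open>b\<close> vanish. So
          \<open>u\<close> agrees there with a \<open>p\<close>-element while being a
          \<open>p'\<close>-element, hence is trivial.\<close>
        have ku: "?k u = ?k (?n [^]\<^bsub>?Q\<^esub> e)"
          unfolding u_eq k.hom_mult[OF ne Z.mem_carrier[OF cZ]] kc by (rule QZ.r_one[OF k.hom_closed[OF ne]])
        have "?k u [^]\<^bsub>?Q Mod Z\<^esub> (p ^ a') = \<one>\<^bsub>?Q Mod Z\<^esub>"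
          using g.part_pow_pa[OF nb(1)] nb Q.rcoset_eq_self_iff[OF sZ Q.one_closed] Z.one_closed
          by (simp add: ku Z.FactGroup_pow)
        moreover have "?k u [^]\<^bsub>?Q Mod Z\<^esub> t = \<one>\<^bsub>?Q Mod Z\<^esub>"
          using g.part_pow_t[OF y] uQ Q.rcoset_eq_self_iff[OF sZ Q.one_closed] Z.one_closed
          by (simp add: Z.FactGroup_pow u_def)
        ultimately have "?k u = \<one>\<^bsub>?Q Mod Z\<^esub>"
          using QZ.pow_coprime_one[OF k.hom_closed[OF uQ]] g.coprime_pa_t by blast
        then have "u \<in> Z" using Q.rcoset_eq_self_iff[OF sZ uQ] by simp
        moreover have "?q w [^]\<^bsub>?Q\<^esub> e \<in> V" using w by (auto simp: V_def)
        ultimately show "?q w [^]\<^bsub>?Q\<^esub> e \<otimes>\<^bsub>?Q\<^esub> y [^]\<^bsub>?Q\<^esub> f = y [^]\<^bsub>?Q\<^esub> f \<otimes>\<^bsub>?Q\<^esub> ?q w [^]\<^bsub>?Q\<^esub> e"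
          unfolding Z_def u_def by simp
      qed
      then have "?q w \<in> finite_hypercenter ?Q" by (auto simp: Q.finite_hypercenter_eq)
      then obtain n where "w \<in> central_above G M n" using M.finite_hypercenter_Mod_iff[OF wG] by blast
      moreover have "M \<subseteq> M0" by (simp add: M_def)
      ultimately show ?thesis using central_above_mono by blast
    qed
    then show "w \<in> hypercenter G T" using wG by (simp add: hypercenter_eq)
  qed
  then show ?thesis
    using normal_open_if_contains[OF W hypercenter_normal] by (simp add: open_normal_def)
qed

end

section \<open>Finite-by-pronilpotent groups\<close>

context profinite_group begin

text \<open>Open normal subgroups of \<open>G Mod K\<close> correspond to those of \<open>G\<close>
  containing \<open>K\<close>, with the same quotients; thus the quotient topology is dealt with
  once and for all.\<close>

lemma finite_by_pronilpotent_iff: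
  "finite_by_pronilpotent G T \<longleftrightarrow> (\<exists>K. K \<lhd> G \<and> finite K \<and>
    (\<forall>N. open_normal N \<longrightarrow> K \<subseteq> N \<longrightarrow> (\<exists>n. central_above G N n = carrier G)))"
proof -
  have "pronilpotent (G Mod K) (quotient_topology T (\<lambda>x. K #> x)) \<longleftrightarrow>
      (\<forall>N. open_normal N \<longrightarrow> K \<subseteq> N \<longrightarrow> (\<exists>n. central_above G N n = carrier G))" if K: "K \<lhd> G" for K
  proof -
    interpret K: normal K G by (rule K)
    let ?q = "\<lambda>x. K #> x" and ?Q = "G Mod K"
    interpret Q: group ?Q by (rule K.factorgroup_is_group)
    interpret q: group_hom G ?Q ?q by (rule K.coset_hom)
    have nil: "nilpotent_group (?Q Mod H) \<longleftrightarrow> (\<exists>n. central_above G {x \<in> carrier G. ?q x \<in> H} n = carrier G)"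
      if H: "H \<lhd> ?Q" for H
    proof -
      have "central_above ?Q H n = carrier ?Q \<longleftrightarrow> {x \<in> carrier G. ?q x \<in> central_above ?Q H n} = carrier G" for n
        using subgroup.subset[OF normal_imp_subgroup[OF Q.normal_central_above[OF H, of n]]]
        by (auto simp: carrier_FactGroup)
      then show ?thesis
        using normal.nilpotent_Mod_iff[OF H] q.central_above_vimage[OF K.coset_image, of H] by simp
    qed
    show ?thesis
    proof (intro iffI allI impI)
      fix N assume pro: "pronilpotent ?Q (quotient_topology T ?q)" and N: "open_normal N" and KN: "K \<subseteq> N"
      interpret N: normal N G using N by (simp add: open_normal_def)
      have vim: "{x \<in> carrier G. ?q x \<in> ?q ` N} = N"
      proof
        show "{x \<in> carrier G. ?q x \<in> ?q ` N} \<subseteq> N"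
        proof clarify
          fix x n assume x: "x \<in> carrier G" "n \<in> N" "K #> x = K #> n"
          then have "x \<otimes> inv n \<in> N" using rcoset_eq_iff[OF K.subgroup_axioms x(1)] KN by auto
          then have "x \<otimes> inv n \<otimes> n \<in> N" using x(2) by simp
          then show "x \<in> N" using x by (simp add: m_assoc)
        qed
      qed auto
      have NQ: "?q ` N \<lhd> ?Q" using N.surj_hom_normal_subgroup[OF q.group_hom_axioms K.coset_image] .
      have "openin (quotient_topology T ?q) (?q ` N)"
        using vim N.subset N by (auto simp: openin_quotient_topology topspace_eq open_normal_def)
      then have "nilpotent_group (?Q Mod (?q ` N))" using pro NQ by (simp add: pronilpotent_def)
      then show "\<exists>n. central_above G N n = carrier G" using nil[OF NQ] vim by simp
    next
      assume *: "\<forall>N. open_normal N \<longrightarrow> K \<subseteq> N \<longrightarrow> (\<exists>n. central_above G N n = carrier G)"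
      show "pronilpotent ?Q (quotient_topology T ?q)"
        unfolding pronilpotent_def
      proof (intro allI impI)
        fix H assume H: "H \<lhd> ?Q" "openin (quotient_topology T ?q) H"
        let ?N = "{x \<in> carrier G. ?q x \<in> H}"
        have "subgroup ?N G" by (rule q.subgroup_vimage[OF normal_imp_subgroup[OF H(1)]])
        moreover have "g \<otimes> x \<otimes> inv g \<in> ?N" if g: "g \<in> carrier G" and x: "x \<in> ?N" for g x
        proof -
          have "?q (g \<otimes> x \<otimes> inv g) = ?q g \<otimes>\<^bsub>?Q\<^esub> ?q x \<otimes>\<^bsub>?Q\<^esub> inv\<^bsub>?Q\<^esub> ?q g" using g x by (simp del: mult_FactGroup)
          then show ?thesis using normal.inv_op_closed2[OF H(1) q.hom_closed[OF g]] g x by simp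
        qed
        ultimately have "?N \<lhd> G" by (simp add: normal_inv_iff)
        moreover have "openin T ?N" using H(2) by (simp add: openin_quotient_topology topspace_eq)
        moreover have "K \<subseteq> ?N"
        proof
          fix x assume "x \<in> K"
          then have "?q x = \<one>\<^bsub>?Q\<^esub>" "x \<in> carrier G" using rcoset_eq_self_iff[OF K.subgroup_axioms] by auto
          then show "x \<in> ?N" using subgroup.one_closed[OF normal_imp_subgroup[OF H(1)]] by simp
        qed
        ultimately have "\<exists>n. central_above G ?N n = carrier G" using * by (simp add: open_normal_def)
        then show "nilpotent_group (?Q Mod H)" using nil[OF H(1)] by simp
      qed
    qed
  qed
  then show ?thesis unfolding finite_by_pronilpotent_def by blast
qed

lemma separating_open_normal:
  assumes F: "finite F" "F \<subseteq> carrier G" "\<one> \<notin> F"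
  obtains N where "open_normal N" "N \<inter> F = {}"
proof -
  have "closedin T F"
    using closedin_Hausdorff_finite[OF Hausdorff] F topspace_eq by simp
  then have "openin T (topspace T - F)" by blast
  moreover have "\<one> \<in> topspace T - F" using F(3) topspace_eq by simp
  ultimately obtain N where "open_normal N" "N \<subseteq> topspace T - F" using open_normal_base by blast
  then show thesis using that by blast
qed

text \<open>\<open>M0\<close> is chosen to meet \<open>K\<close> trivially. A series reaching
  \<open>G\<close> above \<open>K <#> M1\<close>, cut down to \<open>M0\<close>, is then a series
  above \<open>M1\<close>.\<close>

lemma hypercenter_open_if_finite_by_pronilpotent:
  assumes "finite_by_pronilpotent G T"
  shows "openin T (hypercenter G T)"
proof -
  obtain K where K: "K \<lhd> G" "finite K"
    and nil: "\<And>N. open_normal N \<Longrightarrow> K \<subseteq> N \<Longrightarrow> \<exists>n. central_above G N n = carrier G"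
    using assms finite_by_pronilpotent_iff by blast
  interpret K: normal K G by (rule K(1))
  obtain M0 where M0: "open_normal M0" "M0 \<inter> (K - {\<one>}) = {}"
    using separating_open_normal[of "K - {\<one>}"] K(2) K.subset by blast
  interpret M0: normal M0 G using M0 by (simp add: open_normal_def)
  have "M0 \<subseteq> hypercenter G T"
  proof
    fix x assume x: "x \<in> M0"
    have "\<exists>n. x \<in> central_above G M n" if M: "open_normal M" for M
    proof -
      define M1 where "M1 = M \<inter> M0"
      have M1: "open_normal M1" unfolding M1_def by (rule open_normal_Int[OF M M0(1)])
      interpret M1: normal M1 G using M1 by (simp add: open_normal_def)
      have KM: "K <#> M1 \<lhd> G" by (rule normal_subgroup_set_mult_closed[OF K(1) M1.normal_axioms])
      have sub1: "M1 \<subseteq> K <#> M1"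
      proof
        fix m assume m: "m \<in> M1"
        then have "\<one> \<otimes> m \<in> K <#> M1" unfolding set_mult_def using K.one_closed by blast
        then show "m \<in> K <#> M1" using m by simp
      qed
      have sub2: "K \<subseteq> K <#> M1"
      proof
        fix k assume k: "k \<in> K"
        then have "k \<otimes> \<one> \<in> K <#> M1" unfolding set_mult_def using M1.one_closed by blast
        then show "k \<in> K <#> M1" using k by simp
      qed
      obtain n where n: "central_above G (K <#> M1) n = carrier G"
        using nil[OF normal_open_if_contains[OF M1 KM sub1] sub2] by blast
      \<comment> \<open>The start is the modular law: \<open>k \<otimes> m\<close> in
        \<open>M0\<close> with \<open>m\<close> in \<open>M1\<close> forces \<open>k\<close> into
        \<open>M0\<close>, so \<open>k = \<one>\<close>. Normality of \<open>M0\<close> keeps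
        commutators inside it.\<close>
      have key: "central_above G (K <#> M1) n \<inter> M0 \<subseteq> central_above G M1 n" for n
      proof (induct n)
        case 0
        show ?case
        proof
          fix y assume y: "y \<in> central_above G (K <#> M1) 0 \<inter> M0"
          then obtain k m where km: "k \<in> K" "m \<in> M1" "y = k \<otimes> m" by (auto simp: set_mult_def)
          have "m \<in> M0" using km(2) by (simp add: M1_def)
          then have "y \<otimes> inv m \<in> M0" using y by simp
          then have "k \<in> M0" using km by (simp add: m_assoc)
          then have "k = \<one>" using M0(2) km(1) by blast
          then show "y \<in> central_above G M1 0" using km by simp
        qed
      next
        case (Suc n)
        then show ?case using commutator_mem_normal[OF M0.normal_axioms] by auto
      qed
      have "x \<in> central_above G (K <#> M1) n \<inter> M0" using n x by simp
      then have "x \<in> central_above G M1 n" using key by blast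
      moreover have "M1 \<subseteq> M" by (simp add: M1_def)
      ultimately show ?thesis using central_above_mono by blast
    qed
    then show "x \<in> hypercenter G T" using x by (simp add: hypercenter_eq)
  qed
  then show ?thesis
    using normal_open_if_contains[OF M0(1) hypercenter_normal] by (simp add: open_normal_def)
qed

text \<open>Hypercentral elements of \<open>G\<close> have hypercentral images, so the index of the
  hypercenter does not grow in \<open>G Mod M\<close>, and the bound is the same for every
  \<open>M\<close>.\<close>

lemma exists_bounded_nilpotent_quotient:
  assumes Z: "openin T (hypercenter G T)" and M: "open_normal M"
  obtains N n where "open_normal N" "central_above G N n = carrier G"
    "card ((\<lambda>x. M #> x) ` N) \<le> residual_bound (card (rcosets (hypercenter G T)))"
proof -
  let ?Z = "hypercenter G T"
  have Zo: "open_normal ?Z" using Z hypercenter_normal by (simp add: open_normal_def)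
  interpret Z: normal ?Z G by (rule hypercenter_normal)
  interpret M: normal M G using M by (simp add: open_normal_def)
  let ?q = "\<lambda>x. M #> x" and ?Q = "G Mod M"
  interpret Q: group ?Q by (rule M.factorgroup_is_group)
  interpret q: group_hom G ?Q ?q by (rule M.coset_hom)
  have finQ: "finite (carrier ?Q)" by (rule finite_quotient[OF M])
  let ?H = "finite_hypercenter ?Q"
  have qZ: "?q z \<in> ?H" if "z \<in> ?Z" for z
    using that M unfolding hypercenter_def open_normal_def by blast
  obtain k where k: "\<And>n. central_above ?Q {\<one>\<^bsub>?Q\<^esub>} n \<subseteq> central_above ?Q {\<one>\<^bsub>?Q\<^esub>} k"
    using Q.central_above_stable[OF Q.one_is_normal finQ] by blast
  have H: "?H = central_above ?Q {\<one>\<^bsub>?Q\<^esub>} k" using k by (auto simp: Q.finite_hypercenter_eq)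
  have sH: "subgroup ?H ?Q"
    unfolding H by (rule normal_imp_subgroup[OF Q.normal_central_above[OF Q.one_is_normal]])
  define r where "r = (\<lambda>U. ?H #>\<^bsub>?Q\<^esub> ?q (SOME u. u \<in> U))"
  have "rcosets\<^bsub>?Q\<^esub> ?H \<subseteq> r ` (rcosets ?Z)"
  proof
    fix U assume "U \<in> rcosets\<^bsub>?Q\<^esub> ?H"
    then obtain x where x: "x \<in> carrier G" "U = ?H #>\<^bsub>?Q\<^esub> ?q x"
      by (auto simp: RCOSETS_def carrier_FactGroup)
    have "(SOME u. u \<in> ?Z #> x) \<in> ?Z #> x" by (rule coset_representative[OF Z.subgroup_axioms x(1)])
    then obtain z where z: "z \<in> ?Z" "(SOME u. u \<in> ?Z #> x) = z \<otimes> x" by (auto simp: r_coset_def)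
    have "?q (z \<otimes> x) = ?q z \<otimes>\<^bsub>?Q\<^esub> ?q x" using q.hom_mult[of z x] z x by simp
    then have "?q (z \<otimes> x) \<in> ?H #>\<^bsub>?Q\<^esub> ?q x" using qZ[OF z(1)] by (auto simp: r_coset_def)
    then have "r (?Z #> x) = U"
      using Q.repr_independence[OF _ _ sH, of "?q (z \<otimes> x)" "?q x"] z(2) x q.hom_closed
      by (simp add: r_def)
    then show "U \<in> r ` (rcosets ?Z)" using x(1) by (auto simp: RCOSETS_def)
  qed
  then have "card (rcosets\<^bsub>?Q\<^esub> ?H) \<le> card (rcosets ?Z)"
    using finite_rcosets[OF Zo] by (meson card_image_le card_mono finite_imageI order_trans)
  then obtain K where K: "K \<lhd> ?Q" "card K \<le> residual_bound (card (rcosets ?Z))" "nilpotent_group (?Q Mod K)"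
    using Q.exists_bounded_nilpotent_residual[OF finQ] by blast
  let ?N = "{x \<in> carrier G. ?q x \<in> K}"
  have "subgroup ?N G" by (rule q.subgroup_vimage[OF normal_imp_subgroup[OF K(1)]])
  moreover have "g \<otimes> x \<otimes> inv g \<in> ?N" if g: "g \<in> carrier G" and x: "x \<in> ?N" for g x
  proof -
    have "?q (g \<otimes> x \<otimes> inv g) = ?q g \<otimes>\<^bsub>?Q\<^esub> ?q x \<otimes>\<^bsub>?Q\<^esub> inv\<^bsub>?Q\<^esub> ?q g" using g x by (simp del: mult_FactGroup)
    then show ?thesis using normal.inv_op_closed2[OF K(1) q.hom_closed[OF g]] g x by simp
  qed
  ultimately have N: "?N \<lhd> G" by (simp add: normal_inv_iff)
  have "M \<subseteq> ?N"
  proof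
    fix x assume "x \<in> M"
    then have "?q x = \<one>\<^bsub>?Q\<^esub>" "x \<in> carrier G" using rcoset_eq_self_iff[OF M.subgroup_axioms] by auto
    then show "x \<in> ?N" using subgroup.one_closed[OF normal_imp_subgroup[OF K(1)]] by simp
  qed
  then have No: "open_normal ?N" by (rule normal_open_if_contains[OF M N])
  obtain n where n: "central_above ?Q K n = carrier ?Q" using normal.nilpotent_Mod_iff[OF K(1)] K(3) by blast
  have "central_above G ?N n = {x \<in> carrier G. ?q x \<in> carrier ?Q}"
    using q.central_above_vimage[OF M.coset_image, of K n] unfolding n .
  also have "\<dots> = carrier G" using q.hom_closed by blast
  finally have nil: "central_above G ?N n = carrier G" .
  have finK: "finite K" using finQ subgroup.subset[OF normal_imp_subgroup[OF K(1)]] finite_subset by blast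
  have "card (?q ` ?N) \<le> card K" by (rule card_mono[OF finK]) blast
  then have "card (?q ` ?N) \<le> residual_bound (card (rcosets ?Z))" using K(2) by (rule order_trans)
  then show thesis using that[OF No nil] by blast
qed

text \<open>The intersection \<open>K\<close> of all open normal subgroups with nilpotent quotient is finite because
  its images in the finite quotients have bounded order.\<close>

lemma finite_by_pronilpotent_if_hypercenter_open:
  assumes Z: "openin T (hypercenter G T)"
  shows "finite_by_pronilpotent G T"
proof -
  define \<N> where "\<N> = {N. open_normal N \<and> (\<exists>n. central_above G N n = carrier G)}"
  define K where "K = \<Inter>\<N>"
  let ?r = "residual_bound (card (rcosets (hypercenter G T)))"
  have cN: "carrier G \<in> \<N>"
    using open_normal_carrier by (auto simp: \<N>_def intro: exI[of _ 0])
  have No: "open_normal N" if "N \<in> \<N>" for N using that by (simp add: \<N>_def)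
  have sN: "N \<lhd> G" if "N \<in> \<N>" for N using No[OF that] by (simp add: open_normal_def)
  have KG: "K \<subseteq> carrier G" using cN by (auto simp: K_def)
  have sub: "subgroup K G" unfolding K_def
    by (rule subgroups_Inter) (use cN sN normal_imp_subgroup in auto)
  have "g \<otimes> x \<otimes> inv g \<in> K" if "g \<in> carrier G" "x \<in> K" for g x
    using that normal.inv_op_closed2[OF sN] by (auto simp: K_def)
  then have KN: "K \<lhd> G" using sub by (simp add: normal_inv_iff)
  have Int: "M \<inter> N \<in> \<N>" if MN: "M \<in> \<N>" "N \<in> \<N>" for M N
  proof -
    obtain i j where ij: "central_above G M i = carrier G" "central_above G N j = carrier G"
      using MN by (auto simp: \<N>_def)
    have "carrier G \<subseteq> central_above G M (max i j)" "carrier G \<subseteq> central_above G N (max i j)"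
      using central_above_le[OF sN[OF MN(1)], of i "max i j"]
        central_above_le[OF sN[OF MN(2)], of j "max i j"] ij by auto
    moreover have "central_above G (M \<inter> N) (max i j) \<subseteq> carrier G"
      using subgroup.subset[OF normal_imp_subgroup[OF normal_central_above]]
        normal_subgroup_intersect[OF sN[OF that(1)] sN[OF that(2)]] by blast
    ultimately have "central_above G (M \<inter> N) (max i j) = carrier G" by (auto simp: central_above_Int)
    then show ?thesis using open_normal_Int[OF No No] that by (auto simp: \<N>_def)
  qed
  have fin: "finite K"
  proof (rule ccontr)
    assume "infinite K"
    then obtain F where F: "F \<subseteq> K" "finite F" "card F = Suc ?r"
      using infinite_arbitrarily_large by blast
    have FG: "F \<subseteq> carrier G" using F KG by blast
    \<comment> \<open>An \<open>M\<close> avoiding these quotients separates the elements of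
      \<open>F\<close>, so too many elements of \<open>K\<close> survive in
      \<open>G Mod M\<close>.\<close>
    let ?D = "(\<lambda>(x, y). x \<otimes> inv y) ` {(x, y). x \<in> F \<and> y \<in> F \<and> x \<noteq> y}"
    have finD: "finite ?D"
      by (rule finite_imageI, rule finite_subset[of _ "F \<times> F"]) (use F(2) in auto)
    have DG: "?D \<subseteq> carrier G" using FG by auto
    have D1: "\<one> \<notin> ?D"
    proof
      assume "\<one> \<in> ?D"
      then obtain x y where xy: "x \<in> F" "y \<in> F" "x \<noteq> y" "x \<otimes> inv y = \<one>" by auto
      then have "x = y" using FG by (metis inv_equality inv_inv inv_closed subsetD)
      then show False using xy by simp
    qed
    obtain M where M: "open_normal M" "M \<inter> ?D = {}"
      using separating_open_normal[OF finD DG D1] by blast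
    have sM: "subgroup M G" using M by (simp add: open_normal_def normal_imp_subgroup)
    obtain N n where N: "open_normal N" "central_above G N n = carrier G" "card ((\<lambda>x. M #> x) ` N) \<le> ?r"
      using exists_bounded_nilpotent_quotient[OF Z M(1)] by blast
    have "K \<subseteq> N" using N by (auto simp: K_def \<N>_def)
    then have FN: "F \<subseteq> N" using F(1) by blast
    have "inj_on (\<lambda>x. M #> x) F"
    proof (rule inj_onI, rule ccontr)
      fix x y assume xy: "x \<in> F" "y \<in> F" "M #> x = M #> y" "x \<noteq> y"
      have G: "x \<in> carrier G" "y \<in> carrier G" using xy FG by blast+
      have "x \<otimes> inv y \<in> M" using rcoset_eq_iff[OF sM G] xy(3) by simp
      moreover have "x \<otimes> inv y \<in> ?D" by (rule image_eqI[of _ _ "(x, y)"]) (use xy in auto)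
      ultimately show False using M(2) by blast
    qed
    moreover have "finite ((\<lambda>x. M #> x) ` N)"
    proof (rule finite_subset)
      show "(\<lambda>x. M #> x) ` N \<subseteq> carrier (G Mod M)"
        using N(1) subgroup.subset by (auto simp: carrier_FactGroup open_normal_def dest: normal_imp_subgroup)
    qed (rule finite_quotient[OF M(1)])
    ultimately have "card F \<le> card ((\<lambda>x. M #> x) ` N)"
      using FN by (metis card_image card_mono image_mono)
    then show False using N(3) F(3) by simp
  qed
  have "\<exists>n. central_above G N n = carrier G" if N: "open_normal N" "K \<subseteq> N" for N
  proof -
    have NN: "N \<lhd> G" "openin T N" using N by (auto simp: open_normal_def)
    \<comment> \<open>The open set \<open>N\<close> contains the intersection of the directed family
      \<open>\<N>\<close>, so by compactness it contains a member.\<close>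
    obtain N1 where N1: "N1 \<in> \<N>" "N1 \<subseteq> N"
    proof (rule compact_directed_closed[OF compact, of \<N> N])
      show "\<N> \<noteq> {}" using cN by blast
      show "closedin T A" if "A \<in> \<N>" for A using open_normal_clopen[OF No[OF that]] .
      show "\<exists>C\<in>\<N>. C \<subseteq> A \<inter> B" if "A \<in> \<N>" "B \<in> \<N>" for A B using Int[OF that] by blast
      show "\<Inter>\<N> \<subseteq> N" using N(2) by (simp add: K_def)
    qed (use NN in auto)
    obtain n where "central_above G N1 n = carrier G" using N1(1) by (auto simp: \<N>_def)
    then have "carrier G \<subseteq> central_above G N n" using central_above_mono[OF N1(2)] by metis
    moreover have "central_above G N n \<subseteq> carrier G"
      by (rule subgroup.subset[OF normal_imp_subgroup[OF normal_central_above[OF NN(1)]]])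
    ultimately show ?thesis by blast
  qed
  then show ?thesis using KN fin finite_by_pronilpotent_iff by blast
qed

end

text \<open>Every condition is compared with openness of \<open>Z\<close>, the common pivot of the
  implications.\<close>

theorem theorem3:
  fixes G :: "('a, 'b) monoid_scheme" and T :: "'a topology" and \<mu> :: "'a measure"
  assumes "profinite_group G T"
    and "normalized_haar_measure G T \<mu>"
  defines "Z \<equiv> hypercenter G T"
  shows "(nilpotent_positive G T \<mu> \<longleftrightarrow> nilpotent_bounded_positive G T \<mu>) \<and>
         (nilpotent_bounded_positive G T \<mu> \<longleftrightarrow>
            openin T Z \<and>
            measure \<mu> (Omega G T) = inverse (real (card (rcosets\<^bsub>G\<^esub> Z))) \<and>
            inverse (real (card (rcosets\<^bsub>G\<^esub> Z))) > 0) \<and>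
         (openin T Z \<and>
            measure \<mu> (Omega G T) = inverse (real (card (rcosets\<^bsub>G\<^esub> Z))) \<and>
            inverse (real (card (rcosets\<^bsub>G\<^esub> Z))) > 0 \<longleftrightarrow>
          finite_by_pronilpotent G T)"
proof -
  interpret profinite_haar G T \<mu>
    using assms(1,2) by (simp add: profinite_haar_def)
  have bounded_pos: "nilpotent_bounded_positive G T \<mu> \<Longrightarrow> nilpotent_positive G T \<mu>"
    unfolding nilpotent_bounded_positive_def nilpotent_positive_def by fastforce
  have "openin T Z \<Longrightarrow>
      measure \<mu> (Omega G T) = inverse (real (card (rcosets\<^bsub>G\<^esub> Z))) \<and>
      inverse (real (card (rcosets\<^bsub>G\<^esub> Z))) > 0"
    using measure_Omega unfolding Z_def by simp
  then show ?thesis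
    using bounded_pos hypercenter_open_if_positive bounded_positive_if_open
      hypercenter_open_if_finite_by_pronilpotent finite_by_pronilpotent_if_hypercenter_open
    unfolding Z_def by blast
qed

end
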